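(* Let $\alpha$ be a non-singular direction, and let $\rho\to\infty$ radially in $P^+$ (respectively in $P^-$) with fixed $\arg\rho$. Let $z\neq 0$ be such that $\arg z=\alpha'-\theta-\arg\rho$ for some $\alpha'\in[\alpha]$ and some $\theta$ with $|\theta|<\frac\pi2$, $|\theta+\arg\rho|<\frac\pi2$ (respectively $\arg z=\alpha'-\theta+\pi-\arg\rho$ for some $\alpha'\in[\alpha]$ and some $\theta$ with $|\theta|<\frac\pi2$, $|\theta-\pi+\arg\rho|<\frac\pi2$). Then for every $j$ $$T^{\pm}_{[\alpha],\cdot j}(z,\rho)\longrightarrow\frac1z\int_0^{+\infty e^{i\alpha'}}U_{\cdot j}(\sigma)\,e^{-\sigma/z}\,d\sigma=T_{[\alpha],\cdot j}(z)$$ with sign $+$ (respectively $-$), and consequently the Floquet (respectively co-Floquet) fundamental solution $Y^{\pm}_{[\alpha]}(z,\rho)$ of the confluent family converges to the canonical fundamental solution $\Psi_{[\alpha]}(z)$ of the limit system.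
   Context: Setting. Let $B=\mathrm{diag}(\lambda_1I_{n_1},\dots,\lambda_pI_{n_p})$ with distinct $\lambda_1,\dots,\lambda_p\in\mathbb{C}$, $n=n_1+\dots+n_p$, and let $A=(A_{ij})_{1\le i,j\le p}$ be a complex $n\times n$ matrix partitioned into blocks according to $B$. For any $n\times n$ matrix $X$, $X_{\cdot j}$ is its $j$-th block column. Put $A_D=\mathrm{diag}(A_{11},\dots,A_{pp})$. Standing assumption: for each $j$, no two eigenvalues of $A_{jj}$ differ by a non-zero integer. A scalar $\rho$ added to a matrix means $\rho I$. Limit system: $z^2\frac{d\psi}{dz}=(B+zA)\psi$. Confluent family: $z(z-\frac1\rho B)\frac{dy}{dz}=(B+zA)y$. Formal transformation: $\hat T(z)=\sum_{k\ge0}T^{(k)}z^k$, $T^{(0)}=I$, is the unique formal power series such that $\psi=\hat T(z)\phi$ transforms the limit system to $z^2\frac{d\phi}{dz}=(B+zA_D)\phi$. Put $U_{\cdot j}(s)=\sum_{k\ge0}\frac{T^{(k)}_{\cdot j}}{k!}s^k$, which converges near $s=0$ and extends analytically along paths in $\mathbb{C}\setminus\{\lambda_i-\lambda_j: i\ne j\}$. Directions: $\alpha\in\mathbb{R}$ is non-singular if $e^{i\alpha}\mathbb{R}^+$ contains no $\lambda_i-\lambda_j$, $i\neq j$. $[\alpha]$ is the connected component of $\alpha$ in the set of non-singular directions in $\mathbb{R}$. Canonical solution of the limit system (with a fixed branch of $\log z$): $\Psi_{[\alpha],\cdot j}(z)=T_{[\alpha],\cdot j}(z)\,z^{A_{jj}}e^{-\lambda_j/z}$,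 where $T_{[\alpha],\cdot j}(z)=\frac1z\int_0^{+\infty e^{i\alpha}}U_{\cdot j}(s)e^{-s/z}ds$, on the sector $\bigcup_{\alpha'\in[\alpha]}\{\Re(e^{-i\alpha'}z)>0\}$ (the integral may be taken in any direction $\alpha'\in[\alpha]$ with $\Re(e^{-i\alpha'}z)>0$). Parameter sectors: fix $0<\eta<\frac\pi2$. $P^+$ is the set of $\rho$ with $\arg\rho\in\,]-\pi+\eta,\pi-\eta[$ and $|\rho|$ sufficiently large, so that in particular $\rho\notin-\mathbb{N}_{>0}-(\mathrm{Spec}\,A\cup\mathrm{Spec}\,A_D)$; $P^-$ is the set of $\rho$ with $\arg\rho\in\,]\eta,2\pi-\eta[$ and $|\rho|$ sufficiently large, so that $\rho\notin\mathbb{N}_{>0}-(\mathrm{Spec}\,A\cup\mathrm{Spec}\,A_D)$. Block-diagonalizing transformations: $$T^{\pm}_{[\alpha],\cdot j}(z,\rho)=\int U_{\cdot j}(\sigma)\Big(\frac{\rho z-\lambda_j-\sigma}{\rho z-\lambda_j}\Big)^{A_{jj}+\rho}\frac{d\sigma}{\rho z-\lambda_j-\sigma}\cdot(A_{jj}+\rho),$$ where the power is continued along the path from the value $I$ at $\sigma=0$, and the path is as follows. For $T^+$ ($\rho\in P^+$): a positive real-time trajectory of the vector field $e^{i\theta}(\rho z-\lambda_j-\sigma)\partial_\sigma$ from $0$ to $\rho z-\lambda_j$, with $|\theta|<\frac\pi2$, $|\theta+\arg\rho|<\frac\pi2$, avoiding the singularities of $U_{\cdot j}$, and leaving $0$ in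 a direction $\alpha'\in[\alpha]$, i.e. $\arg(\rho z-\lambda_j)=\alpha'-\theta$. For $T^-$ ($\rho\in P^-$): a positive real-time trajectory of $e^{i(\theta-\pi)}(\rho z-\lambda_j-\sigma)\partial_\sigma$ from $0$ to $\infty$, with $|\theta|<\frac\pi2$, $|\theta-\pi+\arg\rho|<\frac\pi2$, $\arg(\rho z-\lambda_j)=\alpha'-\theta+\pi$, $\alpha'\in[\alpha]$, end-point homotopic to the ray $e^{i\alpha}\mathbb{R}^+$ in $\mathbb{CP}^1\setminus\{\lambda_i-\lambda_j: i\ne j\}$. Solutions of the confluent family: $Y^{\pm}_{[\alpha]}(z,\rho)=T^{\pm}_{[\alpha]}(z,\rho)\,\Phi(z,\rho)$, where $\Phi(z,\rho)=z^{-\rho}(z-\frac B\rho)^{A_D+\rho}$, with the branch chosen so that its $j$-th diagonal block is $z^{A_{jj}}(1-\frac{\lambda_j}{\rho z})^{A_{jj}+\rho}$, the second factor tending to $I$ as $z\to\infty$, and with the same branch of $\log z$ as in $\Psi_{[\alpha]}$. *)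

theory Defs
  imports "HOL-Analysis.Analysis"
begin

text \<open>
  The index type \<open>'n\<close> enumerates the rows and columns, and \<open>blk :: 'n \<Rightarrow> 'p\<close> assigns to an index
  the block it belongs to, so that \<open>n\<^sub>j\<close> is the cardinality of \<open>blk -` {j}\<close>.
  Since \<open>n\<^sub>j\<close> varies with \<open>j\<close>, blocks are kept inside \<open>n \<times> n\<close> matrices: a block column
  has zeros in all other columns, and the diagonal block \<open>A\<^sub>j\<^sub>j\<close> has zeros outside rows and columns
  of block \<open>j\<close>.  The exponential of such a diagonal block is the identity on the
  other blocks; this has no effect, as it is only ever multiplied from the left by a matrix
  supported on block column \<open>j\<close> or restricted to block \<open>(j,j)\<close> again.
\<close>

definition block_col :: "('n::finite \<Rightarrow> 'p::finite) \<Rightarrow> 'p \<Rightarrow> complex^'n^'n \<Rightarrow> complex^'n^'n" where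
  "block_col blk j X = (\<chi> r k. if blk k = j then X $ r $ k else 0)"

definition diag_block :: "('n::finite \<Rightarrow> 'p::finite) \<Rightarrow> 'p \<Rightarrow> complex^'n^'n \<Rightarrow> complex^'n^'n" where
  "diag_block blk j X = (\<chi> r k. if blk r = j \<and> blk k = j then X $ r $ k else 0)"

definition block_diag :: "('n::finite \<Rightarrow> 'p::finite) \<Rightarrow> complex^'n^'n \<Rightarrow> complex^'n^'n" where
  "block_diag blk X = (\<chi> r k. if blk r = blk k then X $ r $ k else 0)"

definition B_mat :: "('n::finite \<Rightarrow> 'p::finite) \<Rightarrow> ('p \<Rightarrow> complex) \<Rightarrow> complex^'n^'n" where
  "B_mat blk lam = (\<chi> r k. if r = k then lam (blk r) else 0)"

definition spec :: "complex^'n^'n::finite \<Rightarrow> complex set" where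
  "spec M = {\<mu>. \<exists>v. v \<noteq> 0 \<and> M *v v = \<mu> *s v}"

text \<open>
  Eigenvectors of the block are required to be supported on the block; otherwise the zero padding
  would contribute a spurious eigenvalue \<open>0\<close>.
\<close>

definition block_spec :: "('n::finite \<Rightarrow> 'p::finite) \<Rightarrow> 'p \<Rightarrow> complex^'n^'n \<Rightarrow> complex set" where
  "block_spec blk j X =
     {\<mu>. \<exists>v. v \<noteq> 0 \<and> (\<forall>k. blk k \<noteq> j \<longrightarrow> v $ k = 0) \<and> diag_block blk j X *v v = \<mu> *s v}"

definition nonresonant :: "('n::finite \<Rightarrow> 'p::finite) \<Rightarrow> complex^'n^'n \<Rightarrow> bool" where
  "nonresonant blk A \<longleftrightarrow>
     (\<forall>j. \<forall>\<mu>\<in>block_spec blk j A. \<forall>\<nu>\<in>block_spec blk j A. \<mu> - \<nu> \<in> \<int> \<longrightarrow> \<mu> = \<nu>)"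

definition mat_scale :: "complex \<Rightarrow> complex^'n^'n::finite \<Rightarrow> complex^'n^'n" where
  "mat_scale c M = map_matrix ((*) c) M"

definition mat_exp :: "complex^'n^'n::finite \<Rightarrow> complex^'n^'n" where
  "mat_exp M = (\<Sum>k. (1 / fact k) *\<^sub>R (((**) M ^^ k) (mat 1)))"

text \<open>The power \<open>c\<^sup>M\<close> for the choice \<open>l\<close> of \<open>log c\<close>.\<close>

definition mat_pow :: "complex \<Rightarrow> complex^'n^'n::finite \<Rightarrow> complex^'n^'n" where
  "mat_pow l M = mat_exp (mat_scale l M)"

text \<open>
  The formal transformation \<open>\<psi> = T \<phi>\<close> turns the limit system into its block diagonal form
  iff \<open>z\<^sup>2 T' + T (B + z A\<^sub>D) = (B + z A) T\<close>.
\<close>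

definition fps_system ::
    "complex^'n^'n::finite \<Rightarrow> complex^'n^'n \<Rightarrow> complex fps^'n^'n" where
  "fps_system B A = map_matrix fps_const B + map_matrix (\<lambda>a. fps_X * fps_const a) A"

definition formal_transformation ::
    "('n::finite \<Rightarrow> 'p::finite) \<Rightarrow> ('p \<Rightarrow> complex) \<Rightarrow> complex^'n^'n \<Rightarrow> complex fps^'n^'n \<Rightarrow> bool" where
  "formal_transformation blk lam A T \<longleftrightarrow>
     map_matrix (\<lambda>f. fps_nth f 0) T = mat 1 \<and>
     map_matrix (\<lambda>f. fps_X ^ 2 * fps_deriv f) T + T ** fps_system (B_mat blk lam) (block_diag blk A)
       = fps_system (B_mat blk lam) A ** T"

definition U_germ ::
    "('n::finite \<Rightarrow> 'p::finite) \<Rightarrow> complex fps^'n^'n \<Rightarrow> 'p \<Rightarrow> complex \<Rightarrow> complex^'n^'n" where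
  "U_germ blk T j s =
     block_col blk j (map_matrix (\<lambda>f. eval_fps (Abs_fps (\<lambda>k. fps_nth f k / fact k)) s) T)"

definition sing :: "('p \<Rightarrow> complex) \<Rightarrow> 'p \<Rightarrow> complex set" where
  "sing lam j = {lam i - lam j | i. i \<noteq> j}"

text \<open>
  Analytic continuation of the germ of \<open>f\<close> at \<open>\<gamma> 0\<close> along \<open>\<gamma> : [0,\<infinity>) \<rightarrow> \<complex>\<close>; \<open>G t\<close> is the
  continued germ at \<open>\<gamma> t\<close> and \<open>u t\<close> its value there.
\<close>

definition continuation_along ::
    "(complex \<Rightarrow> complex^'n^'n::finite) \<Rightarrow> (real \<Rightarrow> complex) \<Rightarrow> (real \<Rightarrow> complex^'n^'n) \<Rightarrow> bool" where
  "continuation_along f \<gamma> u \<longleftrightarrow>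
     (\<exists>G. (\<forall>t\<ge>0. \<forall>r k. (\<lambda>s. G t s $ r $ k) analytic_on {\<gamma> t}) \<and>
          (\<forall>\<^sub>F s in nhds (\<gamma> 0). G 0 s = f s) \<and>
          (\<forall>t\<ge>0. \<forall>\<^sub>F t' in at t within {0..}. \<forall>\<^sub>F s in nhds (\<gamma> t'). G t' s = G t s) \<and>
          (\<forall>t\<ge>0. u t = G t (\<gamma> t)))"

definition nonsingular_dirs :: "('p \<Rightarrow> complex) \<Rightarrow> real set" where
  "nonsingular_dirs lam = {\<alpha>. \<forall>i j. i \<noteq> j \<longrightarrow> \<not> (\<exists>r>0. lam i - lam j = rcis r \<alpha>)}"

definition dir_class :: "('p \<Rightarrow> complex) \<Rightarrow> real \<Rightarrow> real set" where
  "dir_class lam \<alpha> = connected_component_set (nonsingular_dirs lam) \<alpha>"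

text \<open>The integral \<open>(1/z) \<integral>\<^sub>0 U\<^sub>\<cdot>\<^sub>j(s) exp(-s/z) ds\<close> along the ray in direction \<open>\<alpha>'\<close> has the value \<open>V\<close>.\<close>

definition has_laplace_value ::
    "('n::finite \<Rightarrow> 'p::finite) \<Rightarrow> complex fps^'n^'n \<Rightarrow> real \<Rightarrow> 'p \<Rightarrow> complex \<Rightarrow> complex^'n^'n \<Rightarrow> bool" where
  "has_laplace_value blk T \<alpha>' j z V \<longleftrightarrow>
     (\<exists>u I. continuation_along (U_germ blk T j) (\<lambda>t. rcis t \<alpha>') u \<and>
        ((\<lambda>t. mat_scale (exp (- rcis t \<alpha>' / z) * cis \<alpha>') (u t)) has_integral I) {0..} \<and>
        V = mat_scale (1 / z) I)"

definition T_lim ::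
    "('n::finite \<Rightarrow> 'p::finite) \<Rightarrow> ('p \<Rightarrow> complex) \<Rightarrow> complex fps^'n^'n \<Rightarrow> real \<Rightarrow> 'p \<Rightarrow> complex
      \<Rightarrow> complex^'n^'n" where
  "T_lim blk lam T \<alpha> j z =
     (THE V. \<exists>\<alpha>'\<in>dir_class lam \<alpha>. Re (cis (- \<alpha>') * z) > 0 \<and> has_laplace_value blk T \<alpha>' j z V)"

definition log_branch :: "complex set \<Rightarrow> (complex \<Rightarrow> complex) \<Rightarrow> bool" where
  "log_branch S lg \<longleftrightarrow> open S \<and> lg holomorphic_on S \<and> (\<forall>w\<in>S. exp (lg w) = w)"

definition Psi ::
    "('n::finite \<Rightarrow> 'p::finite) \<Rightarrow> ('p \<Rightarrow> complex) \<Rightarrow> complex^'n^'n \<Rightarrow> complex fps^'n^'n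
      \<Rightarrow> (complex \<Rightarrow> complex) \<Rightarrow> real \<Rightarrow> complex \<Rightarrow> complex^'n^'n" where
  "Psi blk lam A T lg \<alpha> z =
     (\<Sum>j\<in>UNIV. mat_scale (exp (- lam j / z))
        (T_lim blk lam T \<alpha> j z ** mat_pow (lg z) (diag_block blk j A)))"

text \<open>
  The sets \<open>P\<^sup>\<plusminus>\<close>, up to the requirement that \<open>\<bar>\<rho>\<bar>\<close> be sufficiently large.
  \<open>Arg\<close> takes values in \<open>]-\<pi>,\<pi>]\<close> and \<open>Arg2pi\<close> in \<open>[0,2\<pi>[\<close>.
\<close>

definition P_plus :: "('n::finite \<Rightarrow> 'p::finite) \<Rightarrow> complex^'n^'n \<Rightarrow> real \<Rightarrow> complex set" where
  "P_plus blk A \<eta> = {\<rho>. \<rho> \<noteq> 0 \<and> Arg \<rho> \<in> {- pi + \<eta> <..< pi - \<eta>} \<and>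
     (\<forall>m::nat. m > 0 \<longrightarrow> (\<forall>\<mu>\<in>spec A \<union> spec (block_diag blk A). \<rho> \<noteq> - of_nat m - \<mu>))}"

definition P_minus :: "('n::finite \<Rightarrow> 'p::finite) \<Rightarrow> complex^'n^'n \<Rightarrow> real \<Rightarrow> complex set" where
  "P_minus blk A \<eta> = {\<rho>. \<rho> \<noteq> 0 \<and> Arg2pi \<rho> \<in> {\<eta> <..< 2 * pi - \<eta>} \<and>
     (\<forall>m::nat. m > 0 \<longrightarrow> (\<forall>\<mu>\<in>spec A \<union> spec (block_diag blk A). \<rho> \<noteq> of_nat m - \<mu>))}"

definition trajectory_from_0 :: "(complex \<Rightarrow> complex) \<Rightarrow> (real \<Rightarrow> complex) \<Rightarrow> bool" where
  "trajectory_from_0 X \<gamma> \<longleftrightarrow>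
     \<gamma> 0 = 0 \<and> (\<forall>t\<ge>0. (\<gamma> has_vector_derivative X (\<gamma> t)) (at t within {0..}))"

text \<open>
  \<open>V\<close> is the value of the integral defining \<open>T\<^sup>\<plusminus>\<close> along the path \<open>\<gamma>\<close>, where \<open>w = \<rho>z - \<lambda>\<^sub>j\<close>;
  \<open>u\<close> is \<open>U\<^sub>\<cdot>\<^sub>j\<close> and \<open>l\<close> the logarithm of \<open>(w - \<sigma>)/w\<close>, both continued along \<open>\<gamma>\<close>.
\<close>

definition has_path_value ::
    "('n::finite \<Rightarrow> 'p::finite) \<Rightarrow> complex^'n^'n \<Rightarrow> complex fps^'n^'n \<Rightarrow> 'p \<Rightarrow> complex \<Rightarrow> complex
      \<Rightarrow> (real \<Rightarrow> complex) \<Rightarrow> complex^'n^'n \<Rightarrow> bool" where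
  "has_path_value blk A T j w \<rho> \<gamma> V \<longleftrightarrow>
     (\<exists>u l I. continuation_along (U_germ blk T j) \<gamma> u \<and>
        continuous_on {0..} l \<and> l 0 = 0 \<and> (\<forall>t\<ge>0. exp (l t) = (w - \<gamma> t) / w) \<and>
        ((\<lambda>t. mat_scale (vector_derivative \<gamma> (at t within {0..}) / (w - \<gamma> t))
               (u t ** mat_pow (l t) (diag_block blk j (A + mat \<rho>)))) has_integral I) {0..} \<and>
        V = I ** diag_block blk j (A + mat \<rho>))"

text \<open>
  \<open>T\<^sup>\<plusminus>\<close> depends on the parameter \<open>\<theta>\<close> of the trajectory (for \<open>T\<^sup>+\<close> its value really does, because
  the spirals for two values of \<open>\<theta>\<close> may be separated by a singularity), so \<open>\<theta>\<close> is an argument.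
\<close>

definition is_T_plus ::
    "('n::finite \<Rightarrow> 'p::finite) \<Rightarrow> ('p \<Rightarrow> complex) \<Rightarrow> complex^'n^'n \<Rightarrow> complex fps^'n^'n
      \<Rightarrow> real \<Rightarrow> real \<Rightarrow> 'p \<Rightarrow> complex \<Rightarrow> complex \<Rightarrow> complex^'n^'n \<Rightarrow> bool" where
  "is_T_plus blk lam A T \<alpha> \<theta> j z \<rho> V \<longleftrightarrow>
     (let w = \<rho> * z - lam j in
        w \<noteq> 0 \<and> \<bar>\<theta>\<bar> < pi / 2 \<and> \<bar>\<theta> + Arg \<rho>\<bar> < pi / 2 \<and>
        (\<exists>\<alpha>'\<in>dir_class lam \<alpha>. w = rcis (cmod w) (\<alpha>' - \<theta>)) \<and>
        (\<exists>\<gamma>. trajectory_from_0 (\<lambda>\<sigma>. cis \<theta> * (w - \<sigma>)) \<gamma> \<and> (\<gamma> \<longlongrightarrow> w) at_top \<and>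
             w \<notin> sing lam j \<and> (\<forall>t\<ge>0. \<gamma> t \<notin> sing lam j) \<and>
             has_path_value blk A T j w \<rho> \<gamma> V))"

definition T_plus ::
    "('n::finite \<Rightarrow> 'p::finite) \<Rightarrow> ('p \<Rightarrow> complex) \<Rightarrow> complex^'n^'n \<Rightarrow> complex fps^'n^'n
      \<Rightarrow> real \<Rightarrow> real \<Rightarrow> 'p \<Rightarrow> complex \<Rightarrow> complex \<Rightarrow> complex^'n^'n" where
  "T_plus blk lam A T \<alpha> \<theta> j z \<rho> = (THE V. is_T_plus blk lam A T \<alpha> \<theta> j z \<rho> V)"

text \<open>
  The projective line \<open>\<complex>\<P>\<^sup>1\<close> is the one-point compactification of \<open>\<complex>\<close>, with \<open>None\<close> as the point
  at infinity; paths \<open>[0,\<infinity>) \<rightarrow> \<complex>\<close> tending to infinity become paths on \<open>[0,1]\<close>.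
\<close>

definition sphere_path :: "(real \<Rightarrow> complex) \<Rightarrow> real \<Rightarrow> complex option" where
  "sphere_path \<gamma> s = (if s < 1 then Some (\<gamma> (s / (1 - s))) else None)"

definition homotopic_to_ray :: "complex set \<Rightarrow> real \<Rightarrow> (real \<Rightarrow> complex) \<Rightarrow> bool" where
  "homotopic_to_ray S \<alpha> \<gamma> \<longleftrightarrow>
     homotopic_with (\<lambda>h. h 0 = Some 0 \<and> h 1 = None) (top_of_set {0..1})
       (subtopology (Alexandroff_compactification euclidean) (- Some ` S))
       (sphere_path \<gamma>) (sphere_path (\<lambda>t. rcis t \<alpha>))"

definition is_T_minus ::
    "('n::finite \<Rightarrow> 'p::finite) \<Rightarrow> ('p \<Rightarrow> complex) \<Rightarrow> complex^'n^'n \<Rightarrow> complex fps^'n^'n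
      \<Rightarrow> real \<Rightarrow> real \<Rightarrow> 'p \<Rightarrow> complex \<Rightarrow> complex \<Rightarrow> complex^'n^'n \<Rightarrow> bool" where
  "is_T_minus blk lam A T \<alpha> \<theta> j z \<rho> V \<longleftrightarrow>
     (let w = \<rho> * z - lam j in
        w \<noteq> 0 \<and> \<bar>\<theta>\<bar> < pi / 2 \<and> \<bar>\<theta> - pi + Arg2pi \<rho>\<bar> < pi / 2 \<and>
        (\<exists>\<alpha>'\<in>dir_class lam \<alpha>. w = rcis (cmod w) (\<alpha>' - \<theta> + pi)) \<and>
        (\<exists>\<gamma>. trajectory_from_0 (\<lambda>\<sigma>. cis (\<theta> - pi) * (w - \<sigma>)) \<gamma> \<and> filterlim \<gamma> at_infinity at_top \<and>
             (\<forall>t\<ge>0. \<gamma> t \<notin> sing lam j) \<and> homotopic_to_ray (sing lam j) \<alpha> \<gamma> \<and>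
             has_path_value blk A T j w \<rho> \<gamma> V))"

definition T_minus ::
    "('n::finite \<Rightarrow> 'p::finite) \<Rightarrow> ('p \<Rightarrow> complex) \<Rightarrow> complex^'n^'n \<Rightarrow> complex fps^'n^'n
      \<Rightarrow> real \<Rightarrow> real \<Rightarrow> 'p \<Rightarrow> complex \<Rightarrow> complex \<Rightarrow> complex^'n^'n" where
  "T_minus blk lam A T \<alpha> \<theta> j z \<rho> = (THE V. is_T_minus blk lam A T \<alpha> \<theta> j z \<rho> V)"

text \<open>
  The principal logarithm of \<open>1 - \<lambda>\<^sub>j/(\<rho>z)\<close> is the branch on the complement of the segment
  \<open>[0, \<lambda>\<^sub>j/\<rho>]\<close> that tends to \<open>0\<close> as \<open>z \<rightarrow> \<infinity>\<close>.
\<close>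

definition Phi ::
    "('n::finite \<Rightarrow> 'p::finite) \<Rightarrow> ('p \<Rightarrow> complex) \<Rightarrow> complex^'n^'n \<Rightarrow> (complex \<Rightarrow> complex)
      \<Rightarrow> complex \<Rightarrow> complex \<Rightarrow> complex^'n^'n" where
  "Phi blk lam A lg z \<rho> =
     (\<Sum>j\<in>UNIV. diag_block blk j
        (mat_pow (lg z) (diag_block blk j A) **
         mat_pow (Ln (1 - lam j / (\<rho> * z))) (diag_block blk j (A + mat \<rho>))))"

text \<open>\<open>Y\<^sup>\<plusminus>\<close>, with the trajectory parameter \<open>\<theta> j\<close> used for block column \<open>j\<close> of \<open>T\<^sup>\<plusminus>\<close>.\<close>

definition Y_plus ::
    "('n::finite \<Rightarrow> 'p::finite) \<Rightarrow> ('p \<Rightarrow> complex) \<Rightarrow> complex^'n^'n \<Rightarrow> complex fps^'n^'n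
      \<Rightarrow> (complex \<Rightarrow> complex) \<Rightarrow> real \<Rightarrow> ('p \<Rightarrow> real) \<Rightarrow> complex \<Rightarrow> complex \<Rightarrow> complex^'n^'n" where
  "Y_plus blk lam A T lg \<alpha> \<theta> z \<rho> =
     (\<Sum>j\<in>UNIV. T_plus blk lam A T \<alpha> (\<theta> j) j z \<rho>) ** Phi blk lam A lg z \<rho>"

definition Y_minus ::
    "('n::finite \<Rightarrow> 'p::finite) \<Rightarrow> ('p \<Rightarrow> complex) \<Rightarrow> complex^'n^'n \<Rightarrow> complex fps^'n^'n
      \<Rightarrow> (complex \<Rightarrow> complex) \<Rightarrow> real \<Rightarrow> ('p \<Rightarrow> real) \<Rightarrow> complex \<Rightarrow> complex \<Rightarrow> complex^'n^'n" where
  "Y_minus blk lam A T lg \<alpha> \<theta> z \<rho> =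
     (\<Sum>j\<in>UNIV. T_minus blk lam A T \<alpha> (\<theta> j) j z \<rho>) ** Phi blk lam A lg z \<rho>"

end

theory Submission
  imports Defs "HOL-Complex_Analysis.Conformal_Mappings" "HOL-Real_Asymp.Real_Asymp"
begin

text \<open>
  The function \<open>U = U\<^sub>\<cdot>\<^sub>j\<close> satisfies \<open>(B - \<lambda>\<^sub>j - s) U' = U A\<^sub>j\<^sub>j - A U\<close> near \<open>0\<close>.  In the variable \<open>log s\<close>
  this is a linear system with bounded coefficients on \<open>{Re > M} \<union> {Im \<in> [\<alpha>]}\<close>, away from the edges of
  the strip, where \<open>exp M\<close> exceeds all \<open>\<bar>\<lambda>\<^sub>i - \<lambda>\<^sub>k\<bar>\<close>; hence \<open>U\<close> continues to this domain and grows at most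
  polynomially there.  For large \<open>\<rho>\<close> the trajectories that define \<open>T\<^sup>\<plusminus>\<close> lift to the domain: they
  follow a ray in a direction of \<open>[\<alpha>]\<close> until they have passed all the singularities.  In the rescaled
  time \<open>x = \<bar>\<rho>\<bar> t\<close> the power becomes \<open>exp (- e\<^sup>i\<^sup>\<theta> e\<^sup>i\<^sup>\<phi> x)\<close>, where \<open>\<phi> = arg \<rho>\<close> for \<open>T\<^sup>+\<close> and
  \<open>\<phi> = arg \<rho> - \<pi>\<close> for \<open>T\<^sup>-\<close>, up to a factor tending
  to \<open>I\<close>, so dominated convergence yields the Laplace integral.
\<close>

subsection \<open>Matrices and the matrix exponential\<close>

text \<open>The trajectories are spirals that change with \<rho>, and those of T^- may wind around
  the origin without end on their way to infinity. So U has to be controlled on infinitely many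
  sheets and not just in a sector. In the logarithmic plane these sheets form a single domain. It is
  starlike about any point common to the half-plane and the strip, so a linear system can be solved
  on all of it at once, with Gronwall bounds along segments. The resulting bound involves |Im
  \<zeta>|, the winding, as well as the logarithm of the modulus. In rescaled time both together
  stay below \<delta> x + C with \<delta> as small as desired, which any exponential decay absorbs.
  The objects in the statement are definite descriptions, so limits alone are not enough: continued
  germs and logarithms along a path must be shown unique, and the Laplace integral independent of
  the direction in [\<alpha>]. Both signs are treated together by a parameter h, with 1 - 2h as the
  sign.\<close>

lemma bounded_bilinear_matrix_mult:
  "bounded_bilinear ((**) :: complex^'n::finite^'n \<Rightarrow> complex^'n^'n \<Rightarrow> complex^'n^'n)"
proof -
  have "bilinear ((**) :: complex^'n::finite^'n \<Rightarrow> complex^'n^'n \<Rightarrow> complex^'n^'n)"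
    unfolding bilinear_def
    by (auto intro!: linearI simp: vec_eq_iff matrix_matrix_mult_def algebra_simps
        sum.distrib scaleR_sum_right)
  then show ?thesis by (simp add: bilinear_conv_bounded_bilinear)
qed

lemma bounded_bilinear_mat_scale:
  "bounded_bilinear (mat_scale :: complex \<Rightarrow> complex^'n::finite^'n \<Rightarrow> complex^'n^'n)"
proof -
  have "bilinear (mat_scale :: complex \<Rightarrow> complex^'n::finite^'n \<Rightarrow> complex^'n^'n)"
    unfolding bilinear_def
    by (auto intro!: linearI simp: vec_eq_iff mat_scale_def map_matrix_def algebra_simps)
  then show ?thesis by (simp add: bilinear_conv_bounded_bilinear)
qed

lemma mat_scale_nth [simp]: "mat_scale c X $ r $ s = c * X $ r $ s"
  by (simp add: mat_scale_def map_matrix_def)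

lemma block_col_nth [simp]: "block_col blk j X $ r $ s = (if blk s = j then X $ r $ s else 0)"
  by (simp add: block_col_def)

lemma diag_block_nth [simp]:
  "diag_block blk j X $ r $ s = (if blk r = j \<and> blk s = j then X $ r $ s else 0)"
  by (simp add: diag_block_def)

lemma matrix_mult_nth: "(X ** Y) $ r $ s = (\<Sum>q\<in>UNIV. X $ r $ q * Y $ q $ s)"
  by (simp add: matrix_matrix_mult_def)

lemma mat_scale_mult_left: "mat_scale c X ** Y = mat_scale c (X ** Y)"
  by (simp add: vec_eq_iff matrix_mult_nth sum_distrib_left mult.assoc)

lemma mat_scale_mult_right: "X ** mat_scale c Y = mat_scale c (X ** Y)"
  by (simp add: vec_eq_iff matrix_mult_nth sum_distrib_left mult_ac)

lemma mat_scale_scale [simp]: "mat_scale c (mat_scale d X) = mat_scale (c * d) X"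
  by (simp add: vec_eq_iff)

lemma mat_scale_1 [simp]: "mat_scale 1 X = X"
  by (simp add: vec_eq_iff)

lemma matrix_norm_le_sum:
  fixes X :: "complex^'n::finite^'n"
  shows "norm X \<le> (\<Sum>r\<in>UNIV. \<Sum>s\<in>UNIV. norm (X $ r $ s))"
proof -
  have "norm X \<le> (\<Sum>r\<in>UNIV. norm (X $ r))"
    unfolding norm_vec_def by (rule L2_set_le_sum) simp
  also have "\<dots> \<le> (\<Sum>r\<in>UNIV. \<Sum>s\<in>UNIV. norm (X $ r $ s))"
    unfolding norm_vec_def[where 'a=complex] by (intro sum_mono L2_set_le_sum) simp
  finally show ?thesis .
qed

lemma matrix_norm_mono:
  fixes X Y :: "complex^'n::finite^'n"
  assumes "\<And>r s. norm (X $ r $ s) \<le> norm (Y $ r $ s)"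
  shows "norm X \<le> norm Y"
  by (intro norm_le_componentwise_cart) (simp add: assms)

lemma matrix_entry_norm_le: "norm (X $ r $ s) \<le> norm (X :: complex^'n::finite^'n)"
  by (meson Finite_Cartesian_Product.norm_nth_le order_trans)

lemma norm_mat_scale: "norm (mat_scale c X) = norm c * norm (X :: complex^'n::finite^'n)"
proof -
  have 1: "norm (mat_scale c X $ r) = norm c * norm (X $ r)" for r
    unfolding norm_vec_def by (simp add: norm_mult L2_set_right_distrib)
  show ?thesis
    unfolding norm_vec_def[of "mat_scale c X"] norm_vec_def[of X] 1
    by (simp add: L2_set_right_distrib)
qed

lemma norm_block_col_le: "norm (block_col blk j X) \<le> norm (X :: complex^'n::finite^'n)"
  by (rule matrix_norm_mono) auto

lemma tendsto_matrixI:
  assumes "\<And>r s. ((\<lambda>x. f x $ r $ s) \<longlongrightarrow> L $ r $ s) F"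
  shows "(f \<longlongrightarrow> (L :: complex^'n::finite^'n)) F"
  by (intro vec_tendstoI assms)

lemma continuous_on_matrixI:
  fixes f :: "'a::topological_space \<Rightarrow> complex^'n::finite^'n"
  assumes "\<And>r s. continuous_on S (\<lambda>x. f x $ r $ s)"
  shows "continuous_on S f"
  using assms unfolding continuous_on_def by (auto intro!: tendsto_matrixI)

lemma has_vector_derivative_matrixI:
  fixes f :: "real \<Rightarrow> complex^'n::finite^'n"
  assumes "\<And>r s. ((\<lambda>t. f t $ r $ s) has_vector_derivative f' $ r $ s) (at t within S)"
  shows "(f has_vector_derivative f') (at t within S)"
  using assms unfolding has_vector_derivative_def has_derivative_def
  by (auto intro!: tendsto_matrixI bounded_linear_scaleR_left simp: Let_def)

section \<open>Powers and the exponential of a matrix, entry by entry\<close>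

definition mat_power :: "complex^'n^'n::finite \<Rightarrow> nat \<Rightarrow> complex^'n^'n" where
  "mat_power M k = ((**) M ^^ k) (mat 1)"

lemma mat_power_0 [simp]: "mat_power M 0 = mat 1"
  and mat_power_Suc [simp]: "mat_power M (Suc k) = M ** mat_power M k"
  by (simp_all add: mat_power_def)

lemma mat_power_scale: "mat_power (mat_scale c M) k = mat_scale (c ^ k) (mat_power M k)"
  by (induction k) (simp_all add: mat_scale_mult_left mat_scale_mult_right mult.commute)

lemma add_mat_mult: "(X + mat c) ** Y = X ** Y + mat_scale c Y"
proof -
  have "(mat c ** Y) $ r $ s = mat_scale c Y $ r $ s" for r s
    by (simp add: matrix_mult_nth mat_def mult_delta_left)
  then have "mat c ** Y = mat_scale c Y" by (simp add: vec_eq_iff)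
  then show ?thesis
    by (simp add: bounded_bilinear.add_left[OF bounded_bilinear_matrix_mult])
qed

text \<open>The norm is the Euclidean norm of the entries. The crude factor comes from n^2 entries,
  each a sum of n products; all that matters is that it does not depend on the matrices.\<close>

lemma norm_matrix_mult_le:
  fixes X Y :: "complex^'n::finite^'n"
  shows "norm (X ** Y) \<le> norm X * norm Y * real CARD('n) ^ 3"
proof -
  have "norm ((X ** Y) $ r $ s) \<le> (\<Sum>q\<in>(UNIV :: 'n set). norm X * norm Y)" for r s
    unfolding matrix_mult_nth
    by (intro order_trans[OF norm_sum] sum_mono)
      (simp add: norm_mult mult_mono matrix_entry_norm_le)
  then have "norm (X ** Y) \<le> (\<Sum>r\<in>(UNIV :: 'n set). \<Sum>s\<in>(UNIV :: 'n set). \<Sum>q\<in>(UNIV :: 'n set). norm X * norm Y)"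
    by (intro order_trans[OF matrix_norm_le_sum] sum_mono)
  also have "\<dots> = norm X * norm Y * real CARD('n) ^ 3"
    by (simp add: power3_eq_cube)
  finally show ?thesis .
qed

lemma norm_mat_power_le:
  fixes M :: "complex^'n::finite^'n"
  shows "norm (mat_power M k) \<le> norm (mat 1 :: complex^'n^'n) * (real CARD('n) ^ 3 * norm M) ^ k"
proof (induction k)
  case (Suc k)
  have "norm (mat_power M (Suc k)) \<le> norm M * norm (mat_power M k) * real CARD('n) ^ 3"
    using norm_matrix_mult_le by simp
  also have "\<dots> \<le> norm M * (norm (mat 1 :: complex^'n^'n) * (real CARD('n) ^ 3 * norm M) ^ k)
       * real CARD('n) ^ 3"
    by (intro mult_right_mono mult_left_mono Suc) simp_all
  finally show ?case by (simp add: mult_ac)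
qed simp

lemma mat_exp_sums_norm:
  fixes M :: "complex^'n::finite^'n"
  shows "summable (\<lambda>k. norm ((1 / fact k) *\<^sub>R mat_power M k))" (is ?A)
    and "norm (mat_exp M) \<le> norm (mat 1 :: complex^'n^'n) * exp (real CARD('n) ^ 3 * norm M)" (is ?B)
proof -
  let ?K = "real CARD('n) ^ 3 * norm M" and ?I = "norm (mat 1 :: complex^'n^'n)"
  have s: "(\<lambda>k. ?I * (?K ^ k /\<^sub>R fact k)) sums (?I * exp ?K)"
    by (intro sums_mult exp_converges)
  have le: "norm ((1 / fact k) *\<^sub>R mat_power M k) \<le> ?I * (?K ^ k /\<^sub>R fact k)" for k
    using norm_mat_power_le[of M k] by (simp add: divide_simps)
  show ?A
    by (rule summable_comparison_test[OF _ sums_summable[OF s]]) (use le in auto)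
  then show ?B
    unfolding mat_exp_def mat_power_def[symmetric] sums_unique[OF s]
    by (intro order_trans[OF summable_norm] suminf_le le sums_summable[OF s])
qed

lemma mat_exp_sums: "(\<lambda>k. (1 / fact k) *\<^sub>R mat_power M k) sums mat_exp M"
  unfolding mat_exp_def mat_power_def[symmetric]
  by (rule summable_sums[OF summable_norm_cancel[OF mat_exp_sums_norm(1)]])

lemma mat_exp_nth_sums: "(\<lambda>k. mat_power M k $ r $ s / fact k) sums (mat_exp M $ r $ s)"
proof -
  have "(\<lambda>k. ((1 / fact k) *\<^sub>R mat_power M k) $ r $ s) sums (mat_exp M $ r $ s)"
    by (intro sums_vec_nth mat_exp_sums)
  moreover have "((1 / fact k) *\<^sub>R mat_power M k) $ r $ s = mat_power M k $ r $ s / fact k" for k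
    unfolding vector_scaleR_component by (simp add: scaleR_conv_of_real)
  ultimately show ?thesis by simp
qed

lemma norm_mat_pow_le:
  fixes M :: "complex^'n::finite^'n"
  shows "norm (mat_pow l M)
    \<le> norm (mat 1 :: complex^'n^'n) * exp (real CARD('n) ^ 3 * norm M * norm l)"
  using mat_exp_sums_norm(2)[of "mat_scale l M"] by (simp add: mat_pow_def norm_mat_scale mult_ac)

lemma mat_pow_nth_sums:
  "(\<lambda>k. (mat_power M k $ r $ s / fact k) * l ^ k) sums (mat_pow l M $ r $ s)"
  using mat_exp_nth_sums[of "mat_scale l M" r s] by (simp add: mat_pow_def mat_power_scale mult_ac)

lemma continuous_on_mat_pow: "continuous_on UNIV (\<lambda>l. mat_pow l M)"
proof (rule continuous_on_matrixI)
  fix r s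
  have eq: "(\<lambda>l. mat_pow l M $ r $ s) = (\<lambda>l. \<Sum>k. (mat_power M k $ r $ s / fact k) * l ^ k)"
    by (rule ext, rule sums_unique[OF mat_pow_nth_sums])
  have "isCont (\<lambda>l. \<Sum>k. (mat_power M k $ r $ s / fact k) * l ^ k) l" for l
    by (rule isCont_powser_converges_everywhere) (use mat_pow_nth_sums in \<open>auto simp: sums_iff\<close>)
  then show "continuous_on UNIV (\<lambda>l. mat_pow l M $ r $ s)"
    unfolding eq by (simp add: continuous_on_eq_continuous_at)
qed

lemma mat_pow_0 [simp]: "mat_pow 0 M = mat 1"
proof -
  have "mat_pow 0 M $ r $ s = mat 1 $ r $ s" for r s
    using sums_unique2[OF mat_pow_nth_sums[of M r s 0] powser_sums_zero[of "\<lambda>k. mat_power M k $ r $ s / fact k"]]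
    by simp
  then show ?thesis by (simp add: vec_eq_iff)
qed

text \<open>The binomial formula for M and a commuting scalar matrix, divided by k! so that it reads
  as a Cauchy product. Both sides obey the same recursion in k.\<close>

lemma mat_power_add_mat:
  fixes M :: "complex^'n::finite^'n"
  shows "mat_power (M + mat c) k $ r $ s / fact k
    = (\<Sum>i\<le>k. (mat_power M i $ r $ s / fact i) * (c ^ (k - i) / fact (k - i)))"
proof (induction k arbitrary: r s)
  case (Suc k)
  define p where "p i r s = mat_power M i $ r $ s / fact i" for i r s
  define e where "e i = c ^ i / fact i" for i
  define q where "q k r s = (\<Sum>i\<le>k. p i r s * e (k - i))" for k r s
  have p_Suc: "of_nat (Suc i) * p (Suc i) r s = (\<Sum>t\<in>UNIV. M $ r $ t * p i t s)" for i r s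
    by (simp add: p_def matrix_mult_nth sum_divide_distrib sum_distrib_left del: of_nat_Suc)
  have e_Suc: "of_nat (Suc i) * e (Suc i) = c * e i" for i
    by (simp add: e_def divide_simps del: of_nat_Suc)
  have IH: "mat_power (M + mat c) k $ r $ s = fact k * q k r s" for r s
    using Suc by (simp add: q_def p_def e_def field_simps)
  \<comment> \<open>Leibniz rule on coefficients: the weight k + 1 splits into i and k + 1 - i, and
    each part lowers the index of one factor.\<close>
  have "of_nat (Suc k) * q (Suc k) r s
      = (\<Sum>i\<le>Suc k. of_nat i * p i r s * e (Suc k - i)) + (\<Sum>i\<le>Suc k. p i r s * (of_nat (Suc k - i) * e (Suc k - i)))"
    unfolding q_def sum_distrib_left sum.distrib[symmetric]
  proof (intro sum.cong refl)
    fix i assume "i \<in> {..Suc k}"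
    then have "(of_nat (Suc k) :: complex) = of_nat i + of_nat (Suc k - i)"
      by (simp flip: of_nat_add)
    then show "of_nat (Suc k) * (p i r s * e (Suc k - i)) =
        of_nat i * p i r s * e (Suc k - i) + p i r s * (of_nat (Suc k - i) * e (Suc k - i))"
      by (simp add: ring_distribs mult_ac del: of_nat_Suc)
  qed
  also have "(\<Sum>i\<le>Suc k. of_nat i * p i r s * e (Suc k - i)) = (\<Sum>i\<le>k. of_nat (Suc i) * p (Suc i) r s * e (k - i))"
    by (subst sum.atMost_Suc_shift) simp
  also have "\<dots> = (\<Sum>t\<in>UNIV. M $ r $ t * q k t s)"
    unfolding p_Suc q_def sum_distrib_right sum_distrib_left by (subst sum.swap) (simp add: mult_ac)
  also have "(\<Sum>i\<le>Suc k. p i r s * (of_nat (Suc k - i) * e (Suc k - i))) = (\<Sum>i\<le>k. p i r s * (of_nat (Suc (k - i)) * e (Suc (k - i))))"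
    by (simp add: Suc_diff_le del: of_nat_Suc of_nat_diff)
  also have "\<dots> = c * q k r s"
    unfolding e_Suc q_def sum_distrib_left by (simp add: mult_ac)
  finally have "of_nat (Suc k) * q (Suc k) r s = (\<Sum>t\<in>UNIV. M $ r $ t * q k t s) + c * q k r s" .
  moreover have "mat_power (M + mat c) (Suc k) $ r $ s = fact k * ((\<Sum>t\<in>UNIV. M $ r $ t * q k t s) + c * q k r s)"
    by (simp add: add_mat_mult, simp add: matrix_mult_nth IH ring_distribs sum_distrib_left mult_ac)
  ultimately have "mat_power (M + mat c) (Suc k) $ r $ s = fact (Suc k) * q (Suc k) r s"
    by simp
  then have "mat_power (M + mat c) (Suc k) $ r $ s / fact (Suc k) = q (Suc k) r s"
    by (metis fact_nonzero nonzero_mult_div_cancel_left)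
  then show ?case unfolding q_def p_def e_def .
qed (simp add: mat_def)

lemma mat_exp_add_mat: "mat_exp (M + mat c) = mat_scale (exp c) (mat_exp M)"
proof -
  have "mat_exp (M + mat c) $ r $ s = mat_exp M $ r $ s * exp c" for r s
  proof -
    have "summable (\<lambda>k. norm (mat_power M k $ r $ s / fact k))"
    proof (rule summable_comparison_test[OF _ mat_exp_sums_norm(1)[of M]], intro exI allI impI)
      fix k show "norm (norm (mat_power M k $ r $ s / fact k)) \<le> norm ((1 / fact k) *\<^sub>R mat_power M k)"
        using matrix_entry_norm_le[of "mat_power M k" r s] by (simp add: norm_divide divide_simps)
    qed
    moreover have "summable (\<lambda>k. norm (c ^ k / fact k))"
      using summable_norm_exp[of c] by (simp add: scaleR_conv_of_real field_simps norm_divide norm_mult)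
    moreover have "(\<lambda>k. c ^ k / fact k) sums exp c"
      using exp_converges[of c] by (simp add: scaleR_conv_of_real field_simps)
    ultimately have "(\<lambda>k. \<Sum>i\<le>k. (mat_power M i $ r $ s / fact i) * (c ^ (k - i) / fact (k - i)))
        sums (mat_exp M $ r $ s * exp c)"
      using Cauchy_product_sums[of "\<lambda>k. mat_power M k $ r $ s / fact k" "\<lambda>k. c ^ k / fact k"]
        mat_exp_nth_sums[of M r s] by (simp add: sums_iff)
    then show ?thesis
      using mat_exp_nth_sums[of "M + mat c" r s] unfolding mat_power_add_mat by (rule sums_unique2[symmetric])
  qed
  then show ?thesis by (simp add: vec_eq_iff mult.commute)
qed

text \<open>\<open>Q\<close> describes matrices on which \<open>X\<close> and \<open>Y\<close> act
  alike from the right, and it is stable under \<open>Y\<close>, so all powers act alike. With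
  \<open>Q\<close> as support in one block column, a zero-padded block can be traded for the block
  plus a full scalar matrix.\<close>

lemma mult_mat_power_cong:
  assumes "Q u" and "\<And>u. Q u \<Longrightarrow> u ** X = u ** Y" and "\<And>u. Q u \<Longrightarrow> Q (u ** Y)"
  shows "u ** mat_power X k = u ** mat_power Y k"
  using assms(1)
proof (induction k arbitrary: u)
  case (Suc k)
  have "u ** mat_power X (Suc k) = (u ** Y) ** mat_power X k"
    by (simp add: matrix_mul_assoc assms(2)[OF Suc.prems])
  also have "\<dots> = (u ** Y) ** mat_power Y k"
    by (rule Suc.IH[OF assms(3)[OF Suc.prems]])
  finally show ?case by (simp add: matrix_mul_assoc)
qed simp

lemma mult_mat_exp_cong:
  fixes u :: "complex^'n::finite^'n"
  assumes "Q u" and "\<And>u. Q u \<Longrightarrow> u ** X = u ** Y" and "\<And>u. Q u \<Longrightarrow> Q (u ** Y)"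
  shows "u ** mat_exp X = u ** mat_exp Y"
proof -
  have 1: "(\<lambda>k. u ** ((1 / fact k) *\<^sub>R mat_power X k)) sums (u ** mat_exp X)" for X
    by (intro bounded_linear.sums[OF bounded_bilinear.bounded_linear_right[OF bounded_bilinear_matrix_mult]] mat_exp_sums)
  have 2: "u ** ((1 / fact k) *\<^sub>R mat_power X k) = u ** ((1 / fact k) *\<^sub>R mat_power Y k)" for k
    by (simp add: bounded_bilinear.scaleR_right[OF bounded_bilinear_matrix_mult] mult_mat_power_cong[of Q, OF assms])
  show ?thesis using 1[of X] 1[of Y] unfolding 2 by (rule sums_unique2)
qed

text \<open>On block column \<open>j\<close> the padded matrix \<open>A\<^sub>j\<^sub>j + \<rho>\<close> acts like \<open>A\<^sub>j\<^sub>j + \<rho> I\<close>.\<close>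

lemma block_col_mult_mat_pow:
  fixes u A :: "complex^'n::finite^'n"
  assumes u: "block_col blk j u = u"
  shows "u ** mat_pow l (diag_block blk j (A + mat \<rho>))
    = mat_scale (exp (l * \<rho>)) (u ** mat_pow l (diag_block blk j A))"
proof -
  let ?D = "diag_block blk j A"
  have "u ** mat_exp (mat_scale l (diag_block blk j (A + mat \<rho>))) = u ** mat_exp (mat_scale l ?D + mat (l * \<rho>))"
  proof (rule mult_mat_exp_cong[where Q = "\<lambda>u. block_col blk j u = u", OF u])
    fix u :: "complex^'n^'n" assume "block_col blk j u = u"
    then have 0: "blk s \<noteq> j \<Longrightarrow> u $ r $ s = 0" for r s
      by (metis block_col_nth)
    show "u ** mat_scale l (diag_block blk j (A + mat \<rho>)) = u ** (mat_scale l ?D + mat (l * \<rho>))"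
      using 0 by (auto simp: vec_eq_iff matrix_mult_nth mat_def algebra_simps intro!: sum.cong)
    have "(u ** (mat_scale l ?D + mat (l * \<rho>))) $ r $ s = 0" if "blk s \<noteq> j" for r s
      unfolding matrix_mult_nth by (intro sum.neutral) (use that 0 in \<open>auto simp: mat_def\<close>)
    then show "block_col blk j (u ** (mat_scale l ?D + mat (l * \<rho>))) = u ** (mat_scale l ?D + mat (l * \<rho>))"
      by (simp add: vec_eq_iff)
  qed
  then show ?thesis
    by (simp add: mat_pow_def mat_exp_add_mat mat_scale_mult_right)
qed

subsection \<open>Linear differential equations on starlike domains\<close>

lemma starlike_primitive:
  assumes "open S" "a \<in> S" "\<And>z. z \<in> S \<Longrightarrow> closed_segment a z \<subseteq> S" "h holomorphic_on S"
  shows "\<exists>g. g a = 0 \<and> (\<forall>z\<in>S. (g has_field_derivative h z) (at z))"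
proof -
  have "starlike S" using assms by (auto simp: starlike_def)
  then obtain g where "\<forall>z\<in>S. (g has_field_derivative h z) (at z)"
    using holomorphic_starlike_primitive[of S h "{}"] assms
    by (metis DiffD1 finite.emptyI holomorphic_on_imp_continuous_on holomorphic_on_imp_differentiable_at)
  then show ?thesis
    by (intro exI[of _ "\<lambda>z. g z - g a"]) (auto intro!: derivative_eq_intros)
qed

text \<open>\<open>D n\<close> is the n-th term of the Picard series, an n-fold iterated integral
  along the segment; integrating a bound in t^n once more produces the factorial.\<close>

lemma picard_bound:
  fixes M :: "'m::finite \<Rightarrow> 'm \<Rightarrow> complex \<Rightarrow> complex"
  assumes D0: "\<And>i z. D 0 i z = v i" and Da: "\<And>n i. D (Suc n) i a = 0"
    and D': "\<And>n i z. z \<in> S \<Longrightarrow> (D (Suc n) i has_field_derivative (\<Sum>k\<in>UNIV. M i k z * D n k z)) (at z)"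
    and seg: "closed_segment a y \<subseteq> S"
    and K: "\<And>i z. z \<in> closed_segment a y \<Longrightarrow> (\<Sum>k\<in>UNIV. norm (M i k z)) \<le> K"
    and V: "\<And>i. norm (v i) \<le> V"
    and t: "t \<in> {0..1}"
  shows "norm (D n i (a + of_real t * (y - a))) \<le> V * (K * norm (y - a) * t) ^ n / fact n"
  using t
proof (induction n arbitrary: i t)
  case 0
  then show ?case using V[of i] by (simp add: D0)
next
  case (Suc n)
  let ?p = "\<lambda>s. a + of_real s * (y - a)"
  have pS: "?p s \<in> closed_segment a y" if "s \<in> {0..1}" for s
    using that by (auto simp: closed_segment_def intro!: exI[of _ s] simp: algebra_simps scaleR_conv_of_real)
  have V0: "0 \<le> V" using V[of undefined] norm_ge_zero order_trans by blast
  have K0: "0 \<le> K"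
    using K[of a undefined] by (meson ends_in_segment(1) norm_ge_zero order_trans sum_nonneg)
  show ?case
  proof (cases "t = 0")
    case True then show ?thesis by (simp add: Da)
  next
    case False
    define f where "f s = D (Suc n) i (?p s)" for s
    define f' where "f' s = (y - a) * (\<Sum>k\<in>UNIV. M i k (?p s) * D n k (?p s))" for s
    \<comment> \<open>The claimed bound as a function of s. Its derivative is the induction
      hypothesis times K and the length of the segment, so it suffices to compare
      derivatives.\<close>
    define \<phi> where "\<phi> s = V * (K * norm (y - a) * s) ^ Suc n / fact (Suc n)" for s
    define \<phi>' where "\<phi>' s = V * (K * norm (y - a)) * (K * norm (y - a) * s) ^ n / fact n" for s
    have f': "(f has_vector_derivative f' s) (at s)" if "s \<in> {0..1}" for s
    proof -
      have "(?p has_vector_derivative (y - a)) (at s)"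
        by (auto intro!: derivative_eq_intros simp: has_vector_derivative_def scaleR_conv_of_real)
      from field_vector_diff_chain_at[OF this D'[of "?p s"]] show ?thesis
        using pS[OF that] seg by (auto simp: f_def[abs_def] f'_def o_def)
    qed
    have \<phi>': "(\<phi> has_vector_derivative \<phi>' s) (at s)" for s
    proof -
      have "(\<phi> has_real_derivative \<phi>' s) (at s)"
        unfolding \<phi>_def \<phi>'_def
        by (rule derivative_eq_intros refl | simp add: divide_simps del: of_nat_Suc power_Suc)+
      then show ?thesis by (simp add: has_real_derivative_iff_has_vector_derivative)
    qed
    have "norm (f t - f 0) \<le> \<phi> t - \<phi> 0"
    proof (rule differentiable_bound_general)
      show "0 < t" using False Suc.prems by auto
      show "continuous_on {0..t} f"
        by (intro continuous_at_imp_continuous_on ballI has_vector_derivative_continuous[OF f'])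
          (use Suc.prems in auto)
      show "continuous_on {0..t} \<phi>"
        by (intro continuous_at_imp_continuous_on ballI has_vector_derivative_continuous[OF \<phi>'])
      fix s assume s: "0 < s" "s < t"
      then have s1: "s \<in> {0..1}" using Suc.prems by auto
      show "(f has_vector_derivative f' s) (at s)" by (rule f'[OF s1])
      show "(\<phi> has_vector_derivative \<phi>' s) (at s)" by (rule \<phi>')
      let ?b = "V * (K * norm (y - a) * s) ^ n / fact n"
      have "norm (\<Sum>k\<in>UNIV. M i k (?p s) * D n k (?p s)) \<le> (\<Sum>k\<in>UNIV. norm (M i k (?p s)) * ?b)"
         
        by (intro order_trans[OF norm_sum] sum_mono, unfold norm_mult) (intro mult_left_mono Suc.IH s1 norm_ge_zero)
      also have "\<dots> \<le> K * ?b"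
        unfolding sum_distrib_right[symmetric]
        by (intro mult_right_mono K pS s1) (use V0 K0 s1 in auto)
      finally have "norm (f' s) \<le> norm (y - a) * (K * ?b)"
        unfolding f'_def norm_mult by (intro mult_left_mono) auto
      then show "norm (f' s) \<le> \<phi>' s" by (simp add: \<phi>'_def mult_ac)
    qed
    then show ?thesis by (simp add: f_def \<phi>_def Da)
  qed
qed

text \<open>On a starlike set every holomorphic function has a global primitive, so the Picard
  operator never needs a smaller domain. Linearity makes the series converge everywhere, since the
  factorials beat any bound on the coefficients.\<close>

lemma linear_ode_starlike:
  fixes M :: "'m::finite \<Rightarrow> 'm \<Rightarrow> complex \<Rightarrow> complex"
  assumes S: "open S" "a \<in> S" and star: "\<And>z. z \<in> S \<Longrightarrow> closed_segment a z \<subseteq> S"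
    and hol: "\<And>i k. M i k holomorphic_on S"
  shows "\<exists>x. (\<forall>i. x i a = v i) \<and>
    (\<forall>i. \<forall>z\<in>S. (x i has_field_derivative (\<Sum>k\<in>UNIV. M i k z * x k z)) (at z))"
proof -
  define P where "P h = (SOME g. g a = 0 \<and> (\<forall>z\<in>S. (g has_field_derivative h z) (at z)))" for h
  have P: "P h a = 0 \<and> (\<forall>z\<in>S. (P h has_field_derivative h z) (at z))" if "h holomorphic_on S" for h
  proof -
    have "\<exists>g. g a = 0 \<and> (\<forall>z\<in>S. (g has_field_derivative h z) (at z))"
      by (rule starlike_primitive[OF S _ that]) (rule star)
    from someI_ex[OF this] show ?thesis unfolding P_def .
  qed
  define D where "D = rec_nat (\<lambda>i z. v i) (\<lambda>_ d i. P (\<lambda>z. \<Sum>k\<in>UNIV. M i k z * d k z))"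
  have D0: "D 0 i z = v i" for i z by (simp add: D_def)
  have DSuc: "D (Suc n) i = P (\<lambda>z. \<Sum>k\<in>UNIV. M i k z * D n k z)" for n i by (simp add: D_def)
  have D_hol: "D n i holomorphic_on S" for n i
  proof (induction n arbitrary: i)
    case 0
    have "D 0 i = (\<lambda>z. v i)" by (auto simp: D0)
    then show ?case by simp
  next
    case (Suc n)
    have "(\<lambda>z. \<Sum>k\<in>UNIV. M i k z * D n k z) holomorphic_on S"
      by (intro holomorphic_intros hol Suc)
    from P[OF this] show ?case
      unfolding DSuc[symmetric] using S(1) holomorphic_on_open by blast
  qed
  have Ph: "(\<lambda>z. \<Sum>k\<in>UNIV. M i k z * D n k z) holomorphic_on S" for n i
    by (intro holomorphic_intros hol D_hol)
  have Da: "D (Suc n) i a = 0" for n i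
    unfolding DSuc using P[OF Ph] by (rule conjunct1)
  have D': "(D (Suc n) i has_field_derivative (\<Sum>k\<in>UNIV. M i k z * D n k z)) (at z)" if "z \<in> S" for n i z
    unfolding DSuc by (rule P[OF Ph, THEN conjunct2, THEN bspec, OF that])
  define V where "V = (\<Sum>i\<in>UNIV. norm (v i))"
  have V: "norm (v i) \<le> V" for i unfolding V_def by (intro member_le_sum) auto
  have V0: "0 \<le> V" unfolding V_def by (simp add: sum_nonneg)
  \<comment> \<open>The termwise derivative of the Picard series; the term of index 0 is the
    constant initial value.\<close>
  define f' where "f' n i z = (case n of 0 \<Rightarrow> 0 | Suc n \<Rightarrow> (\<Sum>k\<in>UNIV. M i k z * D n k z))" for n i z
  have f': "(D n i has_field_derivative f' n i z) (at z)" if "z \<in> S" for n i z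
  proof (cases n)
    case 0
    have "D 0 i = (\<lambda>z. v i)" by (auto simp: D0)
    then show ?thesis by (simp add: 0 f'_def)
  qed (use D'[OF that] in \<open>simp add: f'_def\<close>)
  have loc: "\<exists>d h. 0 < d \<and> summable h \<and> (\<forall>\<^sub>F n in sequentially. \<forall>y\<in>ball z d \<inter> S. norm (D n i y) \<le> h n)"
    if "z \<in> S" for z i
  proof -
    obtain d where d: "0 < d" "cball z d \<subseteq> S"
      using \<open>z \<in> S\<close> S(1) open_contains_cball by blast
    \<comment> \<open>The segments from \<open>a\<close> to points near \<open>z\<close> sweep out a
      compact subset of \<open>S\<close>. Its coefficient bound \<open>K\<close> makes the Picard
      bound uniform near \<open>z\<close>, as termwise differentiation requires.\<close>
    define C where "C = (\<lambda>(y, t). a + of_real t * (y - a)) ` (cball z d \<times> {0..1::real})"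
    have "compact C"
      unfolding C_def case_prod_unfold
      by (intro compact_continuous_image continuous_intros compact_Times) auto
    have seg_C: "closed_segment a y \<subseteq> C" if "y \<in> cball z d" for y
    proof
      fix x assume "x \<in> closed_segment a y"
      then obtain t where "0 \<le> t" "t \<le> 1" "x = (1 - t) *\<^sub>R a + t *\<^sub>R y"
        by (auto simp: closed_segment_def)
      then show "x \<in> C" unfolding C_def using that
        by (intro image_eqI[of _ _ "(y, t)"]) (auto simp: algebra_simps scaleR_conv_of_real)
    qed
    have "C \<subseteq> S"
    proof
      fix x assume "x \<in> C"
      then obtain y t where yt: "y \<in> cball z d" "0 \<le> t" "t \<le> 1" "x = a + of_real t * (y - a)"
        by (auto simp: C_def)
      then have "x \<in> closed_segment a y"
        by (auto simp: closed_segment_def intro!: exI[of _ t] simp: algebra_simps scaleR_conv_of_real)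
      then show "x \<in> S" by (rule subsetD[OF star[OF subsetD[OF d(2) yt(1)]]])
    qed
    have "continuous_on C (\<lambda>x. \<Sum>i\<in>UNIV. \<Sum>k\<in>UNIV. norm (M i k x))"
      by (intro continuous_intros continuous_on_subset[OF holomorphic_on_imp_continuous_on[OF hol] \<open>C \<subseteq> S\<close>])
    then have "bounded ((\<lambda>x. \<Sum>i\<in>UNIV. \<Sum>k\<in>UNIV. norm (M i k x)) ` C)"
      using \<open>compact C\<close> by (intro compact_imp_bounded compact_continuous_image)
    then obtain K where K: "\<And>x. x \<in> C \<Longrightarrow> \<bar>\<Sum>i\<in>UNIV. \<Sum>k\<in>UNIV. norm (M i k x)\<bar> \<le> K" "0 < K"
      unfolding bounded_pos by auto
    have K1: "(\<Sum>k\<in>UNIV. norm (M i k x)) \<le> K" if "x \<in> C" for i x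
    proof -
      have "(\<Sum>k\<in>UNIV. norm (M i k x)) \<le> (\<Sum>i\<in>UNIV. \<Sum>k\<in>UNIV. norm (M i k x))"
        by (rule member_le_sum[where f = "\<lambda>i. \<Sum>k\<in>UNIV. norm (M i k x)"]) (auto intro: sum_nonneg)
      then show ?thesis using K(1)[OF that] by linarith
    qed
    define e where "e = norm (z - a) + d"
    show ?thesis
    proof (intro exI conjI always_eventually allI ballI)
      show "0 < d" by fact
      show "summable (\<lambda>n. V * ((K * e) ^ n /\<^sub>R fact n))"
        by (intro summable_mult summable_exp_generic)
      fix n y assume y: "y \<in> ball z d \<inter> S"
      have "norm (D n i (a + of_real 1 * (y - a))) \<le> V * (K * norm (y - a) * 1) ^ n / fact n"
        by (rule picard_bound[where S = S and M = M and v = v, OF D0 Da D'])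
          (use y star V K1 seg_C[of y] in auto)
      also have "\<dots> \<le> V * (K * e) ^ n / fact n"
      proof -
        have "norm (y - a) \<le> norm (y - z) + norm (z - a)" using norm_triangle_ineq[of "y - z" "z - a"] by simp
        then have "norm (y - a) \<le> e" using y by (simp add: e_def dist_norm norm_minus_commute)
        then show ?thesis using V0 K(2)
          by (intro divide_right_mono mult_left_mono power_mono) auto
      qed
      finally show "norm (D n i y) \<le> V * ((K * e) ^ n /\<^sub>R fact n)" by (simp add: field_simps)
    qed
  qed
  define Q where "Q i g g' \<longleftrightarrow> (\<forall>z\<in>S. (\<lambda>n. D n i z) sums g z \<and> (\<lambda>n. f' n i z) sums g' z \<and>
    (g has_field_derivative g' z) (at z))" for i g g'
  have "\<exists>g g'. Q i g g'" for i
    unfolding Q_def by (rule series_and_derivative_comparison_local[OF S(1) f' loc])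
  then obtain g g' where "\<And>i. Q i (g i) (g' i)" by metis
  then have gg: "\<forall>i. \<forall>z\<in>S. (\<lambda>n. D n i z) sums g i z \<and> (\<lambda>n. f' n i z) sums g' i z \<and>
    (g i has_field_derivative g' i z) (at z)"
    unfolding Q_def by (rule allI)
  note gz = bspec[OF spec[OF gg]]
  have g: "(\<lambda>n. D n i z) sums g i z" "(\<lambda>n. f' n i z) sums g' i z"
    "(g i has_field_derivative g' i z) (at z)" if "z \<in> S" for i z
    by (rule gz[OF that, THEN conjunct1] gz[OF that, THEN conjunct2, THEN conjunct1]
        gz[OF that, THEN conjunct2, THEN conjunct2])+
  have g': "g' i z = (\<Sum>k\<in>UNIV. M i k z * g k z)" if "z \<in> S" for i z
  proof -
    have "(\<lambda>n. \<Sum>k\<in>UNIV. M i k z * D n k z) sums (\<Sum>k\<in>UNIV. M i k z * g k z)"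
      by (intro sums_sum sums_mult g that)
    then have "(\<lambda>n. f' (Suc n) i z) sums (\<Sum>k\<in>UNIV. M i k z * g k z)" by (simp add: f'_def)
    then have "(\<lambda>n. f' n i z) sums (\<Sum>k\<in>UNIV. M i k z * g k z)" by (subst (asm) sums_Suc_iff) (simp add: f'_def)
    with g(2)[OF that] show ?thesis by (rule sums_unique2)
  qed
  have "g i a = v i" for i
  proof -
    have "(\<lambda>n. D n i a) = (\<lambda>n. if n = 0 then v i else 0)"
    proof
      fix n show "D n i a = (if n = 0 then v i else 0)" by (cases n) (simp_all add: D0 Da)
    qed
    then have "(\<lambda>n. D n i a) sums v i" using sums_single[of 0 "\<lambda>_. v i"] by simp
    with g(1)[OF S(2)] show ?thesis by (rule sums_unique2)
  qed
  moreover have "(g i has_field_derivative (\<Sum>k\<in>UNIV. M i k z * g k z)) (at z)" if "z \<in> S" for i z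
    using g(3)[OF that] unfolding g'[OF that] .
  ultimately show ?thesis by (intro exI[of _ g] conjI allI ballI)
qed

text \<open>The function |f|^2 exp(-2Kt) does not increase. Squaring avoids differentiating the norm
  at zeros of f.\<close>

lemma gronwall_linear:
  fixes f :: "real \<Rightarrow> 'a::real_inner"
  assumes f': "\<And>t. t \<in> {0..1} \<Longrightarrow> (f has_vector_derivative f' t) (at t)"
    and K: "\<And>t. t \<in> {0..1} \<Longrightarrow> norm (f' t) \<le> K * norm (f t)"
  shows "norm (f 1) \<le> norm (f 0) * exp K"
proof -
  define g where "g t = (f t \<bullet> f t) * exp (- 2 * K * t)" for t
  have "g 1 \<le> g 0"
  proof (rule DERIV_nonpos_imp_nonincreasing[of 0 1])
    fix t :: real assume t: "0 \<le> t" "t \<le> 1"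
    have fd: "(f has_derivative (\<lambda>h. h *\<^sub>R f' t)) (at t)"
      using f'[of t] t by (simp add: has_vector_derivative_def)
    have "((\<lambda>t. f t \<bullet> f t) has_derivative (\<lambda>h. h * (2 * (f t \<bullet> f' t)))) (at t)"
      by (rule has_derivative_eq_rhs[OF has_derivative_inner[OF fd fd]])
        (auto simp: fun_eq_iff inner_commute)
    then have "((\<lambda>t. f t \<bullet> f t) has_real_derivative 2 * (f t \<bullet> f' t)) (at t)"
      by (simp add: has_field_derivative_def mult.commute[of _ "2 * (f t \<bullet> f' t)"] cong: if_cong)
    then have "(g has_real_derivative (2 * (f t \<bullet> f' t) - 2 * K * (f t \<bullet> f t)) * exp (- 2 * K * t)) (at t)"
      unfolding g_def by (auto intro!: derivative_eq_intros simp: algebra_simps)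
    moreover have "2 * (f t \<bullet> f' t) - 2 * K * (f t \<bullet> f t) \<le> 0"
    proof -
      have "f t \<bullet> f' t \<le> norm (f t) * norm (f' t)" by (rule norm_cauchy_schwarz)
      also have "\<dots> \<le> norm (f t) * (K * norm (f t))" using K t by (intro mult_left_mono) auto
      also have "\<dots> = K * (f t \<bullet> f t)" by (simp add: dot_square_norm power2_eq_square)
      finally show ?thesis by simp
    qed
    ultimately show "\<exists>y. (g has_real_derivative y) (at t) \<and> y \<le> 0"
      by (meson exp_ge_zero mult_nonpos_nonneg)
  qed simp
  then have "(norm (f 1))\<^sup>2 * exp (- 2 * K) \<le> (norm (f 0))\<^sup>2"
    by (simp add: g_def dot_square_norm)
  then have "(norm (f 1))\<^sup>2 \<le> (norm (f 0) * exp K)\<^sup>2"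
    by (simp add: power_mult_distrib exp_minus divide_simps flip: exp_double)
  then show ?thesis by (simp add: power2_le_iff_abs_le)
qed

text \<open>
  \<open>U' = c\<^sub>r (U D - A U)\<close> in row \<open>r\<close>: the shape that \<open>(B - \<lambda>\<^sub>j - s) U' = U A\<^sub>j\<^sub>j - A U\<close> takes both in the
  variable \<open>s\<close> and in the variable \<open>log s\<close>.
\<close>

definition solves_system :: "('n::finite \<Rightarrow> complex \<Rightarrow> complex) \<Rightarrow> complex^'n^'n \<Rightarrow> complex^'n^'n
    \<Rightarrow> complex set \<Rightarrow> (complex \<Rightarrow> complex^'n^'n) \<Rightarrow> bool" where
  "solves_system c A D S V \<longleftrightarrow> (\<forall>z\<in>S. \<forall>r s.
     ((\<lambda>z. V z $ r $ s) has_field_derivative c r z * (V z ** D - A ** V z) $ r $ s) (at z))"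

text \<open>A matrix is a vector indexed by pairs, and \<open>M\<close> is the coefficient matrix of
  X to c (X D - A X) in these coordinates, so the vector-valued existence result applies.\<close>

lemma solves_system_exists:
  fixes A D :: "complex^'n::finite^'n"
  assumes S: "open S" "a \<in> S" and star: "\<And>z. z \<in> S \<Longrightarrow> closed_segment a z \<subseteq> S"
    and hol: "\<And>r. c r holomorphic_on S"
  shows "\<exists>V. V a = v \<and> solves_system c A D S V"
proof -
  define M where "M i k z = c (fst i) z * ((if fst k = fst i then D $ snd k $ snd i else 0)
    - (if snd k = snd i then A $ fst i $ fst k else 0))" for i k :: "'n \<times> 'n" and z
  have M: "M i k holomorphic_on S" for i k
    unfolding M_def by (intro holomorphic_intros hol)
  have "\<exists>x. (\<forall>i. x i a = v $ fst i $ snd i) \<and>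
    (\<forall>i. \<forall>z\<in>S. (x i has_field_derivative (\<Sum>k\<in>UNIV. M i k z * x k z)) (at z))"
    by (rule linear_ode_starlike[OF S _ M]) (rule star)
  then obtain x where x: "\<And>i. x i a = v $ fst i $ snd i"
    "\<And>i z. z \<in> S \<Longrightarrow> (x i has_field_derivative (\<Sum>k\<in>UNIV. M i k z * x k z)) (at z)"
    by metis
  define V where "V z = (\<chi> r s. x (r, s) z)" for z
  have "(\<Sum>k\<in>UNIV. M (r, s) k z * x k z) = c r z * (V z ** D - A ** V z) $ r $ s" for r s z
  proof -
    have "(\<Sum>k\<in>UNIV. M (r, s) k z * x k z) = (\<Sum>p\<in>UNIV. \<Sum>q\<in>UNIV. M (r, s) (p, q) z * x (p, q) z)"
      by (simp add: sum.cartesian_product case_prod_unfold)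
    also have "\<dots> = c r z * ((\<Sum>p\<in>UNIV. \<Sum>q\<in>UNIV. if p = r then D $ q $ s * x (p, q) z else 0)
      - (\<Sum>p\<in>UNIV. \<Sum>q\<in>UNIV. if q = s then A $ r $ p * x (p, q) z else 0))"
      unfolding sum_subtractf[symmetric] sum_distrib_left
      by (intro sum.cong refl) (auto simp: M_def algebra_simps)
    also have "(\<Sum>p\<in>UNIV. \<Sum>q\<in>UNIV. if p = r then D $ q $ s * x (p, q) z else 0) = (V z ** D) $ r $ s"
      by (subst sum.swap) (simp add: matrix_mult_nth V_def mult.commute)
    also have "(\<Sum>p\<in>UNIV. \<Sum>q\<in>UNIV. if q = s then A $ r $ p * x (p, q) z else 0) = (A ** V z) $ r $ s"
      by (simp add: matrix_mult_nth V_def)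
    finally show ?thesis by simp
  qed
  note eqM = this
  have "((\<lambda>z. V z $ r $ s) has_field_derivative c r z * (V z ** D - A ** V z) $ r $ s) (at z)"
    if "z \<in> S" for r s z
  proof -
    have "(\<lambda>z. V z $ r $ s) = x (r, s)" by (simp add: V_def)
    then show ?thesis using x(2)[OF that, of "(r, s)"] unfolding eqM by simp
  qed
  then have "solves_system c A D S V"
    unfolding solves_system_def by simp
  moreover have "V a = v" by (simp add: V_def x vec_eq_iff)
  ultimately show ?thesis by blast
qed

text \<open>Gronwall along the segment. The exponent is linear in its length; when the variable is
  log s, this becomes polynomial growth in s.\<close>

lemma solves_system_growth:
  fixes A D :: "complex^'n::finite^'n"
  assumes V: "solves_system c A D S V" and seg: "closed_segment a b \<subseteq> S"
    and \<kappa>: "\<And>r z. z \<in> closed_segment a b \<Longrightarrow> norm (c r z) \<le> \<kappa>"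
  shows "norm (V b) \<le> norm (V a) * exp (\<kappa> * ((norm D + norm A) * real CARD('n) ^ 3) * norm (b - a))"
proof -
  define N where "N = (norm D + norm A) * real CARD('n) ^ 3"
  define p where "p t = a + of_real t * (b - a)" for t
  define f' where "f' t = (\<chi> r s. (b - a) * (c r (p t) * (V (p t) ** D - A ** V (p t)) $ r $ s))" for t
  have "0 \<le> norm (c undefined a)" by simp
  then have \<kappa>0: "0 \<le> \<kappa>" using \<kappa>[of a] by (meson ends_in_segment(1) order_trans)
  have p: "p t \<in> closed_segment a b" if "t \<in> {0..1}" for t
    using that by (auto simp: p_def closed_segment_def intro!: exI[of _ t] simp: algebra_simps scaleR_conv_of_real)
  have "norm ((V \<circ> p) 1) \<le> norm ((V \<circ> p) 0) * exp (\<kappa> * N * norm (b - a))"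
  proof (rule gronwall_linear)
    fix t :: real assume t: "t \<in> {0..1}"
    have pd: "(p has_vector_derivative (b - a)) (at t)"
      unfolding p_def by (auto intro!: derivative_eq_intros simp: has_vector_derivative_def scaleR_conv_of_real)
    have "((\<lambda>t. (V \<circ> p) t $ r $ s) has_vector_derivative f' t $ r $ s) (at t)" for r s
      using field_vector_diff_chain_at[OF pd, of "\<lambda>z. V z $ r $ s"] V p[OF t] seg
      unfolding solves_system_def f'_def o_def by auto
    then show "((V \<circ> p) has_vector_derivative f' t) (at t)"
      by (rule has_vector_derivative_matrixI)
    have "norm (f' t) \<le> norm (mat_scale (of_real (norm (b - a) * \<kappa>)) (V (p t) ** D - A ** V (p t)))"
    proof (rule matrix_norm_mono)
      fix r s
      show "norm (f' t $ r $ s) \<le> norm (mat_scale (of_real (norm (b - a) * \<kappa>)) (V (p t) ** D - A ** V (p t)) $ r $ s)"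
        using \<kappa>[OF p[OF t], of r] \<kappa>0
        by (simp add: f'_def norm_mult mult.assoc mult_left_mono mult_right_mono
          del: vector_minus_component)
    qed
    also have "\<dots> = norm (b - a) * \<kappa> * norm (V (p t) ** D - A ** V (p t))"
      using \<kappa>0 by (simp add: norm_mat_scale norm_mult)
    also have "\<dots> \<le> norm (b - a) * \<kappa> * (norm (V (p t)) * N)"
    proof (intro mult_left_mono)
      show "norm (V (p t) ** D - A ** V (p t)) \<le> norm (V (p t)) * N"
      using norm_triangle_ineq4[of "V (p t) ** D" "A ** V (p t)"] norm_matrix_mult_le[of "V (p t)" D]
        norm_matrix_mult_le[of A "V (p t)"]
      by (simp add: N_def algebra_simps)
    qed (use \<kappa>0 in auto)
    finally show "norm (f' t) \<le> \<kappa> * N * norm (b - a) * norm ((V \<circ> p) t)"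
      by (simp add: mult_ac)
  qed
  then show ?thesis by (simp add: p_def N_def)
qed

lemma solves_system_diff:
  assumes "solves_system c A D S V" "solves_system c A D S W"
  shows "solves_system c A D S (\<lambda>z. V z - W z)"
  unfolding solves_system_def
proof (intro ballI allI)
  fix z r s assume "z \<in> S"
  have eq: "(V z - W z) ** D - A ** (V z - W z) = (V z ** D - A ** V z) - (W z ** D - A ** W z)"
    by (simp add: bounded_bilinear.diff_left[OF bounded_bilinear_matrix_mult]
        bounded_bilinear.diff_right[OF bounded_bilinear_matrix_mult])
  have "((\<lambda>z. V z $ r $ s - W z $ r $ s) has_field_derivative
      c r z * (V z ** D - A ** V z) $ r $ s - c r z * (W z ** D - A ** W z) $ r $ s) (at z)"
    using assms \<open>z \<in> S\<close> unfolding solves_system_def by (intro DERIV_diff) auto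
  then show "((\<lambda>z. (V z - W z) $ r $ s) has_field_derivative
      c r z * ((V z - W z) ** D - A ** (V z - W z)) $ r $ s) (at z)"
    unfolding eq by (simp add: algebra_simps)
qed

text \<open>The difference of two solutions solves the same system and starts at 0, so the growth
  bound kills it. The coefficient bound comes from compactness of the segment.\<close>

lemma solves_system_unique:
  fixes A D :: "complex^'n::finite^'n"
  assumes V: "solves_system c A D S V" "solves_system c A D S W" and "V a = W a"
    and hol: "\<And>r. c r holomorphic_on S" and seg: "closed_segment a b \<subseteq> S"
  shows "V b = W b"
proof -
  have "continuous_on (closed_segment a b) (\<lambda>z. \<Sum>r\<in>UNIV. norm (c r z))"
    by (intro continuous_intros continuous_on_subset[OF holomorphic_on_imp_continuous_on[OF hol] seg])
  then have "bounded ((\<lambda>z. \<Sum>r\<in>UNIV. norm (c r z)) ` closed_segment a b)"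
    by (intro compact_imp_bounded compact_continuous_image) auto
  then obtain K where K: "\<And>z. z \<in> closed_segment a b \<Longrightarrow> \<bar>\<Sum>r\<in>UNIV. norm (c r z)\<bar> \<le> K"
    unfolding bounded_pos by auto
  have K1: "norm (c r z) \<le> K" if "z \<in> closed_segment a b" for r z
  proof -
    have "norm (c r z) \<le> (\<Sum>r\<in>UNIV. norm (c r z))"
      by (rule member_le_sum[where f = "\<lambda>r. norm (c r z)"]) auto
    then show ?thesis using K[OF that] by linarith
  qed
  from solves_system_growth[OF solves_system_diff[OF V] seg K1] assms(3)
  show ?thesis by simp
qed

subsection \<open>Convergence of the Borel transform\<close>

definition borel_coeff :: "('n::finite \<Rightarrow> 'p::finite) \<Rightarrow> complex fps^'n^'n \<Rightarrow> 'p \<Rightarrow> nat \<Rightarrow> complex^'n^'n" where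
  "borel_coeff blk T j k = block_col blk j (\<chi> r s. fps_nth (T $ r $ s) k / fact k)"

lemma U_germ_nth:
  "U_germ blk T j z $ r $ s = eval_fps (Abs_fps (\<lambda>k. borel_coeff blk T j k $ r $ s)) z"
proof (cases "blk s = j")
  case False
  then have "Abs_fps (\<lambda>k. borel_coeff blk T j k $ r $ s) = 0"
    by (simp add: borel_coeff_def fps_eq_iff)
  then show ?thesis using False by (simp add: U_germ_def)
qed (simp add: U_germ_def borel_coeff_def map_matrix_def)

lemma matrix_system_norm_le:
  fixes X D A :: "complex^'n::finite^'n"
  shows "norm (X ** D - A ** X) \<le> norm X * ((norm D + norm A) * real CARD('n) ^ 3)"
  using norm_triangle_ineq4[of "X ** D" "A ** X"] norm_matrix_mult_le[of X D] norm_matrix_mult_le[of A X]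
  by (simp add: algebra_simps)

text \<open>Compare the coefficients of z^(k+1) in the formal equation and divide by k!. The
  derivative term yields k u_k, and (k+1)!/k! yields the factor k + 1. The result is the
  differential equation of U read off at s^k.\<close>

lemma borel_coeff_rec:
  fixes blk :: "'n::finite \<Rightarrow> 'p::finite"
    and j :: 'p
  assumes T: "formal_transformation blk lam A T"
  defines "u \<equiv> borel_coeff blk T j" and "D \<equiv> diag_block blk j A"
  shows "(lam (blk r) - lam j) * of_nat (Suc k) * u (Suc k) $ r $ s
    = of_nat k * u k $ r $ s + (u k ** D - A ** u k) $ r $ s"
proof (cases "blk s = j")
  case False
  then have "(u k ** D) $ r $ s = 0" "(A ** u k) $ r $ s = 0"
    unfolding matrix_mult_nth by (auto intro!: sum.neutral simp: u_def borel_coeff_def D_def)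
  then show ?thesis using False by (simp add: u_def borel_coeff_def)
next
  case True
  define t where "t k r s = fps_nth (T $ r $ s) k" for k r s
  have tu: "t k r q = fact k * u k $ r $ q" if "blk q = j" for k r q
    using that by (simp add: t_def u_def borel_coeff_def)
  have "map_matrix (\<lambda>f. fps_X ^ 2 * fps_deriv f) T + T ** fps_system (B_mat blk lam) (block_diag blk A)
       = fps_system (B_mat blk lam) A ** T"
    using T by (simp add: formal_transformation_def)
  then have "fps_nth ((map_matrix (\<lambda>f. fps_X ^ 2 * fps_deriv f) T
      + T ** fps_system (B_mat blk lam) (block_diag blk A)) $ r $ s) (Suc k)
    = fps_nth ((fps_system (B_mat blk lam) A ** T) $ r $ s) (Suc k)" by simp
  moreover have "fps_nth ((T ** fps_system (B_mat blk lam) (block_diag blk A)) $ r $ s) (Suc k)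
      = lam j * t (Suc k) r s + fact k * (u k ** D) $ r $ s"
  proof -
    have "fps_nth ((T ** fps_system (B_mat blk lam) (block_diag blk A)) $ r $ s) (Suc k)
      = (\<Sum>q\<in>UNIV. (if q = s then lam j * t (Suc k) r q else 0) + t k r q * block_diag blk A $ q $ s)"
      unfolding matrix_matrix_mult_def
      by (simp add: fps_sum_nth fps_system_def map_matrix_def B_mat_def True t_def ring_distribs
          mult_ac fps_mult_left_const_nth)
        (intro sum.cong refl, auto simp: True t_def mult_ac fps_mult_left_const_nth)
    also have "\<dots> = lam j * t (Suc k) r s + (\<Sum>q\<in>UNIV. t k r q * block_diag blk A $ q $ s)"
      by (simp add: sum.distrib)
    also have "(\<Sum>q\<in>UNIV. t k r q * block_diag blk A $ q $ s) = (\<Sum>q\<in>UNIV. fact k * (u k $ r $ q * D $ q $ s))"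
      by (intro sum.cong refl) (auto simp: block_diag_def D_def True tu)
    finally show ?thesis by (simp add: matrix_mult_nth sum_distrib_left)
  qed
  moreover have "fps_nth ((fps_system (B_mat blk lam) A ** T) $ r $ s) (Suc k)
      = lam (blk r) * t (Suc k) r s + fact k * (A ** u k) $ r $ s"
  proof -
    have "fps_nth ((fps_system (B_mat blk lam) A ** T) $ r $ s) (Suc k)
      = (\<Sum>q\<in>UNIV. (if q = r then lam (blk r) * t (Suc k) q s else 0) + A $ r $ q * t k q s)"
      unfolding matrix_matrix_mult_def
      by (simp add: fps_sum_nth fps_system_def map_matrix_def B_mat_def t_def ring_distribs
          mult.assoc fps_mult_left_const_nth)
        (intro sum.cong refl, auto simp: t_def mult_ac fps_mult_left_const_nth)
    also have "\<dots> = lam (blk r) * t (Suc k) r s + (\<Sum>q\<in>UNIV. A $ r $ q * t k q s)"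
      by (simp add: sum.distrib)
    also have "(\<Sum>q\<in>UNIV. A $ r $ q * t k q s) = (\<Sum>q\<in>UNIV. fact k * (A $ r $ q * u k $ q $ s))"
      by (intro sum.cong refl) (auto simp: True tu)
    finally show ?thesis by (simp add: matrix_mult_nth sum_distrib_left)
  qed
  moreover have "fps_nth (map_matrix (\<lambda>f. fps_X ^ 2 * fps_deriv f) T $ r $ s) (Suc k) = of_nat k * t k r s"
    by (cases k) (simp_all add: map_matrix_def t_def fps_X_power_mult_nth)
  ultimately have "of_nat k * t k r s + (lam j * t (Suc k) r s + fact k * (u k ** D) $ r $ s)
    = lam (blk r) * t (Suc k) r s + fact k * (A ** u k) $ r $ s" by simp
  then have "fact k * (of_nat k * u k $ r $ s + (lam j * of_nat (Suc k) * u (Suc k) $ r $ s + (u k ** D) $ r $ s))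
    = fact k * (lam (blk r) * of_nat (Suc k) * u (Suc k) $ r $ s + (A ** u k) $ r $ s)"
    unfolding tu[OF True] by (simp add: algebra_simps)
  then have "of_nat k * u k $ r $ s + (lam j * of_nat (Suc k) * u (Suc k) $ r $ s + (u k ** D) $ r $ s)
    = lam (blk r) * of_nat (Suc k) * u (Suc k) $ r $ s + (A ** u k) $ r $ s"
    by (simp del: of_nat_Suc)
  then show ?thesis by (simp add: algebra_simps del: of_nat_Suc)
qed

text \<open>
  For \<open>r\<close> outside block \<open>j\<close> the recursion bounds \<open>u\<^sub>k\<^sub>+\<^sub>1\<close> by \<open>u\<^sub>k\<close>.  In the rows of block \<open>j\<close> its left-hand
  side vanishes, and for large \<open>k\<close> the term \<open>k u\<^sub>k\<close> forces these rows to be dominated by the others.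
\<close>

lemma borel_coeff_growth:
  fixes blk :: "'n::finite \<Rightarrow> 'p::finite"
    and j :: 'p
  assumes T: "formal_transformation blk lam A T" and inj: "inj lam"
  defines "u \<equiv> borel_coeff blk T j"
  shows "\<exists>L>0. \<exists>k0. \<forall>k\<ge>k0. norm (u (Suc k)) \<le> L * norm (u k)"
proof -
  define D where "D = diag_block blk j A"
  define N where "N = (norm D + norm A) * real CARD('n) ^ 3"
  have N: "norm (X ** D - A ** X) \<le> norm X * N" for X
    unfolding N_def by (rule matrix_system_norm_le)
  have N0: "0 \<le> N" by (simp add: N_def)
  note rec = borel_coeff_rec[OF T, where j = j, folded u_def D_def]
  \<comment> \<open>Rows of block j contribute 1/0 = 0; the summand 1 keeps \<open>\<kappa>\<close>
    positive even if there are no other rows.\<close>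
  define \<kappa> where "\<kappa> = 1 + (\<Sum>r\<in>UNIV. 1 / norm (lam (blk r) - lam j))"
  have \<kappa>: "1 / norm (lam (blk r) - lam j) \<le> \<kappa>" for r
  proof -
    have "1 / norm (lam (blk r) - lam j) \<le> (\<Sum>r\<in>UNIV. 1 / norm (lam (blk r) - lam j))"
      by (rule member_le_sum[where f = "\<lambda>r. 1 / norm (lam (blk r) - lam j)"]) auto
    then show ?thesis by (simp add: \<kappa>_def)
  qed
  have \<kappa>0: "0 < \<kappa>" unfolding \<kappa>_def by (intro add_pos_nonneg sum_nonneg) auto
  define P Q where "P k = (\<chi> r s. if blk r = j then u k $ r $ s else 0)"
    and "Q k = (\<chi> r s. if blk r = j then 0 else u k $ r $ s)" for k
  have PQ: "u k = P k + Q k" for k by (simp add: P_def Q_def vec_eq_iff)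
  \<comment> \<open>The factor 2 prepares |u| \<le> |P| + |Q| \<le> 2 |Q|; the squared cardinality
    comes from summing over the entries.\<close>
  define L where "L = 2 * (real CARD('n) * real CARD('n) * (\<kappa> * (1 + N)))"
  have L0: "0 < L" using \<kappa>0 N0 by (simp add: L_def)
  have Q: "2 * norm (Q (Suc k)) \<le> L * norm (u k)" for k
  proof -
    have "norm (Q (Suc k) $ r $ s) \<le> \<kappa> * (1 + N) * norm (u k)" for r s
    proof (cases "blk r = j")
      case False
      then have ne: "lam (blk r) \<noteq> lam j" using inj by (simp add: inj_eq)
      let ?R = "of_nat k * u k $ r $ s + (u k ** D - A ** u k) $ r $ s"
      have "u (Suc k) $ r $ s = ?R / ((lam (blk r) - lam j) * of_nat (Suc k))"
        using rec[of r k s] ne by (simp add: field_simps del: of_nat_Suc)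
      then have "norm (u (Suc k) $ r $ s) = 1 / norm (lam (blk r) - lam j) * (norm ?R / real (Suc k))"
        by (simp add: norm_divide norm_mult del: of_nat_Suc)
      also have "\<dots> \<le> \<kappa> * ((1 + N) * norm (u k))"
      proof (intro mult_mono \<kappa>)
        have "norm ?R \<le> real k * norm (u k) + norm (u k) * N"
          by (intro order_trans[OF norm_triangle_ineq] add_mono order_trans[OF matrix_entry_norm_le N])
            (auto simp: norm_mult intro!: mult_left_mono matrix_entry_norm_le)
        also have "\<dots> \<le> real (Suc k) * ((1 + N) * norm (u k))"
          using N0 by (simp add: algebra_simps)
        finally show "norm ?R / real (Suc k) \<le> (1 + N) * norm (u k)"
          by (simp add: divide_le_eq mult.commute del: of_nat_Suc)
      qed (use \<kappa>0 in auto)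
      finally show ?thesis using False by (simp add: Q_def mult.assoc)
    qed (use \<kappa>0 N0 in \<open>simp add: Q_def\<close>)
    then have "norm (Q (Suc k)) \<le> (\<Sum>r\<in>(UNIV :: 'n set). \<Sum>s\<in>(UNIV :: 'n set). \<kappa> * (1 + N) * norm (u k))"
      by (intro order_trans[OF matrix_norm_le_sum] sum_mono)
    then show ?thesis by (simp add: L_def mult.assoc)
  qed
  \<comment> \<open>In the rows of block j the recursion reads (k+1) u = -(u D - A u), whence (k+1)
    |P| \<le> N (|P| + |Q|). Once k + 1 \<ge> 2N, the term in |P| on the right can be
    absorbed.\<close>
  have P: "norm (P (Suc k)) \<le> norm (Q (Suc k))" if "2 * N \<le> real (Suc k)" for k
  proof -
    have "norm (mat_scale (of_nat (Suc k)) (P (Suc k))) \<le> norm (u (Suc k) ** D - A ** u (Suc k))"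
    proof (rule matrix_norm_mono)
      fix r s
      have "of_nat (Suc k) * u (Suc k) $ r $ s = - (u (Suc k) ** D - A ** u (Suc k)) $ r $ s" if "blk r = j"
      proof -
        have "of_nat (Suc k) * u (Suc k) $ r $ s + (u (Suc k) ** D - A ** u (Suc k)) $ r $ s = 0"
          using rec[of r "Suc k" s] that by (simp del: of_nat_Suc)
        then show ?thesis by (rule eq_neg_iff_add_eq_0[THEN iffD2, of "_ * _"])
      qed
      then show "norm (mat_scale (of_nat (Suc k)) (P (Suc k)) $ r $ s) \<le> norm ((u (Suc k) ** D - A ** u (Suc k)) $ r $ s)"
        by (simp add: P_def del: of_nat_Suc vector_minus_component)
    qed
    also have "\<dots> \<le> norm (u (Suc k)) * N" by (rule N)
    also have "\<dots> \<le> (norm (P (Suc k)) + norm (Q (Suc k))) * N"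
      unfolding PQ[of "Suc k"] by (intro mult_right_mono norm_triangle_ineq N0)
    finally have 1: "real (Suc k) * norm (P (Suc k)) \<le> N * norm (P (Suc k)) + N * norm (Q (Suc k))"
      by (simp only: norm_mat_scale norm_of_nat ring_distribs mult.commute)
    have "2 * N * norm (P (Suc k)) \<le> real (Suc k) * norm (P (Suc k))"
      using that by (intro mult_right_mono) auto
    with 1 have 2: "N * norm (P (Suc k)) \<le> N * norm (Q (Suc k))" by linarith
    show ?thesis
    proof (cases "N = 0")
      case True
      then have "real (Suc k) * norm (P (Suc k)) \<le> 0" using 1 by simp
      then have "norm (P (Suc k)) \<le> 0" by (simp add: mult_le_0_iff del: of_nat_Suc norm_le_zero_iff)
      then show ?thesis by (meson norm_ge_zero order_trans)
    qed (use 2 N0 in auto)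
  qed
  have "norm (u (Suc k)) \<le> L * norm (u k)" if "nat \<lceil>2 * N\<rceil> \<le> k" for k
  proof -
    have "2 * N \<le> real (Suc k)" using that by linarith
    then have "norm (u (Suc k)) \<le> 2 * norm (Q (Suc k))"
      using P[of k] norm_triangle_ineq[of "P (Suc k)" "Q (Suc k)"] PQ[of "Suc k"] by simp
    then show ?thesis using Q[of k] by linarith
  qed
  then show ?thesis using L0 by blast
qed

text \<open>The ratio test is applied to norms of whole matrices, which gives one radius for all
  entries; with \<epsilon> = 1/(2L) the ratio is 1/2.\<close>

lemma borel_coeff_conv_radius:
  fixes blk :: "'n::finite \<Rightarrow> 'p::finite"
    and j :: 'p
  assumes "formal_transformation blk lam A T" and "inj lam"
  obtains \<epsilon> where "0 < \<epsilon>"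
    "\<And>r s. ereal \<epsilon> \<le> fps_conv_radius (Abs_fps (\<lambda>k. borel_coeff blk T j k $ r $ s))"
proof -
  obtain L k0 where L: "0 < L"
    "\<And>k. k0 \<le> k \<Longrightarrow> norm (borel_coeff blk T j (Suc k)) \<le> L * norm (borel_coeff blk T j k)"
    using borel_coeff_growth[OF assms] by metis
  let ?u = "borel_coeff blk T j"
  define \<epsilon> where "\<epsilon> = 1 / (2 * L)"
  have \<epsilon>: "0 < \<epsilon>" "L * \<epsilon> = 1 / 2" using L by (auto simp: \<epsilon>_def)
  have sum: "summable (\<lambda>k. norm (?u k) * \<epsilon> ^ k)"
  proof (rule summable_ratio_test[where c = "1/2" and N = k0])
    fix k assume "k0 \<le> k"
    then have "norm (?u (Suc k)) * \<epsilon> ^ Suc k \<le> L * norm (?u k) * \<epsilon> ^ Suc k"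
      using L \<epsilon> by (intro mult_right_mono) auto
    also have "\<dots> = (L * \<epsilon>) * (norm (?u k) * \<epsilon> ^ k)" by (simp only: power_Suc mult_ac)
    finally show "norm (norm (?u (Suc k)) * \<epsilon> ^ Suc k) \<le> 1 / 2 * norm (norm (?u k) * \<epsilon> ^ k)"
      using \<epsilon> by (simp add: abs_mult)
  qed simp
  have "ereal \<epsilon> \<le> fps_conv_radius (Abs_fps (\<lambda>k. ?u k $ r $ s))" for r s
  proof -
    have "summable (\<lambda>k. ?u k $ r $ s * of_real \<epsilon> ^ k)"
    proof (rule summable_comparison_test[OF _ sum], intro exI allI impI)
      fix k show "norm (?u k $ r $ s * of_real \<epsilon> ^ k) \<le> norm (?u k) * \<epsilon> ^ k"
        using \<epsilon> by (simp add: norm_mult norm_power mult_right_mono matrix_entry_norm_le)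
    qed
    from conv_radius_geI[OF this] show ?thesis using \<epsilon> by (simp add: fps_conv_radius_def)
  qed
  with \<epsilon> that show ?thesis by blast
qed

text \<open>Obtained by summing \<open>borel_coeff_rec\<close>. The equation stays multiplied out
  because in the rows of block j the factor of the derivative is -z, which vanishes at 0.\<close>

lemma U_germ_ode:
  fixes blk :: "'n::finite \<Rightarrow> 'p::finite"
    and j :: 'p
  assumes T: "formal_transformation blk lam A T" and inj: "inj lam"
  defines "D \<equiv> diag_block blk j A"
  obtains \<epsilon> where "0 < \<epsilon>" "\<And>r s. (\<lambda>z. U_germ blk T j z $ r $ s) holomorphic_on ball 0 \<epsilon>"
    "\<And>(z::complex) r s. z \<in> ball 0 \<epsilon> \<Longrightarrow> \<exists>d. ((\<lambda>z. U_germ blk T j z $ r $ s) has_field_derivative d) (at z) \<and>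
       (lam (blk r) - lam j - z) * d = (U_germ blk T j z ** D - A ** U_germ blk T j z) $ r $ s"
proof -
  let ?u = "borel_coeff blk T j"
  obtain \<epsilon> where \<epsilon>: "0 < \<epsilon>" "\<And>r s. ereal \<epsilon> \<le> fps_conv_radius (Abs_fps (\<lambda>k. ?u k $ r $ s))"
    using borel_coeff_conv_radius[OF T inj] by metis
  define F where "F r s = Abs_fps (\<lambda>k. ?u k $ r $ s)" for r s
  have U: "U_germ blk T j z $ r $ s = eval_fps (F r s) z" for z r s
    by (simp add: U_germ_nth F_def)
  have rad: "norm z < fps_conv_radius (F r s)" if "z \<in> ball 0 \<epsilon>" for z r s
    using that \<epsilon>(2)[of r s] unfolding F_def by (simp add: less_le_trans[of _ "ereal \<epsilon>"])
  show ?thesis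
  proof (rule that[OF \<epsilon>(1)])
    fix r s
    show "(\<lambda>z. U_germ blk T j z $ r $ s) holomorphic_on ball 0 \<epsilon>"
      unfolding U by (rule holomorphic_on_eval_fps) (use rad in \<open>auto simp: eball_def\<close>)
  next
    fix z :: complex and r s assume z: "z \<in> ball 0 \<epsilon>"
    let ?d = "eval_fps (fps_deriv (F r s)) z" and ?p = "fps_const (lam (blk r) - lam j) - fps_X"
    have d: "((\<lambda>z. U_germ blk T j z $ r $ s) has_field_derivative ?d) (at z)"
      unfolding U by (rule has_field_derivative_eval_fps[OF rad[OF z]])
    have rad': "norm z < fps_conv_radius (fps_deriv (F r s))"
      using rad[OF z, of r s] fps_conv_radius_deriv[of "F r s"] by (rule less_le_trans)
    have radp: "fps_conv_radius ?p = \<infinity>"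
      using fps_conv_radius_diff[of "fps_const (lam (blk r) - lam j)" fps_X] by simp
    have "eval_fps (?p * fps_deriv (F r s)) z = (lam (blk r) - lam j - z) * ?d"
      using rad' radp by (simp add: eval_fps_mult eval_fps_diff)
    moreover have "norm z < fps_conv_radius (?p * fps_deriv (F r s))"
      using fps_conv_radius_mult[of ?p "fps_deriv (F r s)"] rad' radp by (auto intro: less_le_trans)
    ultimately have "(\<lambda>n. fps_nth (?p * fps_deriv (F r s)) n * z ^ n) sums ((lam (blk r) - lam j - z) * ?d)"
      using sums_eval_fps by metis
    moreover have "fps_nth (?p * fps_deriv (F r s)) n = (?u n ** D - A ** ?u n) $ r $ s" for n
      using borel_coeff_rec[OF T, of r j n s]
      by (cases n) (simp_all add: left_diff_distrib F_def D_def algebra_simps)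
    moreover have "(\<lambda>n. (?u n ** D - A ** ?u n) $ r $ s * z ^ n) sums
        (U_germ blk T j z ** D - A ** U_germ blk T j z) $ r $ s"
    proof -
      have s: "(\<lambda>n. ?u n $ p $ q * z ^ n) sums (U_germ blk T j z $ p $ q)" for p q
        using sums_eval_fps[OF rad[OF z, of p q]] unfolding U by (simp add: F_def)
      have "(\<lambda>n. (\<Sum>q\<in>UNIV. D $ q $ s * (?u n $ r $ q * z ^ n)) - (\<Sum>q\<in>UNIV. A $ r $ q * (?u n $ q $ s * z ^ n))) sums
        ((\<Sum>q\<in>UNIV. D $ q $ s * U_germ blk T j z $ r $ q) - (\<Sum>q\<in>UNIV. A $ r $ q * U_germ blk T j z $ q $ s))"
        by (intro sums_diff sums_sum sums_mult s)
      then show ?thesis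
        by (simp add: matrix_mult_nth sum_distrib_right sum_distrib_left left_diff_distrib right_diff_distrib mult_ac)
    qed
    ultimately have "(lam (blk r) - lam j - z) * ?d = (U_germ blk T j z ** D - A ** U_germ blk T j z) $ r $ s"
      using sums_unique2 by force
    with d show "\<exists>d. ((\<lambda>z. U_germ blk T j z $ r $ s) has_field_derivative d) (at z) \<and>
       (lam (blk r) - lam j - z) * d = (U_germ blk T j z ** D - A ** U_germ blk T j z) $ r $ s" by blast
  qed
qed

subsection \<open>Lifting the Borel transform to the logarithmic plane\<close>

lemma rcis_eq_sgn_iff:
  assumes "x \<noteq> 0"
  shows "(\<exists>r>0. x = rcis r \<alpha>) \<longleftrightarrow> cis \<alpha> = sgn x"
proof
  assume "\<exists>r>0. x = rcis r \<alpha>"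
  then obtain r where "0 < r" "x = rcis r \<alpha>" by blast
  then show "cis \<alpha> = sgn x" by (simp add: rcis_def sgn_div_norm norm_mult scaleR_conv_of_real)
next
  assume "cis \<alpha> = sgn x"
  then have "x = rcis (norm x) \<alpha>"
    using assms by (simp add: rcis_def sgn_div_norm scaleR_conv_of_real)
  then show "\<exists>r>0. x = rcis r \<alpha>" using assms by (intro exI[of _ "norm x"]) simp
qed

text \<open>There are finitely many pairs of blocks, and each imposes a condition that is visibly
  open once the existential radius is traded for
  \<open>cis \<alpha> \<noteq> sgn (lam i - lam j)\<close>.\<close>

lemma open_nonsingular_dirs:
  fixes lam :: "'p::finite \<Rightarrow> complex"
  assumes "inj lam"
  shows "open (nonsingular_dirs lam)"
proof -
  have "nonsingular_dirs lam = (\<Inter>(i, j)\<in>{(i, j). i \<noteq> j}. {\<alpha>. cis \<alpha> \<noteq> sgn (lam i - lam j)})"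
  proof -
    have "(\<exists>r>0. lam i - lam j = rcis r \<alpha>) \<longleftrightarrow> cis \<alpha> = sgn (lam i - lam j)" if "i \<noteq> j" for i j \<alpha>
      by (rule rcis_eq_sgn_iff) (use that assms in \<open>simp add: inj_eq\<close>)
    then show ?thesis unfolding nonsingular_dirs_def by auto
  qed
  also have "open \<dots>"
    by (intro open_INT) (auto intro!: open_Collect_neq continuous_intros)
  finally show ?thesis .
qed

lemma dir_class:
  fixes lam :: "'p::finite \<Rightarrow> complex"
  assumes "inj lam" and "\<alpha> \<in> nonsingular_dirs lam"
  shows open_dir_class: "open (dir_class lam \<alpha>)"
    and base_in_dir_class: "\<alpha> \<in> dir_class lam \<alpha>"
    and dir_class_nonsingular: "dir_class lam \<alpha> \<subseteq> nonsingular_dirs lam"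
    and Icc_subset_dir_class: "\<And>a b. a \<in> dir_class lam \<alpha> \<Longrightarrow> b \<in> dir_class lam \<alpha> \<Longrightarrow> {a..b} \<subseteq> dir_class lam \<alpha>"
    and convex_dir_class: "convex (dir_class lam \<alpha>)"
proof -
  show "open (dir_class lam \<alpha>)"
    unfolding dir_class_def by (rule open_connected_component[OF open_nonsingular_dirs[OF assms(1)]])
  show "\<alpha> \<in> dir_class lam \<alpha>" using assms(2) by (simp add: dir_class_def connected_component_refl)
  show "dir_class lam \<alpha> \<subseteq> nonsingular_dirs lam"
    unfolding dir_class_def by (rule connected_component_subset)
  have con: "connected (dir_class lam \<alpha>)" by (simp add: dir_class_def)
  show "\<And>a b. a \<in> dir_class lam \<alpha> \<Longrightarrow> b \<in> dir_class lam \<alpha> \<Longrightarrow> {a..b} \<subseteq> dir_class lam \<alpha>"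
    by (rule connected_contains_Icc[OF con])
  show "convex (dir_class lam \<alpha>)"
    using con by (simp add: is_interval_convex_1 flip: is_interval_connected_1)
qed

definition log_domain :: "('p \<Rightarrow> complex) \<Rightarrow> real \<Rightarrow> real \<Rightarrow> complex set" where
  "log_domain lam \<alpha> M = {\<zeta>. M < Re \<zeta> \<or> Im \<zeta> \<in> dir_class lam \<alpha>}"

lemma exp_eq_rcis: "exp \<zeta> = rcis (exp (Re \<zeta>)) (Im \<zeta>)"
  by (simp add: exp_eq_polar rcis_def)

lemma exp_log_domain_nonsingular:
  fixes lam :: "'p::finite \<Rightarrow> complex"
  assumes "inj lam" and "\<alpha> \<in> nonsingular_dirs lam" and "\<zeta> \<in> log_domain lam \<alpha> M"
    and "\<And>i j. norm (lam i - lam j) \<le> exp M"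
  shows "i \<noteq> j \<Longrightarrow> exp \<zeta> \<noteq> lam i - lam j"
proof
  assume ij: "i \<noteq> j" and eq: "exp \<zeta> = lam i - lam j"
  from assms(3) consider "M < Re \<zeta>" | "Im \<zeta> \<in> dir_class lam \<alpha>" by (auto simp: log_domain_def)
  then show False
  proof cases
    case 1
    then have "exp M < norm (exp \<zeta>)" by simp
    then show ?thesis using assms(4)[of i j] unfolding eq by simp
  next
    case 2
    then have "Im \<zeta> \<in> nonsingular_dirs lam" using dir_class_nonsingular[OF assms(1,2)] by blast
    moreover have "lam i - lam j = rcis (exp (Re \<zeta>)) (Im \<zeta>)" using eq exp_eq_rcis[of \<zeta>] by simp
    ultimately show ?thesis using ij unfolding nonsingular_dirs_def by force
  qed
qed

lemma convex_Im_vimage: "convex I \<Longrightarrow> convex {z. Im z \<in> I}"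
  using convex_linear_vimage[OF bounded_linear.linear[OF bounded_linear_Im], of I] by (simp add: vimage_def)

lemma open_Im_vimage: "open I \<Longrightarrow> open {z. Im z \<in> I}"
  using continuous_open_vimage[of I Im] by (simp add: vimage_def)

text \<open>The centre lies in both convex pieces, so the segment to any point stays in the piece
  containing that point. The union itself need not be convex.\<close>

lemma log_domain_starlike:
  fixes lam :: "'p::finite \<Rightarrow> complex"
  assumes "inj lam" and "\<alpha> \<in> nonsingular_dirs lam" and "M < Re c" and "Im c \<in> dir_class lam \<alpha>"
    and "z \<in> log_domain lam \<alpha> M"
  shows "closed_segment c z \<subseteq> log_domain lam \<alpha> M"
  using assms(5) unfolding log_domain_def
proof (elim CollectE disjE)
  assume "M < Re z"
  then have "closed_segment c z \<subseteq> {z. M < Re z}"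
    by (intro closed_segment_subset convex_halfspace_Re_gt) (use assms in auto)
  then show "closed_segment c z \<subseteq> {\<zeta>. M < Re \<zeta> \<or> Im \<zeta> \<in> dir_class lam \<alpha>}" by auto
next
  assume "Im z \<in> dir_class lam \<alpha>"
  then have "closed_segment c z \<subseteq> {z. Im z \<in> dir_class lam \<alpha>}"
    by (intro closed_segment_subset convex_Im_vimage convex_dir_class) (use assms in auto)
  then show "closed_segment c z \<subseteq> {\<zeta>. M < Re \<zeta> \<or> Im \<zeta> \<in> dir_class lam \<alpha>}" by auto
qed

lemma open_log_domain:
  fixes lam :: "'p::finite \<Rightarrow> complex"
  assumes "inj lam" and "\<alpha> \<in> nonsingular_dirs lam"
  shows "open (log_domain lam \<alpha> M)"
  unfolding log_domain_def
  by (intro open_Collect_disj open_Im_vimage open_dir_class assms open_halfspace_Re_gt)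

text \<open>With s = exp \<zeta> the derivation d/d\<zeta> is s d/ds, so dividing by \<lambda>_r -
  \<lambda>_j - s leaves this factor. In the rows of block j it is the constant -1: the singular
  point s = 0 has moved to infinity.\<close>

definition log_coeff :: "('n \<Rightarrow> 'p) \<Rightarrow> ('p \<Rightarrow> complex) \<Rightarrow> 'p \<Rightarrow> 'n \<Rightarrow> complex \<Rightarrow> complex" where
  "log_coeff blk lam j r \<zeta> = (if blk r = j then -1 else exp \<zeta> / (lam (blk r) - lam j - exp \<zeta>))"

text \<open>For Re \<zeta> \<ge> M + 1 the modulus of exp \<zeta> is at least 2|\<mu>|, which bounds
  the quotient by 2. The rest of the strip is mapped into the compact sector \<open>C\<close>, which
  misses \<mu> because its directions are non-singular.\<close>

lemma log_coeff_bound: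
  fixes lam :: "'p::finite \<Rightarrow> complex"
  assumes inj: "inj lam" and \<alpha>: "\<alpha> \<in> nonsingular_dirs lam"
    and M: "\<And>i j. norm (lam i - lam j) \<le> exp M" and ab: "{a..b} \<subseteq> dir_class lam \<alpha>"
  shows "\<exists>\<kappa>. \<forall>\<zeta>. M + 1 \<le> Re \<zeta> \<or> Im \<zeta> \<in> {a..b} \<longrightarrow> norm (log_coeff blk lam j r \<zeta>) \<le> \<kappa>"
proof (cases "blk r = j")
  case False
  define \<mu> where "\<mu> = lam (blk r) - lam j"
  have \<mu>0: "\<mu> \<noteq> 0" using False inj by (simp add: \<mu>_def inj_eq)
  define C where "C = (\<lambda>(t, x). rcis t x) ` ({0..exp (M + 1)} \<times> {a..b})"
  have "compact C"
    unfolding C_def case_prod_unfold rcis_def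
    by (intro compact_continuous_image continuous_intros compact_Times) auto
  have "\<mu> \<notin> C"
  proof
    assume "\<mu> \<in> C"
    then obtain t x where tx: "0 \<le> t" "x \<in> {a..b}" "\<mu> = rcis t x" by (auto simp: C_def)
    then have "0 < t" using \<mu>0 by (cases "t = 0") auto
    moreover have "x \<in> nonsingular_dirs lam"
      using tx ab dir_class_nonsingular[OF inj \<alpha>] by blast
    ultimately show False using tx False by (auto simp: nonsingular_dirs_def \<mu>_def)
  qed
  then have "continuous_on C (\<lambda>s. s / (\<mu> - s))" by (intro continuous_intros) auto
  then have "bounded ((\<lambda>s. s / (\<mu> - s)) ` C)"
    using \<open>compact C\<close> by (intro compact_imp_bounded compact_continuous_image)
  then obtain K where K: "\<And>s. s \<in> C \<Longrightarrow> norm (s / (\<mu> - s)) \<le> K" unfolding bounded_pos by auto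
  show ?thesis
  proof (intro exI allI impI)
    fix \<zeta> assume \<zeta>: "M + 1 \<le> Re \<zeta> \<or> Im \<zeta> \<in> {a..b}"
    have "norm (exp \<zeta> / (\<mu> - exp \<zeta>)) \<le> max 2 K"
    proof (cases "M + 1 \<le> Re \<zeta>")
      case True
      have "2 * norm \<mu> \<le> exp 1 * exp M"
        using M[of "blk r" j] exp_ge_add_one_self[of "1::real"] by (intro mult_mono) (auto simp: \<mu>_def)
      also have "\<dots> = exp (M + 1)" by (simp add: exp_add)
      also have "\<dots> \<le> norm (exp \<zeta>)" using True by simp
      finally have "norm (exp \<zeta>) \<le> 2 * norm (exp \<zeta> - \<mu>)"
        using norm_triangle_ineq2[of "exp \<zeta>" \<mu>] by linarith
      then have "norm (exp \<zeta> / (\<mu> - exp \<zeta>)) \<le> 2"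
        by (simp add: norm_divide norm_minus_commute divide_le_eq)
      then show ?thesis by simp
    next
      case False
      then have "exp \<zeta> \<in> C" unfolding C_def using \<zeta> exp_eq_rcis[of \<zeta>]
        by (intro image_eqI[of _ _ "(exp (Re \<zeta>), Im \<zeta>)"]) auto
      then show ?thesis using K[of "exp \<zeta>"] by simp
    qed
    then show "norm (log_coeff blk lam j r \<zeta>) \<le> max 2 K" using False by (simp add: log_coeff_def \<mu>_def)
  qed
qed (auto simp: log_coeff_def intro!: exI[of _ 1])

lemma solves_system_subset:
  "solves_system c A D S V \<Longrightarrow> S' \<subseteq> S \<Longrightarrow> solves_system c A D S' V"
  by (auto simp: solves_system_def)

lemma solves_system_holomorphic:
  assumes "solves_system c A D S V" "open S"
  shows "(\<lambda>z. V z $ r $ s) holomorphic_on S"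
  unfolding holomorphic_on_open[OF assms(2)]
proof
  fix z assume "z \<in> S"
  then have "((\<lambda>z. V z $ r $ s) has_field_derivative c r z * (V z ** D - A ** V z) $ r $ s) (at z)"
    using assms(1) unfolding solves_system_def by simp
  then show "\<exists>f'. ((\<lambda>z. V z $ r $ s) has_field_derivative f') (at z)" ..
qed

text \<open>Two stages are used because the germ lives far to the left, at points about which the
  full domain need not be starlike. The germ is first continued inside the convex strip from
  \<open>c0\<close> to \<open>c1\<close>, then from \<open>c1\<close> to the whole domain;
  uniqueness shows that the two solutions agree on the strip.\<close>

lemma borel_lift:
  fixes blk :: "'n::finite \<Rightarrow> 'p::finite" and j :: 'p
  assumes T: "formal_transformation blk lam A T" and inj: "inj lam" and \<alpha>: "\<alpha> \<in> nonsingular_dirs lam"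
  obtains V M \<epsilon> where
    "\<And>r s. (\<lambda>\<zeta>. V \<zeta> $ r $ s) holomorphic_on log_domain lam \<alpha> M"
    "\<And>\<zeta>. block_col blk j (V \<zeta>) = V \<zeta>"
    "\<And>i j. norm (lam i - lam j) \<le> exp M"
    "0 < \<epsilon>" "\<epsilon> \<le> exp M"
    "\<And>r s. (\<lambda>z. U_germ blk T j z $ r $ s) holomorphic_on ball 0 \<epsilon>"
    "\<And>\<zeta>. Im \<zeta> \<in> dir_class lam \<alpha> \<Longrightarrow> Re \<zeta> < ln \<epsilon> \<Longrightarrow> V \<zeta> = U_germ blk T j (exp \<zeta>)"
    "\<And>a b. a \<in> dir_class lam \<alpha> \<Longrightarrow> b \<in> dir_class lam \<alpha> \<Longrightarrow>
      \<exists>C K. 0 \<le> C \<and> 0 \<le> K \<and> (\<forall>\<zeta>. M + 1 \<le> Re \<zeta> \<or> Im \<zeta> \<in> {a..b} \<longrightarrow>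
        norm (V \<zeta>) \<le> C * exp (K * (max 0 (Re \<zeta>) + \<bar>Im \<zeta>\<bar>)))"
proof -
  let ?U = "U_germ blk T j" and ?I = "dir_class lam \<alpha>"
  define D where "D = diag_block blk j A"
  define c where "c = log_coeff blk lam j"
  obtain \<epsilon> where \<epsilon>: "0 < \<epsilon>" "\<And>r s. (\<lambda>z. ?U z $ r $ s) holomorphic_on ball 0 \<epsilon>"
    and U': "\<And>z r s. z \<in> ball 0 \<epsilon> \<Longrightarrow> \<exists>d. ((\<lambda>z. ?U z $ r $ s) has_field_derivative d) (at z) \<and>
       (lam (blk r) - lam j - z) * d = (?U z ** D - A ** ?U z) $ r $ s"
    using U_germ_ode[OF T inj, where j = j] unfolding D_def by metis
  \<comment> \<open>The double sum dominates every |\<lambda>_i - \<lambda>_j|; adding \<epsilon>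
    keeps the disc of the germ away from the half-plane Re > M.\<close>
  define M where "M = ln (\<epsilon> + (\<Sum>i\<in>UNIV. \<Sum>j\<in>UNIV. norm (lam i - lam j)))"
  have S0: "0 \<le> (\<Sum>i\<in>UNIV. \<Sum>j\<in>UNIV. norm (lam i - lam j))" by (intro sum_nonneg) auto
  then have expM: "exp M = \<epsilon> + (\<Sum>i\<in>UNIV. \<Sum>j\<in>UNIV. norm (lam i - lam j))"
    using \<epsilon> by (simp add: M_def add_pos_nonneg)
  have M: "norm (lam i - lam j) \<le> exp M" for i j
  proof -
    have "norm (lam i - lam j) \<le> (\<Sum>j\<in>UNIV. norm (lam i - lam j))"
      by (rule member_le_sum[where f = "\<lambda>j. norm (lam i - lam j)"]) auto
    also have "\<dots> \<le> (\<Sum>i\<in>UNIV. \<Sum>j\<in>UNIV. norm (lam i - lam j))"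
      by (rule member_le_sum[where f = "\<lambda>i. \<Sum>j\<in>UNIV. norm (lam i - lam j)"]) (auto intro: sum_nonneg)
    finally show ?thesis using \<epsilon> by (simp add: expM)
  qed
  have \<epsilon>M: "\<epsilon> \<le> exp M" using S0 by (simp add: expM)
  define \<Omega> where "\<Omega> = log_domain lam \<alpha> M"
  define S1 where "S1 = {z. Im z \<in> ?I}"
  define Z where "Z = S1 \<inter> {z. Re z < ln \<epsilon>}"
  define c0 where "c0 = Complex (ln \<epsilon> - 1) \<alpha>"
  define c1 where "c1 = Complex (M + 1) \<alpha>"
  have \<alpha>I: "\<alpha> \<in> ?I" by (rule base_in_dir_class[OF inj \<alpha>])
  have nz: "lam (blk r) - lam j - exp \<zeta> \<noteq> 0" if "\<zeta> \<in> \<Omega>" "blk r \<noteq> j" for r \<zeta>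
    using exp_log_domain_nonsingular[OF inj \<alpha> _ M, of \<zeta> "blk r" j] that by (auto simp: \<Omega>_def)
  have c_hol: "c r holomorphic_on \<Omega>" for r
    unfolding c_def log_coeff_def using nz by (cases "blk r = j") (auto intro!: holomorphic_intros)
  have sub: "S1 \<subseteq> \<Omega>" "Z \<subseteq> S1" by (auto simp: S1_def \<Omega>_def Z_def log_domain_def)
  have c_hol1: "c r holomorphic_on S1" for r by (rule holomorphic_on_subset[OF c_hol sub(1)])
  have convS1: "convex S1" unfolding S1_def by (intro convex_Im_vimage convex_dir_class inj \<alpha>)
  have convZ: "convex Z" unfolding Z_def by (intro convex_Int convS1 convex_halfspace_Re_lt)
  have c0: "c0 \<in> Z" "c0 \<in> S1" and c1: "c1 \<in> S1" "c1 \<in> \<Omega>"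
    using \<alpha>I by (auto simp: c0_def c1_def Z_def S1_def \<Omega>_def log_domain_def)
  have opS1: "open S1" unfolding S1_def by (intro open_Im_vimage open_dir_class inj \<alpha>)
  obtain V1 where V1: "V1 c0 = ?U (exp c0)" "solves_system c A D S1 V1"
  proof -
    have "\<exists>V. V c0 = ?U (exp c0) \<and> solves_system c A D S1 V"
      by (rule solves_system_exists[OF opS1 c0(2) closed_segment_subset[OF c0(2) _ convS1] c_hol1])
    then show ?thesis using that by blast
  qed
  obtain V2 where V2: "V2 c1 = V1 c1" "solves_system c A D \<Omega> V2"
  proof -
    have "\<exists>V. V c1 = V1 c1 \<and> solves_system c A D \<Omega> V"
    proof (rule solves_system_exists[OF _ c1(2) _ c_hol])
      show "open \<Omega>" unfolding \<Omega>_def by (rule open_log_domain[OF inj \<alpha>])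
      show "closed_segment c1 z \<subseteq> \<Omega>" if "z \<in> \<Omega>" for z
        using that unfolding \<Omega>_def
        by (rule log_domain_starlike[OF inj \<alpha>, rotated 2]) (simp_all add: c1_def \<alpha>I)
    qed
    then show ?thesis using that by blast
  qed
  have V2_S1: "solves_system c A D S1 V2" and V1_Z: "solves_system c A D Z V1"
    by (rule solves_system_subset[OF V2(2) sub(1)], rule solves_system_subset[OF V1(2) sub(2)])
  have V21: "V2 z = V1 z" if "z \<in> S1" for z
    by (rule solves_system_unique[OF V2_S1 V1(2) V2(1) c_hol1])
      (use closed_segment_subset[OF c1(1) that convS1] in auto)
  have exp_ball: "exp z \<in> ball 0 \<epsilon> \<longleftrightarrow> Re z < ln \<epsilon>" for z :: complex
  proof -
    have "exp (Re z) < \<epsilon> \<longleftrightarrow> exp (Re z) < exp (ln \<epsilon>)" using \<epsilon>(1) by simp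
    then show ?thesis by (simp only: exp_less_cancel_iff mem_ball_0 norm_exp_eq_Re)
  qed
  have UZ: "solves_system c A D Z (\<lambda>z. ?U (exp z))"
    unfolding solves_system_def
  proof (intro ballI allI)
    fix z r s assume z: "z \<in> Z"
    then have "exp z \<in> ball 0 \<epsilon>" unfolding exp_ball by (simp add: Z_def)
    from U'[OF this] obtain d where d: "((\<lambda>z. ?U z $ r $ s) has_field_derivative d) (at (exp z))"
      "(lam (blk r) - lam j - exp z) * d = (?U (exp z) ** D - A ** ?U (exp z)) $ r $ s" by blast
    have "((\<lambda>z. ?U (exp z) $ r $ s) has_field_derivative d * exp z) (at z)"
      by (rule DERIV_chain2[OF d(1) DERIV_exp])
    moreover have "d * exp z = c r z * (?U (exp z) ** D - A ** ?U (exp z)) $ r $ s"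
      unfolding d(2)[symmetric] using nz[of z r] z sub by (auto simp: c_def log_coeff_def)
    ultimately show "((\<lambda>z. ?U (exp z) $ r $ s) has_field_derivative
        c r z * (?U (exp z) ** D - A ** ?U (exp z)) $ r $ s) (at z)" by simp
  qed
  have V1U: "V1 z = ?U (exp z)" if "z \<in> Z" for z
    by (rule solves_system_unique[OF V1_Z UZ V1(1) holomorphic_on_subset[OF c_hol1 sub(2)]])
      (use closed_segment_subset[OF c0(1) that convZ] in auto)
  \<comment> \<open>Projection onto block column j makes the column support hold everywhere, also
    outside the domain, where \<open>V2\<close> is arbitrary.\<close>
  define V where "V z = block_col blk j (V2 z)" for z
  have V_U: "V z = ?U (exp z)" if "Im z \<in> ?I" "Re z < ln \<epsilon>" for z
  proof -
    have "V2 z = ?U (exp z)" using V21[of z] V1U[of z] that sub by (auto simp: Z_def S1_def)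
    then show ?thesis by (simp add: V_def vec_eq_iff U_germ_def)
  qed
  show ?thesis
  proof (rule that)
    fix r s
    have "(\<lambda>\<zeta>. V2 \<zeta> $ r $ s) holomorphic_on \<Omega>"
      by (rule solves_system_holomorphic[OF V2(2)]) (simp add: \<Omega>_def open_log_domain[OF inj \<alpha>])
    then show "(\<lambda>\<zeta>. V \<zeta> $ r $ s) holomorphic_on log_domain lam \<alpha> M"
      by (cases "blk s = j") (simp_all add: V_def \<Omega>_def)
  next
    show "block_col blk j (V \<zeta>) = V \<zeta>" for \<zeta> by (simp add: V_def vec_eq_iff)
  next
    fix a b assume ab: "a \<in> ?I" "b \<in> ?I"
    \<comment> \<open>The closed strip is widened to contain the height \<alpha> of
      \<open>c1\<close>, so that segments from \<open>c1\<close> stay where the coefficients are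
      bounded.\<close>
    define a' b' where "a' = min a \<alpha>" and "b' = max b \<alpha>"
    have "a' \<in> ?I" "b' \<in> ?I" using ab \<alpha>I by (auto simp: a'_def b'_def min_def max_def)
    then have ab': "{a'..b'} \<subseteq> ?I" by (rule Icc_subset_dir_class[OF inj \<alpha>])
    have "\<forall>r. \<exists>\<kappa>. \<forall>\<zeta>. M + 1 \<le> Re \<zeta> \<or> Im \<zeta> \<in> {a'..b'} \<longrightarrow> norm (c r \<zeta>) \<le> \<kappa>"
      unfolding c_def by (rule allI log_coeff_bound[OF inj \<alpha> M ab'])+
    from choice[OF this] obtain \<kappa>' where
      \<kappa>': "\<forall>r. \<forall>\<zeta>. M + 1 \<le> Re \<zeta> \<or> Im \<zeta> \<in> {a'..b'} \<longrightarrow> norm (c r \<zeta>) \<le> \<kappa>' r" ..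
    define \<kappa> where "\<kappa> = (\<Sum>r\<in>UNIV. \<bar>\<kappa>' r\<bar>)"
    have \<kappa>: "norm (c r \<zeta>) \<le> \<kappa>" if "M + 1 \<le> Re \<zeta> \<or> Im \<zeta> \<in> {a'..b'}" for r \<zeta>
    proof -
      have "\<bar>\<kappa>' r\<bar> \<le> \<kappa>" unfolding \<kappa>_def by (rule member_le_sum[where f = "\<lambda>r. \<bar>\<kappa>' r\<bar>"]) auto
      then show ?thesis using \<kappa>'[rule_format, OF that, of r] by linarith
    qed
    have \<kappa>0: "0 \<le> \<kappa>" by (simp add: \<kappa>_def sum_nonneg)
    define K where "K = \<kappa> * ((norm D + norm A) * real CARD('n) ^ 3)"
    have K0: "0 \<le> K" using \<kappa>0 by (simp add: K_def)
    have grow: "norm (V z) \<le> norm (V2 c1) * exp (K * norm (z - c1))"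
      if z: "M + 1 \<le> Re z \<or> Im z \<in> {a'..b'}" for z
    proof -
      have seg: "closed_segment c1 z \<subseteq> {z. M + 1 \<le> Re z \<or> Im z \<in> {a'..b'}}"
      proof (cases "M + 1 \<le> Re z")
        case True
        then have "closed_segment c1 z \<subseteq> {z. M + 1 \<le> Re z}"
          by (intro closed_segment_subset) (auto simp: c1_def convex_halfspace_Re_ge)
        then show ?thesis by auto
      next
        case False
        then have "closed_segment c1 z \<subseteq> {z. Im z \<in> {a'..b'}}"
          using z by (intro closed_segment_subset convex_Im_vimage) (auto simp: c1_def a'_def b'_def)
        then show ?thesis by auto
      qed
      have "{z. M + 1 \<le> Re z \<or> Im z \<in> {a'..b'}} \<subseteq> \<Omega>"
        using ab' by (auto simp: \<Omega>_def log_domain_def)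
      then have seg': "closed_segment c1 z \<subseteq> \<Omega>" using seg by (rule subset_trans[rotated])
      have "norm (V2 z) \<le> norm (V2 c1) * exp (K * norm (z - c1))"
        unfolding K_def by (rule solves_system_growth[OF V2(2) seg']) (rule \<kappa>, use seg in auto)
      then show ?thesis using norm_block_col_le[of blk j "V2 z"] by (simp add: V_def)
    qed
    \<comment> \<open>The Gronwall bound deteriorates as Re \<zeta> tends to -\<infinity>. There
      \<open>V\<close> is the germ on a small closed disc, bounded by compactness; the two bounds
      are joined at \<open>x0\<close>.\<close>
    have "bounded (?U ` cball 0 (\<epsilon> / 2))"
    proof (intro compact_imp_bounded compact_continuous_image continuous_on_matrixI)
      fix r s
      have "cball 0 (\<epsilon> / 2) \<subseteq> ball (0::complex) \<epsilon>" using \<epsilon>(1) by auto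
      then show "continuous_on (cball 0 (\<epsilon> / 2)) (\<lambda>z. ?U z $ r $ s)"
        by (rule holomorphic_on_imp_continuous_on[OF holomorphic_on_subset[OF \<epsilon>(2)]])
    qed auto
    then obtain Bd where Bd: "\<And>z. z \<in> cball 0 (\<epsilon> / 2) \<Longrightarrow> norm (?U z) \<le> Bd"
      unfolding bounded_iff by blast
    define x0 where "x0 = ln (\<epsilon> / 2)"
    define C where "C = norm (V2 c1) * exp (K * (\<bar>x0\<bar> + \<bar>M + 1\<bar> + \<bar>\<alpha>\<bar>)) + \<bar>Bd\<bar>"
    show "\<exists>C K. 0 \<le> C \<and> 0 \<le> K \<and> (\<forall>\<zeta>. M + 1 \<le> Re \<zeta> \<or> Im \<zeta> \<in> {a..b} \<longrightarrow>
        norm (V \<zeta>) \<le> C * exp (K * (max 0 (Re \<zeta>) + \<bar>Im \<zeta>\<bar>)))"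
    proof (intro exI conjI allI impI)
      show "0 \<le> C" by (simp add: C_def)
      show "0 \<le> K" by fact
      fix z assume z: "M + 1 \<le> Re z \<or> Im z \<in> {a..b}"
      let ?e = "exp (K * (max 0 (Re z) + \<bar>Im z\<bar>))"
      have e1: "1 \<le> ?e" using K0 by simp
      show "norm (V z) \<le> C * ?e"
      proof (cases "Re z < x0")
        case True
        have "x0 < ln \<epsilon>" using \<epsilon>(1) by (simp add: x0_def)
        moreover have "ln \<epsilon> \<le> M" using \<epsilon>M \<epsilon>(1) by (metis ln_mono ln_exp)
        ultimately have "Im z \<in> ?I" and lt: "Re z < ln \<epsilon>"
          using True z ab Icc_subset_dir_class[OF inj \<alpha> ab] by auto
        then have "V z = ?U (exp z)" by (rule V_U)
        moreover have "norm (exp z) \<le> \<epsilon> / 2"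
        proof -
          have "exp (Re z) \<le> exp x0" using True by simp
          also have "exp x0 = \<epsilon> / 2" using \<epsilon>(1) by (simp add: x0_def)
          finally show ?thesis by simp
        qed
        ultimately have "norm (V z) \<le> \<bar>Bd\<bar>" using Bd[of "exp z"] by simp
        also have "\<dots> \<le> C * 1" by (simp add: C_def)
        also have "\<dots> \<le> C * ?e" using e1 \<open>0 \<le> C\<close> by (intro mult_left_mono)
        finally show ?thesis .
      next
        case False
        have "norm (z - c1) \<le> \<bar>Re z - (M + 1)\<bar> + \<bar>Im z - \<alpha>\<bar>"
          using cmod_le[of "z - c1"] by (simp add: c1_def)
        also have "\<dots> \<le> (max 0 (Re z) + \<bar>Im z\<bar>) + (\<bar>x0\<bar> + \<bar>M + 1\<bar> + \<bar>\<alpha>\<bar>)"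
          using False by (auto simp: max_def abs_if)
        finally have "K * norm (z - c1) \<le> K * ((max 0 (Re z) + \<bar>Im z\<bar>) + (\<bar>x0\<bar> + \<bar>M + 1\<bar> + \<bar>\<alpha>\<bar>))"
          using K0 by (rule mult_left_mono)
        then have "exp (K * norm (z - c1)) \<le> exp (K * (\<bar>x0\<bar> + \<bar>M + 1\<bar> + \<bar>\<alpha>\<bar>)) * ?e"
          by (simp only: distrib_left[of K] exp_add[symmetric] exp_le_cancel_iff add.commute)
        then have "norm (V2 c1) * exp (K * norm (z - c1)) \<le> norm (V2 c1) * (exp (K * (\<bar>x0\<bar> + \<bar>M + 1\<bar> + \<bar>\<alpha>\<bar>)) * ?e)"
          by (intro mult_left_mono) auto
        moreover have "norm (V z) \<le> norm (V2 c1) * exp (K * norm (z - c1))"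
          by (rule grow) (use z in \<open>auto simp: a'_def b'_def\<close>)
        moreover have "norm (V2 c1) * (exp (K * (\<bar>x0\<bar> + \<bar>M + 1\<bar> + \<bar>\<alpha>\<bar>)) * ?e) \<le> C * ?e"
          by (simp add: C_def distrib_right)
        ultimately show ?thesis by linarith
      qed
    qed
  next show "\<And>i j. cmod (lam i - lam j) \<le> exp M" by (rule M) next show "0 < \<epsilon>" by fact next show "\<epsilon> \<le> exp M" by fact next show "\<And>r s. (\<lambda>z. ?U z $ r $ s) holomorphic_on ball 0 \<epsilon>" by (rule \<epsilon>(2)) next show "\<And>\<zeta>. Im \<zeta> \<in> ?I \<Longrightarrow> Re \<zeta> < ln \<epsilon> \<Longrightarrow> V \<zeta> = ?U (exp \<zeta>)" by (rule V_U) qed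
qed

subsection \<open>Continuation along paths\<close>

lemma analytic_on_matrix_ball:
  fixes G :: "complex \<Rightarrow> complex^'n::finite^'n"
  assumes "\<And>r k. (\<lambda>s. G s $ r $ k) analytic_on {a}"
  obtains e where "0 < e" "\<And>r k. (\<lambda>s. G s $ r $ k) holomorphic_on ball a e"
proof -
  have "\<forall>p. \<exists>e>0. (\<lambda>s. G s $ fst p $ snd p) holomorphic_on ball a e"
    using assms by (simp add: analytic_on_def)
  from choice[OF this] obtain e :: "'n \<times> 'n \<Rightarrow> real" where
    e: "\<forall>p. 0 < e p \<and> (\<lambda>s. G s $ fst p $ snd p) holomorphic_on ball a (e p)" ..
  have "0 < Min (range e)" using e by (simp add: Min_gr_iff)
  moreover have "(\<lambda>s. G s $ r $ k) holomorphic_on ball a (Min (range e))" for r k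
  proof -
    have "(\<lambda>s. G s $ r $ k) holomorphic_on ball a (e (r, k))" using e[rule_format, of "(r, k)"] by simp
    moreover have "ball a (Min (range e)) \<subseteq> ball a (e (r, k))" by (intro subset_ball Min_le) auto
    ultimately show ?thesis by (rule holomorphic_on_subset)
  qed
  ultimately show ?thesis by (rule that)
qed

text \<open>Brings a punctured-neighbourhood statement into the form in which
  \<open>connected_induction_simple\<close> asks for neighbourhoods.\<close>

lemma eventually_within_openin:
  assumes "eventually P (at c within S)" "P c" "c \<in> S"
  obtains T where "openin (top_of_set S) T" "c \<in> T" "\<And>x. x \<in> T \<Longrightarrow> P x"
proof -
  obtain W where W: "open W" "c \<in> W" "\<forall>x\<in>W. x \<noteq> c \<longrightarrow> x \<in> S \<longrightarrow> P x"
    using assms(1) unfolding eventually_at_topological by blast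
  show ?thesis
    by (rule that[of "S \<inter> W"]) (use W assms in \<open>auto simp: openin_open_Int\<close>)
qed

text \<open>Near a parameter c both continuations are represented on one disc about
  \<open>\<gamma> c\<close>, where the identity theorem carries agreement from any nearby parameter
  to any other. Connectedness of the half-line propagates it from 0.\<close>

lemma continuation_along_unique:
  fixes f :: "complex \<Rightarrow> complex^'n::finite^'n"
  assumes 1: "continuation_along f \<gamma> u1" and 2: "continuation_along f \<gamma> u2"
    and cont: "continuous_on {0..} \<gamma>" and "0 \<le> t"
  shows "u1 t = u2 t"
proof -
  obtain G1 where "\<forall>t\<ge>0. \<forall>r k. (\<lambda>s. G1 t s $ r $ k) analytic_on {\<gamma> t}"
    "\<forall>\<^sub>F s in nhds (\<gamma> 0). G1 0 s = f s"
    "\<forall>t\<ge>0. \<forall>\<^sub>F t' in at t within {0..}. \<forall>\<^sub>F s in nhds (\<gamma> t'). G1 t' s = G1 t s"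
    "\<forall>t\<ge>0. u1 t = G1 t (\<gamma> t)"
    using 1 unfolding continuation_along_def by (elim exE conjE) (rule that; assumption)
  note G1 = this[rule_format]
  obtain G2 where "\<forall>t\<ge>0. \<forall>r k. (\<lambda>s. G2 t s $ r $ k) analytic_on {\<gamma> t}"
    "\<forall>\<^sub>F s in nhds (\<gamma> 0). G2 0 s = f s"
    "\<forall>t\<ge>0. \<forall>\<^sub>F t' in at t within {0..}. \<forall>\<^sub>F s in nhds (\<gamma> t'). G2 t' s = G2 t s"
    "\<forall>t\<ge>0. u2 t = G2 t (\<gamma> t)"
    using 2 unfolding continuation_along_def by (elim exE conjE) (rule that; assumption)
  note G2 = this[rule_format]
  define P where "P t \<longleftrightarrow> (\<forall>\<^sub>F s in nhds (\<gamma> t). G1 t s = G2 t s)" for t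
  have "P t"
  proof (rule connected_induction_simple[where S = "{0..}" and P = P and a = 0 and b = t])
    show "P 0" unfolding P_def using G1(2) G2(2) by eventually_elim simp
    fix c :: real assume c: "c \<in> {0..}"
    obtain e1 where e1: "0 < e1" "\<And>r k. (\<lambda>s. G1 c s $ r $ k) holomorphic_on ball (\<gamma> c) e1"
      using analytic_on_matrix_ball[OF G1(1)] c by (metis atLeast_iff)
    obtain e2 where e2: "0 < e2" "\<And>r k. (\<lambda>s. G2 c s $ r $ k) holomorphic_on ball (\<gamma> c) e2"
      using analytic_on_matrix_ball[OF G2(1)] c by (metis atLeast_iff)
    define e where "e = min e1 e2"
    have e: "0 < e" and hol: "(\<lambda>s. G1 c s $ r $ k) holomorphic_on ball (\<gamma> c) e"
      "(\<lambda>s. G2 c s $ r $ k) holomorphic_on ball (\<gamma> c) e" for r k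
      by (use e1(1) e2(1) in \<open>simp add: e_def\<close>,
        rule holomorphic_on_subset[OF e1(2)], simp add: e_def subset_ball,
        rule holomorphic_on_subset[OF e2(2)], simp add: e_def subset_ball)
    have near: "\<forall>\<^sub>F x in at c within {0..}. dist (\<gamma> x) (\<gamma> c) < e"
      using cont c e by (intro tendstoD[of \<gamma>]) (simp_all add: continuous_on_def)
    have "\<forall>\<^sub>F x in at c within {0..}. \<gamma> x \<in> ball (\<gamma> c) e \<and>
        (\<forall>\<^sub>F s in nhds (\<gamma> x). G1 x s = G1 c s) \<and> (\<forall>\<^sub>F s in nhds (\<gamma> x). G2 x s = G2 c s)"
    proof (intro eventually_conj)
      show "\<forall>\<^sub>F x in at c within {0..}. \<gamma> x \<in> ball (\<gamma> c) e"
        using near by (simp add: dist_commute)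
    qed (use G1(3)[of c] G2(3)[of c] c in simp_all)
    then obtain T where T: "openin (top_of_set {0..}) T" "c \<in> T" "\<And>x. x \<in> T \<Longrightarrow> \<gamma> x \<in> ball (\<gamma> c) e \<and>
        (\<forall>\<^sub>F s in nhds (\<gamma> x). G1 x s = G1 c s) \<and> (\<forall>\<^sub>F s in nhds (\<gamma> x). G2 x s = G2 c s)"
      by (rule eventually_within_openin) (use c e in auto)
    have PT: "P y" if xy: "x \<in> T" "y \<in> T" "P x" for x y
    proof -
      have "\<forall>\<^sub>F s in nhds (\<gamma> x). G1 c s = G2 c s"
      proof -
        have "\<forall>\<^sub>F s in nhds (\<gamma> x). G1 x s = G2 x s" "\<forall>\<^sub>F s in nhds (\<gamma> x). G1 x s = G1 c s"
          "\<forall>\<^sub>F s in nhds (\<gamma> x). G2 x s = G2 c s"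
          using T(3)[OF xy(1)] xy(3) unfolding P_def by simp_all
        then show ?thesis by eventually_elim simp
      qed
      then obtain W where W: "open W" "\<gamma> x \<in> W" "\<And>s. s \<in> W \<Longrightarrow> G1 c s = G2 c s"
        unfolding eventually_nhds by auto
      have eq: "G1 c s = G2 c s" if "s \<in> ball (\<gamma> c) e" for s
      proof -
        have "G1 c s $ r $ k = G2 c s $ r $ k" for r k
          by (rule analytic_continuation_open[where s = "W \<inter> ball (\<gamma> c) e" and s' = "ball (\<gamma> c) e"])
            (use W T(3)[OF xy(1)] hol that in auto)
        then show ?thesis by (simp add: vec_eq_iff)
      qed
      have "\<forall>\<^sub>F s in nhds (\<gamma> y). s \<in> ball (\<gamma> c) e"
        using T(3)[OF xy(2)] by (intro eventually_nhds_in_open) auto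
      moreover have "\<forall>\<^sub>F s in nhds (\<gamma> y). G1 y s = G1 c s" "\<forall>\<^sub>F s in nhds (\<gamma> y). G2 y s = G2 c s"
        using T(3)[OF xy(2)] by auto
      ultimately show "P y" unfolding P_def by eventually_elim (simp add: eq)
    qed
    show "\<exists>T. openin (top_of_set {0..}) T \<and> c \<in> T \<and> (\<forall>x\<in>T. \<forall>y\<in>T. P x \<longrightarrow> P y)"
      by (intro exI[of _ T] conjI ballI impI T(1,2)) (rule PT)
  qed (use \<open>0 \<le> t\<close> in auto)
  then have "G1 t (\<gamma> t) = G2 t (\<gamma> t)" unfolding P_def by (rule eventually_nhds_x_imp_x)
  then show ?thesis using G1(4) G2(4) \<open>0 \<le> t\<close> by simp
qed

lemma continuation_along_cong:
  assumes "continuation_along f \<gamma> u" and eq: "\<And>t. 0 \<le> t \<Longrightarrow> \<gamma>' t = \<gamma> t" "\<And>t. 0 \<le> t \<Longrightarrow> u' t = u t"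
  shows "continuation_along f \<gamma>' u'"
proof -
  obtain G where G: "\<forall>t\<ge>0. \<forall>r k. (\<lambda>s. G t s $ r $ k) analytic_on {\<gamma> t}"
    "\<forall>\<^sub>F s in nhds (\<gamma> 0). G 0 s = f s"
    "\<forall>t\<ge>0. \<forall>\<^sub>F t' in at t within {0..}. \<forall>\<^sub>F s in nhds (\<gamma> t'). G t' s = G t s"
    "\<forall>t\<ge>0. u t = G t (\<gamma> t)"
    using assms(1) unfolding continuation_along_def by (elim exE conjE) (rule that; assumption)
  have "\<forall>\<^sub>F t' in at t within {0..}. \<forall>\<^sub>F s in nhds (\<gamma>' t'). G t' s = G t s" if "0 \<le> t" for t
  proof -
    have "\<forall>\<^sub>F t' in at t within {0..}. t' \<in> {0..}" by (simp add: eventually_at_filter)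
    with G(3)[rule_format, OF that] show ?thesis by eventually_elim (simp add: eq)
  qed
  then have 1: "\<forall>t\<ge>0. \<forall>\<^sub>F t' in at t within {0..}. \<forall>\<^sub>F s in nhds (\<gamma>' t'). G t' s = G t s" by simp
  have 2: "\<forall>t\<ge>0. \<forall>r k. (\<lambda>s. G t s $ r $ k) analytic_on {\<gamma>' t}" using G(1) by (simp add: eq)
  have 3: "\<forall>\<^sub>F s in nhds (\<gamma>' 0). G 0 s = f s" using G(2) by (simp add: eq)
  have 4: "\<forall>t\<ge>0. u' t = G t (\<gamma>' t)" using G(4) by (simp add: eq)
  show ?thesis
    unfolding continuation_along_def by (rule exI[of _ G]) (intro conjI 1 2 3 4)
qed

text \<open>Two logarithms differ by a multiple of 2\<pi>i, and a continuous difference cannot jump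
  that far.\<close>

lemma log_along_unique:
  fixes l1 l2 :: "real \<Rightarrow> complex"
  assumes cont: "continuous_on {0..} l1" "continuous_on {0..} l2" and "l1 0 = l2 0"
    and eq: "\<And>t. 0 \<le> t \<Longrightarrow> exp (l1 t) = exp (l2 t)" and "0 \<le> t"
  shows "l1 t = l2 t"
proof (rule connected_induction_simple[where S = "{0..}" and P = "\<lambda>t. l1 t = l2 t" and a = 0 and b = t])
  fix c :: real assume c: "c \<in> {0..}"
  have cd: "continuous_on {0..} (\<lambda>t. l1 t - l2 t)" by (intro continuous_intros cont)
  have "\<forall>\<^sub>F x in at c within {0..}. x \<in> {0..} \<and> dist (l1 x - l2 x) (l1 c - l2 c) < 1"
  proof (rule eventually_conj)
    show "\<forall>\<^sub>F x in at c within {0..}. x \<in> {0..}" by (simp add: eventually_at_filter)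
    from cd have "((\<lambda>t. l1 t - l2 t) \<longlongrightarrow> l1 c - l2 c) (at c within {0..})" using c by (simp add: continuous_on_def)
    then show "\<forall>\<^sub>F x in at c within {0..}. dist (l1 x - l2 x) (l1 c - l2 c) < 1" by (rule tendstoD) simp
  qed
  then obtain T where T: "openin (top_of_set {0..}) T" "c \<in> T"
    "\<forall>x\<in>T. x \<in> {0..} \<and> dist (l1 x - l2 x) (l1 c - l2 c) < 1"
    by (rule eventually_within_openin) (use c in simp_all)
  note T = T(1,2) bspec[OF T(3)]
  have PT: "l1 y = l2 y" if xy: "x \<in> T" "y \<in> T" "l1 x = l2 x" for x y
  proof -
    have "norm (l1 y - l2 y) < 2"
      using T(3)[OF xy(1)] T(3)[OF xy(2)] dist_triangle2[of "l1 y - l2 y" "l1 x - l2 x" "l1 c - l2 c"] xy(3)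
      by simp
    then have "\<bar>Im (l1 y) - Im (l2 y)\<bar> < 2" using abs_Im_le_cmod[of "l1 y - l2 y"] by simp
    then have "\<bar>Im (l1 y) - Im (l2 y)\<bar> < 2 * pi" using pi_gt3 by linarith
    then show ?thesis by (rule exp_complex_eqI) (use eq[of y] T(3)[OF xy(2)] in simp)
  qed
  show "\<exists>T. openin (top_of_set {0..}) T \<and> c \<in> T \<and> (\<forall>x\<in>T. \<forall>y\<in>T. l1 x = l2 x \<longrightarrow> l1 y = l2 y)"
    by (intro exI[of _ T] conjI ballI impI T(1,2)) (rule PT)
qed (use \<open>0 \<le> t\<close> \<open>l1 0 = l2 0\<close> in simp_all)

text \<open>The outcome of \<open>borel_lift\<close> for one block column, so that the analysis of
  trajectories and of Laplace integrals can rest on the lift \<open>V\<close>.\<close>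

locale borel_lift_data =
  fixes blk :: "'n::finite \<Rightarrow> 'p::finite" and lam :: "'p \<Rightarrow> complex" and A :: "complex^'n^'n"
    and T :: "complex fps^'n^'n" and j :: 'p and \<alpha> :: real
    and V :: "complex \<Rightarrow> complex^'n^'n" and M \<epsilon> :: real
  assumes inj: "inj lam" and \<alpha>: "\<alpha> \<in> nonsingular_dirs lam"
    and V_hol: "\<And>r s. (\<lambda>\<zeta>. V \<zeta> $ r $ s) holomorphic_on log_domain lam \<alpha> M"
    and V_col: "\<And>\<zeta>. block_col blk j (V \<zeta>) = V \<zeta>"
    and M_bound: "\<And>i j. norm (lam i - lam j) \<le> exp M"
    and eps: "0 < \<epsilon>" "\<epsilon> \<le> exp M"
    and U_hol: "\<And>r s. (\<lambda>z. U_germ blk T j z $ r $ s) holomorphic_on ball 0 \<epsilon>"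
    and V_germ: "\<And>\<zeta>. Im \<zeta> \<in> dir_class lam \<alpha> \<Longrightarrow> Re \<zeta> < ln \<epsilon> \<Longrightarrow> V \<zeta> = U_germ blk T j (exp \<zeta>)"
    and V_growth: "\<And>a b. a \<in> dir_class lam \<alpha> \<Longrightarrow> b \<in> dir_class lam \<alpha> \<Longrightarrow>
      \<exists>C K. 0 \<le> C \<and> 0 \<le> K \<and> (\<forall>\<zeta>. M + 1 \<le> Re \<zeta> \<or> Im \<zeta> \<in> {a..b} \<longrightarrow>
        norm (V \<zeta>) \<le> C * exp (K * (max 0 (Re \<zeta>) + \<bar>Im \<zeta>\<bar>)))"
begin

lemma ln_eps_le: "ln \<epsilon> \<le> M"
  using eps by (metis ln_mono ln_exp)

lemma continuous_on_V: "continuous_on (log_domain lam \<alpha> M) V"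
  by (intro continuous_on_matrixI holomorphic_on_imp_continuous_on V_hol)

text \<open>
  For a lift \<open>\<zeta>\<close> of \<open>\<gamma>\<close> to the logarithmic plane, \<open>s \<mapsto> V (\<zeta> t + Ln (s / \<gamma> t))\<close> is the continued
  germ at \<open>\<gamma> t\<close>.
\<close>

lemma continuation_along_lift:
  assumes \<zeta>: "continuous_on {0<..} \<zeta>" "\<And>t. 0 < t \<Longrightarrow> \<zeta> t \<in> log_domain lam \<alpha> M"
    and exp_\<zeta>: "\<And>t. 0 < t \<Longrightarrow> exp (\<zeta> t) = \<gamma> t" and \<gamma>: "\<gamma> 0 = 0" "continuous_on {0..} \<gamma>"
  shows "continuation_along (U_germ blk T j) \<gamma> (\<lambda>t. if t = 0 then U_germ blk T j 0 else V (\<zeta> t))"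
proof -
  let ?U = "U_germ blk T j" and ?\<Omega> = "log_domain lam \<alpha> M"
  define L where "L t s = \<zeta> t + Ln (s / \<gamma> t)" for t s
  \<comment> \<open>At t = 0 the path sits at 0, which has no logarithm; there the germ itself is
    used.\<close>
  define G where "G t s = (if t = 0 then ?U s else V (L t s))" for t s
  have \<gamma>0: "\<gamma> t \<noteq> 0" if "0 < t" for t using exp_\<zeta>[OF that] by (metis exp_not_eq_zero)
  have L\<gamma>: "L t (\<gamma> t) = \<zeta> t" if "0 < t" for t using \<gamma>0[OF that] by (simp add: L_def)
  \<comment> \<open>On this disc the quotient \<open>s / \<gamma> t\<close> has positive real part,
    so the principal logarithm is holomorphic.\<close>
  have L_hol: "L t holomorphic_on ball (\<gamma> t) (norm (\<gamma> t))" if "0 < t" for t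
  proof -
    have "s / \<gamma> t \<notin> \<real>\<^sub>\<le>\<^sub>0" if "s \<in> ball (\<gamma> t) (norm (\<gamma> t))" for s
    proof
      assume "s / \<gamma> t \<in> \<real>\<^sub>\<le>\<^sub>0"
      then have "Re (s / \<gamma> t) \<le> 0" by (simp add: complex_nonpos_Reals_iff)
      then have "1 \<le> norm (1 - s / \<gamma> t)" using complex_Re_le_cmod[of "1 - s / \<gamma> t"] by simp
      also have "\<dots> = norm (\<gamma> t - s) / norm (\<gamma> t)"
        using \<gamma>0[OF \<open>0 < t\<close>] by (simp add: diff_divide_distrib flip: norm_divide)
      finally show False using that \<gamma>0[OF \<open>0 < t\<close>] by (simp add: dist_norm)
    qed
    then show ?thesis unfolding L_def using \<gamma>0[OF that] by (intro holomorphic_intros) auto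
  qed
  have L_open: "\<forall>\<^sub>F s in nhds (\<gamma> t). L t s \<in> W" if "0 < t" "open W" "\<zeta> t \<in> W" for t W
  proof -
    have L_cont: "isCont (L t) (\<gamma> t)"
      using holomorphic_on_imp_continuous_on[OF L_hol[OF that(1)]] \<gamma>0[OF that(1)]
      by (simp add: continuous_on_eq_continuous_at)
    have "filterlim (L t) (nhds (\<zeta> t)) (nhds (\<gamma> t))"
      using L_cont L\<gamma>[OF that(1)] by (simp add: isCont_def tendsto_nhds_iff)
    moreover have "\<forall>\<^sub>F z in nhds (\<zeta> t). z \<in> W" using that by (intro eventually_nhds_in_open)
    ultimately show ?thesis by (rule eventually_compose_filterlim[rotated])
  qed
  have op: "open ?\<Omega>" by (rule open_log_domain[OF inj \<alpha>])
  show ?thesis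
    unfolding continuation_along_def
  proof (intro exI[of _ G] conjI allI impI)
    fix t :: real and r k assume "0 \<le> t"
    show "(\<lambda>s. G t s $ r $ k) analytic_on {\<gamma> t}"
    proof (cases "t = 0")
      case True
      then show ?thesis using U_hol[of r k] eps(1) \<gamma>(1) unfolding analytic_at
        by (intro exI[of _ "ball 0 \<epsilon>"]) (simp add: G_def)
    next
      case False
      then have t: "0 < t" using \<open>0 \<le> t\<close> by simp
      define W where "W = ball (\<gamma> t) (norm (\<gamma> t)) \<inter> L t -` ?\<Omega>"
      have "open W" unfolding W_def
        by (intro continuous_open_preimage holomorphic_on_imp_continuous_on L_hol t op open_ball)
      moreover have "\<gamma> t \<in> W" using \<zeta>(2)[OF t] L\<gamma>[OF t] \<gamma>0[OF t] by (simp add: W_def)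
      moreover have "((\<lambda>\<zeta>. V \<zeta> $ r $ k) \<circ> L t) holomorphic_on W"
        by (rule holomorphic_on_compose_gen[OF holomorphic_on_subset[OF L_hol[OF t]] V_hol]) (auto simp: W_def)
      then have "(\<lambda>s. G t s $ r $ k) holomorphic_on W" using False by (simp add: G_def o_def)
      ultimately show ?thesis unfolding analytic_at by blast
    qed
  next
    show "\<forall>\<^sub>F s in nhds (\<gamma> 0). G 0 s = ?U s" by (simp add: G_def)
  next
    fix t :: real assume "0 \<le> t"
    show "\<forall>\<^sub>F t' in at t within {0..}. \<forall>\<^sub>F s in nhds (\<gamma> t'). G t' s = G t s"
    proof (cases "t = 0")
      case True
      \<comment> \<open>Close to t = 0 the path has modulus below \<epsilon> \<le> exp M, which
        leaves only the strip part of the domain; there \<open>V\<close> is the germ by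
        \<open>V_germ\<close>.\<close>
      define W where "W = {z. Im z \<in> dir_class lam \<alpha>} \<inter> {z. Re z < ln \<epsilon>}"
      have W: "open W" unfolding W_def
        by (intro open_Int open_Im_vimage open_dir_class inj \<alpha> open_halfspace_Re_lt)
      have "\<forall>\<^sub>F t' in at 0 within {0..}. dist (\<gamma> t') (\<gamma> 0) < \<epsilon>"
        using \<gamma>(2) eps by (intro tendstoD[of \<gamma>]) (simp_all add: continuous_on_def)
      moreover have "\<forall>\<^sub>F t' in at 0 within {0..}. (0::real) < t'"
        by (simp add: eventually_at_filter less_eq_real_def)
      ultimately show ?thesis unfolding True
      proof eventually_elim
        case (elim t')
        have "exp (Re (\<zeta> t')) < \<epsilon>" using elim \<gamma>(1) exp_\<zeta>[OF elim(2)] norm_exp_eq_Re[of "\<zeta> t'"] by simp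
        then have "exp (Re (\<zeta> t')) < exp (ln \<epsilon>)" using eps by simp
        then have re: "Re (\<zeta> t') < ln \<epsilon>" by (simp only: exp_less_cancel_iff)
        then have "\<zeta> t' \<in> W" using \<zeta>(2)[OF elim(2)] ln_eps_le by (auto simp: W_def log_domain_def)
        from L_open[OF elim(2) W this] have "\<forall>\<^sub>F s in nhds (\<gamma> t'). L t' s \<in> W" .
        moreover have "\<forall>\<^sub>F s in nhds (\<gamma> t'). s \<in> - {0}"
          by (rule eventually_nhds_in_open) (use \<gamma>0[OF elim(2)] in auto)
        ultimately show ?case
        proof eventually_elim
          fix s assume "L t' s \<in> W" "s \<in> - {0}"
          then have "L t' s \<in> W" "s \<noteq> 0" by auto
          moreover have "exp (L t' s) = s"
            using \<gamma>0[OF elim(2)] exp_\<zeta>[OF elim(2)] \<open>s \<noteq> 0\<close> by (simp add: L_def exp_add)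
          moreover have "V (L t' s) = ?U (exp (L t' s))"
            by (rule V_germ) (use \<open>L t' s \<in> W\<close> in \<open>simp_all add: W_def\<close>)
          ultimately show "G t' s = G 0 s" using elim(2) by (simp add: G_def)
        qed
      qed
    next
      case False
      then have t: "0 < t" using \<open>0 \<le> t\<close> by simp
      have "isCont \<zeta> t" using \<zeta>(1) t by (simp add: continuous_on_eq_continuous_at)
      then have "(\<zeta> \<longlongrightarrow> \<zeta> t) (at t within {0..})"
        unfolding isCont_def by (rule tendsto_within_subset) simp
      then have "\<forall>\<^sub>F t' in at t within {0..}. dist (\<zeta> t') (\<zeta> t) < 1"
        by (rule tendstoD) simp
      moreover have "\<forall>\<^sub>F t' in at t within {0..}. 0 < t'"
        using eventually_nhds_in_open[of "{0<..}" t] t unfolding eventually_at_filter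
        by (auto elim: eventually_mono)
      ultimately show ?thesis
      proof eventually_elim
        case (elim t')
        have "isCont (\<lambda>s. Ln (s / \<gamma> t')) (\<gamma> t')"
          using \<gamma>0[OF elim(2)] by (intro continuous_intros) auto
        then have "\<forall>\<^sub>F s in nhds (\<gamma> t'). dist (Ln (s / \<gamma> t')) (Ln (\<gamma> t' / \<gamma> t')) < 1"
          by (intro tendstoD[of "\<lambda>s. Ln (s / \<gamma> t')"]) (simp_all add: isCont_def tendsto_nhds_iff)
        moreover have "\<forall>\<^sub>F s in nhds (\<gamma> t'). s \<in> - {0}"
          by (rule eventually_nhds_in_open) (use \<gamma>0[OF elim(2)] in auto)
        ultimately show ?case
        proof eventually_elim
          fix s assume s: "dist (Ln (s / \<gamma> t')) (Ln (\<gamma> t' / \<gamma> t')) < 1" "s \<in> - {0}"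
          \<comment> \<open>The offset of \<open>L t' s\<close> from \<open>\<zeta> t\<close>. Its
            imaginary part is below 2 < \<pi>, so it is the principal logarithm of
            \<open>s / \<gamma> t\<close>, and the two branches coincide.\<close>
          define y where "y = \<zeta> t' - \<zeta> t + Ln (s / \<gamma> t')"
          have "norm (Ln (s / \<gamma> t')) < 1" using s(1) \<gamma>0[OF elim(2)] by simp
          then have "norm y < 2"
            using elim(1) norm_triangle_ineq[of "\<zeta> t' - \<zeta> t" "Ln (s / \<gamma> t')"] by (simp add: y_def dist_norm)
          then have "\<bar>Im y\<bar> < 2" using abs_Im_le_cmod[of y] by linarith
          then have "Ln (exp y) = y" using pi_gt3 by (intro Ln_exp) auto
          moreover have "exp y = s / \<gamma> t"
            using s(2) \<gamma>0 elim(2) t by (simp add: y_def exp_add exp_diff exp_\<zeta>)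
          ultimately have "L t s = L t' s" by (simp add: L_def y_def)
          then show "G t' s = G t s" using elim(2) t by (simp add: G_def)
        qed
      qed
    qed
  next
    fix t :: real assume "0 \<le> t"
    then show "(if t = 0 then ?U 0 else V (\<zeta> t)) = G t (\<gamma> t)"
      using \<gamma>(1) L\<gamma> by (simp add: G_def)
  qed
qed

end

subsection \<open>The integrals along trajectories\<close>

text \<open>The integrating factor exp(ct) makes w - \<gamma> constant, so the trajectory is unique
  on the half-line.\<close>

lemma trajectory_from_0_iff:
  fixes c w :: complex
  shows "trajectory_from_0 (\<lambda>\<sigma>. c * (w - \<sigma>)) \<gamma> \<longleftrightarrow> (\<forall>t\<ge>0. \<gamma> t = w * (1 - exp (- (c * of_real t))))"
proof
  assume L: "trajectory_from_0 (\<lambda>\<sigma>. c * (w - \<sigma>)) \<gamma>"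
  then have \<gamma>0: "\<gamma> 0 = 0"
    and \<gamma>': "\<And>t. 0 \<le> t \<Longrightarrow> (\<gamma> has_vector_derivative c * (w - \<gamma> t)) (at t within {0..})"
    by (auto simp: trajectory_from_0_def)
  have e: "((\<lambda>t. exp (c * of_real t)) has_vector_derivative c * exp (c * of_real t)) (at t within {0..})" for t
    by (rule has_vector_derivative_real_field) (auto intro!: derivative_eq_intros)
  have "((\<lambda>t. (w - \<gamma> t) * exp (c * of_real t)) has_vector_derivative 0) (at t within {0..})" if "0 \<le> t" for t
  proof -
    have "((\<lambda>t. w - \<gamma> t) has_vector_derivative 0 - c * (w - \<gamma> t)) (at t within {0..})"
      by (intro has_vector_derivative_diff has_vector_derivative_const \<gamma>' that)
    from has_vector_derivative_mult[OF this e] show ?thesis by (simp add: algebra_simps)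
  qed
  note deriv = this
  have "((\<lambda>t. (w - \<gamma> t) * exp (c * of_real t)) has_vector_derivative 0) (at t within {0..})"
    if "t \<in> {0..}" for t using deriv that by simp
  then obtain k where k: "\<And>t. t \<in> {0..} \<Longrightarrow> (w - \<gamma> t) * exp (c * of_real t) = k"
    by (rule has_vector_derivative_zero_constant[OF convex_real_interval(1)]) (assumption, rule that)
  show "\<forall>t\<ge>0. \<gamma> t = w * (1 - exp (- (c * of_real t)))"
  proof (intro allI impI)
    fix t :: real assume "0 \<le> t"
    have "(w - \<gamma> t) * exp (c * of_real t) = w" using k[of t] k[of 0] \<open>0 \<le> t\<close> \<gamma>0 by simp
    then show "\<gamma> t = w * (1 - exp (- (c * of_real t)))" by (simp add: exp_minus field_simps)
  qed
next
  assume R: "\<forall>t\<ge>0. \<gamma> t = w * (1 - exp (- (c * of_real t)))"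
  have "(\<gamma> has_vector_derivative c * (w - \<gamma> t)) (at t within {0..})" if "0 \<le> t" for t
  proof -
    have "w - \<gamma> t = w * exp (- (c * of_real t))" using R that by (simp add: right_diff_distrib)
    moreover have "((\<lambda>t. w * (1 - exp (- (c * of_real t)))) has_vector_derivative c * (w * exp (- (c * of_real t)))) (at t within {0..})"
      by (rule has_vector_derivative_real_field[where f = "\<lambda>z. w * (1 - exp (- (c * z)))"])
        (auto intro!: derivative_eq_intros)
    ultimately have "((\<lambda>t. w * (1 - exp (- (c * of_real t)))) has_vector_derivative c * (w - \<gamma> t)) (at t within {0..})"
      by simp
    then show ?thesis
      by (rule has_vector_derivative_transform[rotated 2]) (use R that in auto)
  qed
  then show "trajectory_from_0 (\<lambda>\<sigma>. c * (w - \<sigma>)) \<gamma>" using R by (simp add: trajectory_from_0_def)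
qed

text \<open>Along a trajectory \<gamma>'/(w - \<gamma>) is the constant c and the continued
  logarithm is -ct. As the continuations of U and of the logarithm are unique, the existential
  definition reduces to one explicit integral.\<close>

lemma has_path_value_iff:
  fixes blk :: "'n::finite \<Rightarrow> 'p::finite" and c w :: complex
  assumes w: "w \<noteq> 0" and traj: "trajectory_from_0 (\<lambda>\<sigma>. c * (w - \<sigma>)) \<gamma>"
    and u: "continuation_along (U_germ blk T j) (\<lambda>t. w * (1 - exp (- (c * of_real t)))) u"
  shows "has_path_value blk A T j w \<rho> \<gamma> X \<longleftrightarrow>
    (\<exists>I. ((\<lambda>t. mat_scale c (u t ** mat_pow (- (c * of_real t)) (diag_block blk j (A + mat \<rho>)))) has_integral I) {0..}
       \<and> X = I ** diag_block blk j (A + mat \<rho>))"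
proof -
  let ?D = "diag_block blk j (A + mat \<rho>)" and ?l = "\<lambda>t. - (c * complex_of_real t)"
  have \<gamma>: "\<gamma> t = w * (1 - exp (?l t))" if "0 \<le> t" for t
    using traj that unfolding trajectory_from_0_iff by simp
  have w\<gamma>: "w - \<gamma> t = w * exp (?l t)" if "0 \<le> t" for t
    using \<gamma>[OF that] by (simp add: algebra_simps)
  have u\<gamma>: "continuation_along (U_germ blk T j) \<gamma> u"
    by (rule continuation_along_cong[OF u]) (auto simp: \<gamma>)
  have cont\<gamma>: "continuous_on {0..} \<gamma>"
    by (subst continuous_on_cong[OF refl, of _ _ "\<lambda>t. w * (1 - exp (?l t))"])
      (auto simp: \<gamma> intro!: continuous_intros)
  have vd: "vector_derivative \<gamma> (at t within {0..}) / (w - \<gamma> t) = c" if "0 \<le> t" for t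
  proof -
    \<comment> \<open>The derivative within the half-line is determined because each of its points,
      0 included, is an accumulation point.\<close>
    have "at t within {0..} \<noteq> bot" using that 
      unfolding trivial_limit_within not_not islimpt_approachable_real
    proof (intro allI impI)
      fix e :: real assume "0 < e"
      then show "\<exists>x\<in>{0..}. x \<noteq> t \<and> \<bar>x - t\<bar> < e" using that by (intro bexI[of _ "t + e / 2"]) auto
    qed
    then have "vector_derivative \<gamma> (at t within {0..}) = c * (w - \<gamma> t)"
      using traj that by (intro vector_derivative_within) (auto simp: trajectory_from_0_def)
    then show ?thesis using w\<gamma>[OF that] w by simp
  qed
  have l: "continuous_on {0..} ?l" "?l 0 = 0" "\<forall>t\<ge>0. exp (?l t) = (w - \<gamma> t) / w"
    using w\<gamma> w by (auto intro!: continuous_intros)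
  have key: "((\<lambda>t. mat_scale (vector_derivative \<gamma> (at t within {0..}) / (w - \<gamma> t))
               (u' t ** mat_pow (l' t) ?D)) has_integral I) {0..} \<longleftrightarrow>
    ((\<lambda>t. mat_scale c (u t ** mat_pow (?l t) ?D)) has_integral I) {0..}"
    if "continuation_along (U_germ blk T j) \<gamma> u'" "continuous_on {0..} l'" "l' 0 = 0"
      "\<forall>t\<ge>0. exp (l' t) = (w - \<gamma> t) / w" for u' l' I
  proof (rule has_integral_cong)
    fix t :: real assume "t \<in> {0..}"
    then have t: "0 \<le> t" by simp
    have "u' t = u t" by (rule continuation_along_unique[OF that(1) u\<gamma> cont\<gamma> t])
    moreover have "l' t = ?l t"
      by (rule log_along_unique[OF that(2) l(1) _ _ t]) (use that l in auto)
    ultimately show "mat_scale (vector_derivative \<gamma> (at t within {0..}) / (w - \<gamma> t)) (u' t ** mat_pow (l' t) ?D)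
      = mat_scale c (u t ** mat_pow (?l t) ?D)" by (simp add: vd[OF t])
  qed
  show ?thesis
  proof
    assume "has_path_value blk A T j w \<rho> \<gamma> X"
    then obtain u' l' I where *: "continuation_along (U_germ blk T j) \<gamma> u'" "continuous_on {0..} l'"
      "l' 0 = 0" "\<forall>t\<ge>0. exp (l' t) = (w - \<gamma> t) / w"
      and I: "((\<lambda>t. mat_scale (vector_derivative \<gamma> (at t within {0..}) / (w - \<gamma> t))
               (u' t ** mat_pow (l' t) ?D)) has_integral I) {0..}" and X: "X = I ** ?D"
      unfolding has_path_value_def by (elim exE conjE) (rule that; assumption)
    show "\<exists>I. ((\<lambda>t. mat_scale c (u t ** mat_pow (?l t) ?D)) has_integral I) {0..} \<and> X = I ** ?D"
      using I X unfolding key[OF *] by (intro exI[of _ I] conjI)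
  next
    assume "\<exists>I. ((\<lambda>t. mat_scale c (u t ** mat_pow (?l t) ?D)) has_integral I) {0..} \<and> X = I ** ?D"
    then obtain I where I: "((\<lambda>t. mat_scale c (u t ** mat_pow (?l t) ?D)) has_integral I) {0..}" "X = I ** ?D"
      by (elim exE conjE)
    then show "has_path_value blk A T j w \<rho> \<gamma> X"
      unfolding has_path_value_def
      by (intro exI[of _ u] exI[of _ ?l] exI[of _ I] conjI u\<gamma> l I(2) key[OF u\<gamma> l, THEN iffD2] I(1))
  qed
qed

subsection \<open>Asymptotics of the trajectories\<close>

text \<open>
  The trajectory is \<open>exp \<omega> * (1 - exp (- \<tau>))\<close> for \<open>T\<^sup>+\<close> and \<open>exp \<omega> * (exp \<tau> - 1)\<close> for \<open>T\<^sup>-\<close>, where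
  \<open>\<tau> = cis \<theta> * t\<close>; this is its logarithm, with \<open>h = 0\<close> for \<open>T\<^sup>+\<close> and \<open>h = 1\<close> for \<open>T\<^sup>-\<close>.
\<close>

definition lift_path :: "real \<Rightarrow> complex \<Rightarrow> complex \<Rightarrow> complex" where
  "lift_path h \<omega> \<tau> = \<omega> + Ln (1 - exp (- \<tau>)) + of_real h * \<tau>"

lemma Re_one_minus_exp_pos:
  assumes "0 < Re \<tau>" shows "0 < Re (1 - exp (- \<tau>))"
proof -
  have "Re (exp (- \<tau>)) \<le> norm (exp (- \<tau>))" by (rule complex_Re_le_cmod)
  also have "\<dots> < 1" using assms by simp
  finally show ?thesis by simp
qed

lemma Im_Ln_one_minus_exp:
  assumes "0 < Re \<tau>" shows "\<bar>Im (Ln (1 - exp (- \<tau>)))\<bar> < pi / 2"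
proof -
  have "0 < Re (1 - exp (- \<tau>))" by (rule Re_one_minus_exp_pos[OF assms])
  moreover from this have "1 - exp (- \<tau>) \<noteq> 0" by auto
  ultimately show ?thesis using Re_Ln_pos_lt by blast
qed

lemma exp_lift_path:
  assumes "0 < Re \<tau>"
  shows "exp (lift_path h \<omega> \<tau>) = exp \<omega> * (1 - exp (- \<tau>)) * exp (of_real h * \<tau>)"
proof -
  have "1 - exp (- \<tau>) \<noteq> 0" using Re_one_minus_exp_pos[OF assms] by auto
  then show ?thesis by (simp add: lift_path_def exp_add)
qed

lemma continuous_on_lift_path: "continuous_on {\<tau>. 0 < Re \<tau>} (lift_path h \<omega>)"
proof -
  have "1 - exp (- \<tau>) \<notin> \<real>\<^sub>\<le>\<^sub>0" if "0 < Re \<tau>" for \<tau>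
    using Re_one_minus_exp_pos[OF that] by (auto simp: complex_nonpos_Reals_iff)
  then show ?thesis unfolding lift_path_def by (intro continuous_intros) auto
qed

text \<open>The quotient (1 - exp(-\<tau>))/\<tau> tends to 1. In the right half-plane numerator and
  denominator have arguments below \<pi>/2, so the logarithm of the quotient splits without a
  multiple of 2\<pi>i.\<close>

lemma Ln_one_minus_exp_asymp:
  "((\<lambda>\<tau>. Ln (1 - exp (- \<tau>)) - Ln \<tau>) \<longlongrightarrow> 0) (at 0 within {\<tau>. 0 < Re \<tau>})"
proof -
  have "((\<lambda>\<tau>. 1 - exp (- \<tau>)) has_field_derivative 1) (at (0::complex))"
    by (auto intro!: derivative_eq_intros)
  then have "((\<lambda>\<tau>. (1 - exp (- \<tau>)) / \<tau>) \<longlongrightarrow> 1) (at (0::complex))"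
    by (simp add: has_field_derivative_iff)
  then have "((\<lambda>\<tau>. Ln ((1 - exp (- \<tau>)) / \<tau>)) \<longlongrightarrow> Ln 1) (at (0::complex))"
    by (rule tendsto_Ln) simp
  then have "((\<lambda>\<tau>. Ln ((1 - exp (- \<tau>)) / \<tau>)) \<longlongrightarrow> Ln 1) (at 0 within {\<tau>. 0 < Re \<tau>})"
    by (rule tendsto_within_subset) simp
  then have "((\<lambda>\<tau>. Ln ((1 - exp (- \<tau>)) / \<tau>)) \<longlongrightarrow> 0) (at 0 within {\<tau>. 0 < Re \<tau>})"
    by simp
  moreover have "\<forall>\<^sub>F \<tau> in at 0 within {\<tau>. 0 < Re \<tau>}.
      Ln ((1 - exp (- \<tau>)) / \<tau>) = Ln (1 - exp (- \<tau>)) - Ln \<tau>"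
    unfolding eventually_at_filter
  proof (intro always_eventually allI impI)
    fix \<tau> :: complex assume "\<tau> \<noteq> 0" "\<tau> \<in> {\<tau>. 0 < Re \<tau>}"
    then have \<tau>: "0 < Re \<tau>" by simp
    have ne: "1 - exp (- \<tau>) \<noteq> 0" using Re_one_minus_exp_pos[OF \<tau>] by auto
    have "\<bar>Im (Ln \<tau>)\<bar> < pi / 2" using Re_Ln_pos_lt[OF \<open>\<tau> \<noteq> 0\<close>] \<tau> by blast
    then have "\<bar>Im (Ln (1 - exp (- \<tau>)) - Ln \<tau>)\<bar> < pi" using Im_Ln_one_minus_exp[OF \<tau>]
      unfolding minus_complex.sel by linarith
    then have "Ln (exp (Ln (1 - exp (- \<tau>)) - Ln \<tau>)) = Ln (1 - exp (- \<tau>)) - Ln \<tau>"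
      by (intro Ln_exp) auto
    then show "Ln ((1 - exp (- \<tau>)) / \<tau>) = Ln (1 - exp (- \<tau>)) - Ln \<tau>"
      using ne \<open>\<tau> \<noteq> 0\<close> by (simp add: exp_diff)
  qed
  ultimately show ?thesis by (simp add: tendsto_cong)
qed

lemma Ln_cis_mult:
  assumes "\<bar>a\<bar> < pi / 2" "0 < t"
  shows "Ln (cis a * of_real t) = of_real (ln t) + \<i> * of_real a"
proof -
  have "Ln (exp (of_real (ln t) + \<i> * of_real a)) = of_real (ln t) + \<i> * of_real a"
    using assms(1) by (intro Ln_exp) (auto simp: abs_less_iff)
  moreover have "exp (of_real (ln t) + \<i> * of_real a) = cis a * of_real t"
    using assms(2) by (simp add: exp_add exp_of_real cis_conv_exp mult.commute)
  ultimately show ?thesis by simp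
qed

lemma norm_exp_minus_1_le: "norm (exp x - 1) \<le> norm x * exp (norm (x::complex))"
proof -
  have "norm (exp x - exp 0) \<le> exp (norm x) * norm (x - 0)"
  proof (rule field_differentiable_bound[of "cball 0 (norm x)" exp exp])
    fix y :: complex assume "y \<in> cball 0 (norm x)"
    then have "Re y \<le> norm x" using complex_Re_le_cmod[of y] by simp
    then show "norm (exp y) \<le> exp (norm x)" by simp
  qed (auto intro: DERIV_subset[OF DERIV_exp])
  then show ?thesis by (simp add: mult.commute)
qed

lemma norm_trajectory_le:
  fixes \<tau> :: complex
  assumes "h = 0 \<or> h = 1"
  shows "norm ((1 - exp (- \<tau>)) * exp (of_real h * \<tau>)) \<le> norm \<tau> * exp (norm \<tau>)"
  using assms
proof
  assume "h = 0"
  then show ?thesis using norm_exp_minus_1_le[of "- \<tau>"] by (simp add: norm_minus_commute)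
next
  assume "h = 1"
  moreover have "(1 - exp (- \<tau>)) * exp \<tau> = exp \<tau> - 1" by (simp add: left_diff_distrib exp_minus)
  ultimately show ?thesis using norm_exp_minus_1_le[of \<tau>] by simp
qed

text \<open>The inequality ln y \<le> y - 1 at y = k (1 + bx), with k = \<delta>/b chosen to make
  the slope \<delta>.\<close>

lemma ln_one_plus_le_linear:
  assumes "0 < b" "0 < \<delta>"
  shows "\<exists>C. \<forall>x>0. ln (1 + b * x) \<le> \<delta> * x + (C::real)"
proof (intro exI allI impI)
  fix x :: real assume x: "0 < x"
  define k where "k = \<delta> / b"
  have k: "0 < k" using assms by (simp add: k_def)
  have p: "0 < 1 + b * x" using assms x by (simp add: add_pos_pos)
  have "ln (k * (1 + b * x)) \<le> k * (1 + b * x) - 1"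
    using k p by (intro ln_le_minus_one) simp
  also have "ln (k * (1 + b * x)) = ln k + ln (1 + b * x)" using k p by (simp add: ln_mult)
  also have "k * (1 + b * x) = \<delta> * x + k" using assms by (simp add: k_def field_simps)
  finally show "ln (1 + b * x) \<le> \<delta> * x + (\<delta> / b - 1 - ln (\<delta> / b))" by (simp add: k_def)
qed

section \<open>Lifted trajectories for large |\<rho>|, uniformly in time\<close>

context
  fixes h \<theta> :: real and \<theta>r :: "real \<Rightarrow> real" and \<omega> :: "real \<Rightarrow> complex" and \<omega>' :: complex
  assumes h: "h = 0 \<or> h = 1" and \<theta>: "\<bar>\<theta>\<bar> < pi / 2" and \<theta>r: "(\<theta>r \<longlongrightarrow> \<theta>) at_top"
    and \<omega>: "((\<lambda>R. \<omega> R - of_real (ln R)) \<longlongrightarrow> \<omega>') at_top"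
begin

lemma eventually_theta: "\<forall>\<^sub>F R in at_top. \<bar>\<theta>r R\<bar> < pi / 2 \<and> cos \<theta> / 2 < cos (\<theta>r R)"
proof (rule eventually_conj)
  have "((\<lambda>R. \<bar>\<theta>r R\<bar>) \<longlongrightarrow> \<bar>\<theta>\<bar>) at_top" by (intro tendsto_intros \<theta>r)
  then show "\<forall>\<^sub>F R in at_top. \<bar>\<theta>r R\<bar> < pi / 2" using \<theta> by (rule order_tendstoD(2))
  have "0 < cos \<theta>" using \<theta> by (intro cos_gt_zero_pi) auto
  then have "cos \<theta> / 2 < cos \<theta>" by simp
  moreover have "((\<lambda>R. cos (\<theta>r R)) \<longlongrightarrow> cos \<theta>) at_top" by (intro tendsto_intros \<theta>r)
  ultimately show "\<forall>\<^sub>F R in at_top. cos \<theta> / 2 < cos (\<theta>r R)" by (intro order_tendstoD(1))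
qed

text \<open>At time x/R the point \<tau> tends to 0, so Ln(1 - exp(-\<tau>)) is close to Ln \<tau> =
  ln x - ln R + i\<theta>; the term -ln R cancels the growth of \<omega>.\<close>

lemma lift_path_tendsto:
  assumes x: "0 < x"
  shows "((\<lambda>R. lift_path h (\<omega> R) (cis (\<theta>r R) * of_real (x / R))) \<longlongrightarrow> \<omega>' + of_real (ln x) + \<i> * of_real \<theta>) at_top"
proof -
  define \<tau> where "\<tau> R = cis (\<theta>r R) * of_real (x / R)" for R
  have xR: "((\<lambda>R. of_real (x / R) :: complex) \<longlongrightarrow> of_real 0) at_top"
    by (intro tendsto_of_real real_tendsto_divide_at_top[OF tendsto_const] filterlim_ident)
  have "(\<tau> \<longlongrightarrow> cis \<theta> * of_real 0) at_top"
    unfolding \<tau>_def cis_conv_exp by (intro tendsto_intros \<theta>r xR)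
  then have \<tau>0: "(\<tau> \<longlongrightarrow> 0) at_top" by simp
  have ev: "\<forall>\<^sub>F R in at_top. 0 < R \<and> \<bar>\<theta>r R\<bar> < pi / 2 \<and> 0 < Re (\<tau> R)"
    using eventually_theta eventually_gt_at_top[of 0]
  proof eventually_elim
    case (elim R)
    then have "0 < cos (\<theta>r R)" by (intro cos_gt_zero_pi) auto
    then show ?case using elim x by (simp add: \<tau>_def)
  qed
  have "filterlim \<tau> (at 0 within {\<tau>. 0 < Re \<tau>}) at_top"
    unfolding filterlim_at using \<tau>0 ev by (auto elim: eventually_mono)
  from filterlim_compose[OF Ln_one_minus_exp_asymp this]
  have "((\<lambda>R. (\<omega> R - of_real (ln R)) + of_real (ln x) + \<i> * of_real (\<theta>r R)
      + (Ln (1 - exp (- \<tau> R)) - Ln (\<tau> R)) + of_real h * \<tau> R) \<longlongrightarrow>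
      \<omega>' + of_real (ln x) + \<i> * of_real \<theta> + 0 + of_real h * 0) at_top"
    by (intro tendsto_add \<omega> tendsto_const tendsto_mult tendsto_of_real \<theta>r \<tau>0)
  moreover have "\<forall>\<^sub>F R in at_top. (\<omega> R - of_real (ln R)) + of_real (ln x) + \<i> * of_real (\<theta>r R)
      + (Ln (1 - exp (- \<tau> R)) - Ln (\<tau> R)) + of_real h * \<tau> R = lift_path h (\<omega> R) (\<tau> R)"
    using ev
  proof eventually_elim
    case (elim R)
    then have "Ln (\<tau> R) = of_real (ln (x / R)) + \<i> * of_real (\<theta>r R)"
      unfolding \<tau>_def using x by (intro Ln_cis_mult) auto
    also have "ln (x / R) = ln x - ln R" using elim x by (simp add: ln_div)
    finally show ?case by (simp add: lift_path_def)
  qed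
  ultimately show ?thesis by (simp add: tendsto_cong \<tau>_def)
qed

lemma filterlim_Re_omega: "filterlim (\<lambda>R. Re (\<omega> R)) at_top at_top"
proof -
  have "((\<lambda>R. Re (\<omega> R - of_real (ln R))) \<longlongrightarrow> Re \<omega>') at_top" by (intro tendsto_intros \<omega>)
  from filterlim_tendsto_add_at_top[OF this ln_at_top] show ?thesis by simp
qed

lemma tendsto_Im_omega: "((\<lambda>R. Im (\<omega> R)) \<longlongrightarrow> Im \<omega>') at_top"
  using tendsto_Im[OF \<omega>] by simp

text \<open>
  As long as a trajectory stays in a bounded region, it follows the ray in direction \<open>Im \<omega>' + \<theta>\<close>.
\<close>

lemma lift_path_dichotomy:
  assumes \<kappa>: "0 < \<kappa>"
  shows "\<forall>\<^sub>F R in at_top. \<forall>t>0. m \<le> Re (lift_path h (\<omega> R) (cis (\<theta>r R) * of_real t)) \<or>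
    \<bar>Im (lift_path h (\<omega> R) (cis (\<theta>r R) * of_real t)) - (Im \<omega>' + \<theta>)\<bar> \<le> \<kappa>"
proof -
  have "\<forall>\<^sub>F \<tau> in at 0 within {\<tau>. 0 < Re \<tau>}. dist (Ln (1 - exp (- \<tau>)) - Ln \<tau>) 0 < \<kappa> / 4"
    by (rule tendstoD[OF Ln_one_minus_exp_asymp]) (use \<kappa> in simp)
  then obtain \<delta> where \<delta>: "0 < \<delta>"
    "\<forall>\<tau>\<in>{\<tau>. 0 < Re \<tau>}. \<tau> \<noteq> 0 \<and> dist \<tau> 0 < \<delta> \<longrightarrow> dist (Ln (1 - exp (- \<tau>)) - Ln \<tau>) 0 < \<kappa> / 4"
    unfolding eventually_at by blast
  \<comment> \<open>Before time \<open>d\<close> the logarithmic error and h \<tau> cost at most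
    \<kappa>/4 each in the imaginary part; large R takes care of the other two quarters, from
    \<open>\<omega>\<close> and \<open>\<theta>r\<close>.\<close>
  define d where "d = min \<delta> (\<kappa> / 4)"
  have d: "0 < d" using \<delta> \<kappa> by (simp add: d_def)
  have c0: "0 < cos \<theta>" using \<theta> by (intro cos_gt_zero_pi) auto
  \<comment> \<open>From time \<open>d\<close> on, Re \<tau> is at least d cos \<theta> / 2, so |1 -
    exp(-\<tau>)| \<ge> exp e; the divergence of Re \<omega> then lifts the rest of the path above
    m.\<close>
  define e where "e = ln (1 - exp (- (cos \<theta> / 2 * d)))"
  have "\<forall>\<^sub>F R in at_top. m - e \<le> Re (\<omega> R)"
    using filterlim_Re_omega by (simp add: filterlim_at_top)
  moreover have "\<forall>\<^sub>F R in at_top. dist (\<theta>r R) \<theta> < \<kappa> / 4" by (rule tendstoD[OF \<theta>r]) (use \<kappa> in simp)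
  moreover have "\<forall>\<^sub>F R in at_top. dist (Im (\<omega> R)) (Im \<omega>') < \<kappa> / 4"
    by (rule tendstoD[OF tendsto_Im_omega]) (use \<kappa> in simp)
  ultimately show ?thesis using eventually_theta
  proof eventually_elim
    case (elim R)
    show ?case
    proof (intro allI impI)
      fix t :: real assume t: "0 < t"
      define \<tau> where "\<tau> = cis (\<theta>r R) * of_real t"
      have norm_\<tau>: "norm \<tau> = t" using t by (simp add: \<tau>_def norm_mult)
      have Re_\<tau>: "Re \<tau> = cos (\<theta>r R) * t" by (simp add: \<tau>_def)
      have cpos: "0 < cos (\<theta>r R)" using elim c0 by linarith
      then have Re_pos: "0 < Re \<tau>" using t Re_\<tau> by simp
      show "m \<le> Re (lift_path h (\<omega> R) \<tau>) \<or> \<bar>Im (lift_path h (\<omega> R) \<tau>) - (Im \<omega>' + \<theta>)\<bar> \<le> \<kappa>"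
      proof (cases "t < d")
        case True
        have "norm (Ln (1 - exp (- \<tau>)) - Ln \<tau>) < \<kappa> / 4"
          using \<delta>(2)[rule_format, of \<tau>] Re_pos norm_\<tau> True t by (auto simp: d_def)
        then have 1: "\<bar>Im (Ln (1 - exp (- \<tau>)) - Ln \<tau>)\<bar> < \<kappa> / 4"
          using abs_Im_le_cmod order_le_less_trans by blast
        have 2: "Im (Ln \<tau>) = \<theta>r R" unfolding \<tau>_def using elim t by (subst Ln_cis_mult) auto
        have "\<bar>Im (of_real h * \<tau>)\<bar> \<le> norm \<tau>" using h abs_Im_le_cmod[of \<tau>] by auto
        then have 3: "\<bar>Im (of_real h * \<tau>)\<bar> < \<kappa> / 4" using True norm_\<tau> by (simp add: d_def)
        have "Im (lift_path h (\<omega> R) \<tau>) - (Im \<omega>' + \<theta>) = (Im (\<omega> R) - Im \<omega>') + (\<theta>r R - \<theta>)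
            + Im (Ln (1 - exp (- \<tau>)) - Ln \<tau>) + Im (of_real h * \<tau>)"
          using 2 by (simp add: lift_path_def)
        moreover have "\<bar>Im (\<omega> R) - Im \<omega>'\<bar> < \<kappa> / 4" "\<bar>\<theta>r R - \<theta>\<bar> < \<kappa> / 4"
          using elim by (auto simp: dist_real_def)
        ultimately show ?thesis using 1 3 by linarith
      next
        case False
        then have "cos \<theta> / 2 * d \<le> Re \<tau>"
          unfolding Re_\<tau> using elim c0 d t by (intro mult_mono) auto
        then have "exp (- Re \<tau>) \<le> exp (- (cos \<theta> / 2 * d))" by simp
        moreover have "1 - exp (- Re \<tau>) \<le> norm (1 - exp (- \<tau>))"
          using norm_triangle_ineq2[of 1 "exp (- \<tau>)"] by simp
        ultimately have le: "1 - exp (- (cos \<theta> / 2 * d)) \<le> norm (1 - exp (- \<tau>))" by linarith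
        have pos: "0 < 1 - exp (- (cos \<theta> / 2 * d))" using c0 d by simp
        then have "e \<le> ln (norm (1 - exp (- \<tau>)))" unfolding e_def using le by (intro ln_mono) auto
        also have "\<dots> = Re (Ln (1 - exp (- \<tau>)))" using le pos by (subst Re_Ln) auto
        finally have "e \<le> Re (Ln (1 - exp (- \<tau>)))" .
        moreover have "0 \<le> Re (of_real h * \<tau>)" using h Re_pos by auto
        ultimately have "m \<le> Re (lift_path h (\<omega> R) \<tau>)" using elim by (simp add: lift_path_def)
        then show ?thesis ..
      qed
    qed
  qed
qed

text \<open>Since exp(Re \<omega>) \<le> bR for large R, the trajectory at time x/R has modulus at
  most b x exp(x/R). The logarithm of this is at most ln(1 + bx) + x/R, and the winding adds a
  constant plus x/R; all of it fits under an arbitrarily small slope.\<close>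

lemma lift_path_growth:
  assumes \<delta>: "0 < \<delta>"
  shows "\<exists>C. \<forall>\<^sub>F R in at_top. \<forall>x>0. max 0 (Re (lift_path h (\<omega> R) (cis (\<theta>r R) * of_real (x / R))))
    + \<bar>Im (lift_path h (\<omega> R) (cis (\<theta>r R) * of_real (x / R)))\<bar> \<le> \<delta> * x + C"
proof -
  define b where "b = exp (Re \<omega>') + 1"
  have b: "0 < b" by (simp add: b_def add_pos_pos)
  obtain C where C: "\<forall>x>0. ln (1 + b * x) \<le> \<delta> / 2 * x + C"
    using ln_one_plus_le_linear[OF b, of "\<delta> / 2"] \<delta> by auto
  have "((\<lambda>R. exp (Re (\<omega> R - of_real (ln R)))) \<longlongrightarrow> exp (Re \<omega>')) at_top" by (intro tendsto_intros \<omega>)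
  then have "\<forall>\<^sub>F R in at_top. exp (Re (\<omega> R - of_real (ln R))) < b" by (rule order_tendstoD(2)) (simp add: b_def)
  moreover have "\<forall>\<^sub>F R in at_top. dist (Im (\<omega> R)) (Im \<omega>') < 1" by (rule tendstoD[OF tendsto_Im_omega]) simp
  ultimately have "\<forall>\<^sub>F R in at_top. \<forall>x>0. max 0 (Re (lift_path h (\<omega> R) (cis (\<theta>r R) * of_real (x / R))))
    + \<bar>Im (lift_path h (\<omega> R) (cis (\<theta>r R) * of_real (x / R)))\<bar> \<le> \<delta> * x + (C + \<bar>Im \<omega>'\<bar> + 1 + pi / 2)"
    using eventually_theta eventually_gt_at_top[of 0] eventually_ge_at_top[of "4 / \<delta>"]
  proof eventually_elim
    case (elim R)
    show ?case
    proof (intro allI impI)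
      fix x :: real assume x: "0 < x"
      define t where "t = x / R"
      define \<tau> where "\<tau> = cis (\<theta>r R) * of_real t"
      have t: "0 < t" using x elim by (simp add: t_def)
      have norm_\<tau>: "norm \<tau> = t" using t by (simp add: \<tau>_def norm_mult)
      have "0 < cos (\<theta>r R)" using elim by (intro cos_gt_zero_pi) auto
      then have Re_pos: "0 < Re \<tau>" using t by (simp add: \<tau>_def)
      have "exp (Re (lift_path h (\<omega> R) \<tau>)) = norm (exp (lift_path h (\<omega> R) \<tau>))" by simp
      also have "\<dots> = exp (Re (\<omega> R)) * norm ((1 - exp (- \<tau>)) * exp (of_real h * \<tau>))"
        unfolding exp_lift_path[OF Re_pos] by (simp only: norm_mult norm_exp_eq_Re mult.assoc)
      also have "\<dots> \<le> exp (Re (\<omega> R)) * (t * exp t)"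
        using norm_trajectory_le[OF h, of \<tau>] unfolding norm_\<tau> by (intro mult_left_mono) auto
      also have "exp (Re (\<omega> R)) = exp (Re (\<omega> R - of_real (ln R))) * R"
        using elim by (simp add: exp_diff)
      also have "exp (Re (\<omega> R - of_real (ln R))) * R * (t * exp t) \<le> b * R * (t * exp t)"
        using elim t by (intro mult_right_mono) auto
      also have "\<dots> = b * x * exp t" using elim by (simp add: t_def)
      also have "\<dots> \<le> (1 + b * x) * exp t" by simp
      finally have "exp (Re (lift_path h (\<omega> R) \<tau>)) \<le> (1 + b * x) * exp t" .
      moreover have p: "0 < 1 + b * x" using b x by (simp add: add_pos_pos)
      moreover have "(1 + b * x) * exp t = exp (ln (1 + b * x) + t)" using p by (simp add: exp_add)
      ultimately have "exp (Re (lift_path h (\<omega> R) \<tau>)) \<le> exp (ln (1 + b * x) + t)" by linarith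
      then have "Re (lift_path h (\<omega> R) \<tau>) \<le> ln (1 + b * x) + t"
        by (simp only: exp_le_cancel_iff)
      moreover have "0 \<le> ln (1 + b * x)" using b x by (intro ln_ge_zero) simp
      ultimately have 1: "max 0 (Re (lift_path h (\<omega> R) \<tau>)) \<le> \<delta> / 2 * x + C + t"
        using C[rule_format, OF x] t by linarith
      have "\<bar>Im (of_real h * \<tau>)\<bar> \<le> t" using h abs_Im_le_cmod[of \<tau>] norm_\<tau> t by auto
      moreover have "\<bar>Im (\<omega> R)\<bar> \<le> \<bar>Im \<omega>'\<bar> + 1" using elim by (auto simp: dist_real_def)
      moreover have "Im (lift_path h (\<omega> R) \<tau>) = Im (\<omega> R) + Im (Ln (1 - exp (- \<tau>))) + Im (of_real h * \<tau>)"
        by (simp add: lift_path_def)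
      ultimately have 2: "\<bar>Im (lift_path h (\<omega> R) \<tau>)\<bar> \<le> \<bar>Im \<omega>'\<bar> + 1 + pi / 2 + t"
        using Im_Ln_one_minus_exp[OF Re_pos] by linarith
      \<comment> \<open>The time t = x/R enters once through the modulus and once through the
        argument; R \<ge> 4/\<delta> lets both together use half of the slope.\<close>
      have "2 * t \<le> \<delta> / 2 * x"
      proof -
        have "4 \<le> \<delta> * R" using elim \<delta> by (simp add: field_simps)
        then have "4 * x \<le> \<delta> * R * x" using x by (intro mult_right_mono) auto
        then show ?thesis using elim by (simp add: t_def field_simps)
      qed
      with 1 2 show "max 0 (Re (lift_path h (\<omega> R) (cis (\<theta>r R) * of_real (x / R))))
        + \<bar>Im (lift_path h (\<omega> R) (cis (\<theta>r R) * of_real (x / R)))\<bar> \<le> \<delta> * x + (C + \<bar>Im \<omega>'\<bar> + 1 + pi / 2)"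
        unfolding \<tau>_def[symmetric] t_def[symmetric] by linarith
    qed
  qed
  then show ?thesis by (rule exI)
qed

end

subsection \<open>Integrals over the half-line\<close>

text \<open>The half-line is open because the lifted integrands involve a logarithm, which is
  missing at 0.\<close>

definition half_line :: "(real \<Rightarrow> 'a::real_vector) \<Rightarrow> real \<Rightarrow> 'a" where
  "half_line f x = indicator {0<..} x *\<^sub>R f x"

lemma half_line_pos [simp]: "0 < x \<Longrightarrow> half_line f x = f x"
  and half_line_nonpos [simp]: "x \<le> 0 \<Longrightarrow> half_line f x = 0"
  by (simp_all add: half_line_def)

lemma half_line_cong: "(\<And>x. 0 < x \<Longrightarrow> f x = g x) \<Longrightarrow> half_line f = half_line g"
proof
  fix x :: real assume "\<And>x. 0 < x \<Longrightarrow> f x = g x"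
  then show "half_line f x = half_line g x" by (cases "0 < x") simp_all
qed

lemma half_line_bounded_linear:
  assumes "bounded_linear T"
  shows "half_line (\<lambda>x. T (f x)) = (\<lambda>x. T (half_line f x))"
  by (simp add: half_line_def fun_eq_iff linear_scale[OF bounded_linear.linear[OF assms]])

lemma half_line_measurable:
  fixes f :: "real \<Rightarrow> 'a::real_normed_vector"
  assumes "continuous_on {0<..} f"
  shows "half_line f \<in> borel_measurable borel"
proof -
  have "(\<lambda>x. indicator {0<..} x *\<^sub>R f x) \<in> borel_measurable borel"
    by (rule borel_measurable_continuous_on_indicator[OF _ assms]) simp
  then show ?thesis by (simp add: half_line_def[abs_def])
qed

lemma integrable_exp_half_line:
  assumes "0 < (c::real)"
  shows "integrable lborel (half_line (\<lambda>x. exp (- c * x)))"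
proof -
  have m: "half_line (\<lambda>x. exp (- c * x)) \<in> borel_measurable borel"
    by (intro half_line_measurable continuous_intros)
  have "integrable lebesgue (\<lambda>x. indicat_real {0..} x *\<^sub>R exp (- c * x))"
    using assms by (intro nonnegative_absolutely_integrable_1 [unfolded set_integrable_def]
      integrable_on_exp_minus_to_infinity) auto
  then have "integrable lebesgue (half_line (\<lambda>x. exp (- c * x)))"
  proof (rule Bochner_Integration.integrable_bound)
    show "half_line (\<lambda>x. exp (- c * x)) \<in> borel_measurable lebesgue"
      using m by (intro measurable_completion) simp
  qed (auto simp: half_line_def indicator_def)
  then show ?thesis using m by (subst (asm) integrable_completion) auto
qed

lemma integrable_half_line:
  fixes f :: "real \<Rightarrow> 'a::{banach, second_countable_topology}"
  assumes "continuous_on {0<..} f" "0 < c" "\<And>x. 0 < x \<Longrightarrow> norm (f x) \<le> C * exp (- c * x)"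
  shows "integrable lborel (half_line f)"
proof (rule Bochner_Integration.integrable_bound)
  show "integrable lborel (\<lambda>x. C * half_line (\<lambda>x. exp (- c * x)) x)"
    by (intro integrable_mult_right integrable_exp_half_line assms)
  show "half_line f \<in> borel_measurable lborel" using half_line_measurable[OF assms(1)] by simp
  show "AE x in lborel. norm (half_line f x) \<le> norm (C * half_line (\<lambda>x. exp (- c * x)) x)"
  proof (rule AE_I2)
    fix x show "norm (half_line f x) \<le> norm (C * half_line (\<lambda>x. exp (- c * x)) x)"
    proof (cases "0 < x")
      case True
      then show ?thesis using assms(3)[OF True] abs_ge_self[of "C * exp (- c * x)"] by simp
    qed simp
  qed
qed

text \<open>Dominated convergence works with the Lebesgue integral, while the definitions use the
  gauge integral over \<open>{0..}\<close>. This is the passage between them, the point 0 being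
  negligible.\<close>

lemma has_integral_half_line:
  fixes f :: "real \<Rightarrow> 'a::euclidean_space"
  assumes "integrable lborel (half_line f)"
  shows "(f has_integral integral\<^sup>L lborel (half_line f)) {0..}"
proof -
  have "half_line f = (\<lambda>x. if x \<in> {0<..} then f x else 0)"
    by (auto simp: half_line_def fun_eq_iff)
  then have "(f has_integral integral\<^sup>L lborel (half_line f)) {0<..}"
    using has_integral_integral_lborel[OF assms] has_integral_restrict_UNIV[of "{0<..}" f] by simp
  moreover have "(f has_integral I) {0..} \<longleftrightarrow> (f has_integral I) {0<..}" for I
  proof (rule has_integral_spike_set_eq)
    show "negligible {x \<in> {0..} - {0<..}. f x \<noteq> 0}"
      by (rule negligible_subset[of "{0}"]) auto
    have eq: "{x \<in> {0<..} - {0..}. f x \<noteq> 0} = {}" by auto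
    show "negligible {x \<in> {0<..} - {0..}. f x \<noteq> 0}" unfolding eq by (rule negligible_empty)
  qed
  ultimately show ?thesis by simp
qed

lemma half_line_scale:
  fixes f :: "real \<Rightarrow> 'a::{banach, second_countable_topology}"
  assumes "0 < R" "integrable lborel (half_line f)"
  shows "integrable lborel (half_line (\<lambda>t. f (R * t)))"
    and "integral\<^sup>L lborel (half_line (\<lambda>t. f (R * t))) = (1 / R) *\<^sub>R integral\<^sup>L lborel (half_line f)"
proof -
  have eq: "half_line (\<lambda>t. f (R * t)) = (\<lambda>t. half_line f (0 + R * t))"
  proof
    fix t show "half_line (\<lambda>t. f (R * t)) t = half_line f (0 + R * t)"
      using assms(1) by (cases "0 < t") (simp_all add: mult_nonneg_nonpos)
  qed
  show "integrable lborel (half_line (\<lambda>t. f (R * t)))"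
    unfolding eq using assms by (intro lborel_integrable_real_affine) auto
  have "integral\<^sup>L lborel (half_line f) = \<bar>R\<bar> *\<^sub>R integral\<^sup>L lborel (half_line (\<lambda>t. f (R * t)))"
    unfolding eq by (rule lborel_integral_real_affine) (use assms in simp)
  then show "integral\<^sup>L lborel (half_line (\<lambda>t. f (R * t))) = (1 / R) *\<^sub>R integral\<^sup>L lborel (half_line f)"
    using assms(1) by simp
qed

lemma half_line_dominated_convergence:
  fixes f :: "real \<Rightarrow> real \<Rightarrow> 'a::{banach, second_countable_topology}"
  assumes c: "0 < c"
    and ev: "\<forall>\<^sub>F R in at_top. continuous_on {0<..} (f R) \<and> (\<forall>x>0. norm (f R x) \<le> C * exp (- c * x))"
    and g: "continuous_on {0<..} g"
    and lim: "\<And>x. 0 < x \<Longrightarrow> ((\<lambda>R. f R x) \<longlongrightarrow> g x) at_top"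
  shows "\<forall>\<^sub>F R in at_top. integrable lborel (half_line (f R))"
    and "integrable lborel (half_line g)"
    and "((\<lambda>R. integral\<^sup>L lborel (half_line (f R))) \<longlongrightarrow> integral\<^sup>L lborel (half_line g)) at_top"
proof -
  define E where "E R \<longleftrightarrow> continuous_on {0<..} (f R) \<and> (\<forall>x>0. norm (f R x) \<le> C * exp (- c * x))" for R
  have evE: "\<forall>\<^sub>F R in at_top. E R" using ev by (simp add: E_def)
  have int: "integrable lborel (half_line (f R))" if "E R" for R
    using that unfolding E_def by (intro integrable_half_line[OF _ c]) auto
  then show "\<forall>\<^sub>F R in at_top. integrable lborel (half_line (f R))"
    using evE by (rule eventually_mono[rotated])
  \<comment> \<open>Off the event \<open>E\<close> nothing is known about \<open>f R\<close>, not
    even measurability; putting 0 there gives measurability for every R without changing the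
    limit.\<close>
  define s where "s R = (if E R then half_line (f R) else (\<lambda>_. 0))" for R
  have meas: "s R \<in> borel_measurable lborel" for R
    using borel_measurable_integrable[OF int] by (auto simp: s_def)
  have measg: "half_line g \<in> borel_measurable lborel" using half_line_measurable[OF g] by simp
  have w: "integrable lborel (\<lambda>x. C * half_line (\<lambda>x. exp (- c * x)) x)"
    by (intro integrable_mult_right integrable_exp_half_line c)
  have slim: "AE x in lborel. ((\<lambda>R. s R x) \<longlongrightarrow> half_line g x) at_top"
  proof (rule AE_I2)
    fix x :: real
    have "((\<lambda>R. half_line (f R) x) \<longlongrightarrow> half_line g x) at_top"
      by (cases "0 < x") (auto intro: lim)
    moreover have "\<forall>\<^sub>F R in at_top. half_line (f R) x = s R x"
      using evE by eventually_elim (simp add: s_def)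
    ultimately show "((\<lambda>R. s R x) \<longlongrightarrow> half_line g x) at_top" by (rule Lim_transform_eventually)
  qed
  have sbound: "\<forall>\<^sub>F R in at_top. AE x in lborel. norm (s R x) \<le> C * half_line (\<lambda>x. exp (- c * x)) x"
  proof (rule eventually_mono[OF evE], rule AE_I2)
    fix R x assume "E R"
    then show "norm (s R x) \<le> C * half_line (\<lambda>x. exp (- c * x)) x"
      by (cases "0 < x") (auto simp: s_def E_def)
  qed
  show "integrable lborel (half_line g)"
    by (rule integrable_dominated_convergence_at_top[OF measg meas w slim sbound])
  have "((\<lambda>R. integral\<^sup>L lborel (s R)) \<longlongrightarrow> integral\<^sup>L lborel (half_line g)) at_top"
    by (rule integral_dominated_convergence_at_top[OF measg meas w slim sbound])
  moreover have "\<forall>\<^sub>F R in at_top. integral\<^sup>L lborel (s R) = integral\<^sup>L lborel (half_line (f R))"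
    using evE by eventually_elim (simp add: s_def)
  ultimately show "((\<lambda>R. integral\<^sup>L lborel (half_line (f R))) \<longlongrightarrow> integral\<^sup>L lborel (half_line g)) at_top"
    by (rule Lim_transform_eventually)
qed

lemma bounded_linear_mat_scale: "bounded_linear (mat_scale c)"
  by (rule bounded_bilinear.bounded_linear_right[OF bounded_bilinear_mat_scale])

lemma bounded_linear_block_col:
  "bounded_linear (block_col blk j :: complex^'n::finite^'n \<Rightarrow> complex^'n^'n)"
  by (intro linear_conv_bounded_linear[THEN iffD1] linearI) (auto simp: vec_eq_iff)

text \<open>Separates the two contributions of A_jj + \<rho>: after division by |\<rho>| the first
  dies out and the second keeps the phase of \<rho>.\<close>

lemma mult_diag_block_add_mat:
  "I ** diag_block blk j (A + mat \<rho>) = I ** diag_block blk j A + mat_scale \<rho> (block_col blk j I)"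
proof -
  have "(I ** diag_block blk j (A + mat \<rho>)) $ r $ s
      = (I ** diag_block blk j A + mat_scale \<rho> (block_col blk j I)) $ r $ s" for r s
  proof -
    have "(I ** diag_block blk j (A + mat \<rho>)) $ r $ s
      = (\<Sum>q\<in>UNIV. I $ r $ q * diag_block blk j A $ q $ s + (if q = s then if blk s = j then \<rho> * I $ r $ s else 0 else 0))"
      unfolding matrix_mult_nth by (intro sum.cong refl) (auto simp: mat_def algebra_simps)
    then show ?thesis by (simp only: sum.distrib) (simp add: matrix_mult_nth)
  qed
  then show ?thesis by (simp add: vec_eq_iff)
qed

lemma norm_sign: "h = 0 \<or> h = (1::real) \<Longrightarrow> norm (of_real (1 - 2 * h) :: complex) = 1"
  by auto

section \<open>The integral in rescaled time and its limit\<close>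

context borel_lift_data
begin

abbreviation "D \<equiv> diag_block blk j A"

text \<open>
  The integrand of \<open>T\<^sup>\<plusminus>\<close> in the rescaled time \<open>x = R t\<close>, where \<open>\<rho> = (1 - 2h) R cis \<phi>\<close>.
\<close>

definition path_integrand :: "real \<Rightarrow> real \<Rightarrow> real \<Rightarrow> complex \<Rightarrow> real \<Rightarrow> real \<Rightarrow> complex^'n^'n" where
  "path_integrand h \<theta> \<phi> \<omega> R x = mat_scale (cis \<theta> * exp (- (cis \<theta> * cis \<phi> * of_real x)))
     (V (lift_path h \<omega> (cis \<theta> * of_real (x / R))) **
       mat_pow (- (of_real (1 - 2 * h) * cis \<theta> * of_real (x / R))) D)"

text \<open>The pointwise limit of \<open>path_integrand\<close>: the matrix power tends to the
  identity and \<open>lift_path\<close> to the argument of \<open>V\<close> here.\<close>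

definition limit_integrand :: "real \<Rightarrow> real \<Rightarrow> complex \<Rightarrow> real \<Rightarrow> complex^'n^'n" where
  "limit_integrand \<theta> \<phi> \<omega>' x = mat_scale (cis \<theta> * exp (- (cis \<theta> * cis \<phi> * of_real x)))
     (V (\<omega>' + of_real (ln x) + \<i> * of_real \<theta>))"

lemma continuous_on_path_integrand:
  assumes "0 < R" "\<bar>\<theta>\<bar> < pi / 2"
    and dom: "\<And>t. 0 < t \<Longrightarrow> lift_path h \<omega> (cis \<theta> * of_real t) \<in> log_domain lam \<alpha> M"
  shows "continuous_on {0<..} (path_integrand h \<theta> \<phi> \<omega> R)"
proof -
  have cpos: "0 < cos \<theta>" using assms(2) by (intro cos_gt_zero_pi) linarith+
  have "continuous_on {0<..} (\<lambda>x. lift_path h \<omega> (cis \<theta> * of_real (x / R)))"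
    by (rule continuous_on_compose2[OF continuous_on_lift_path])
      (use assms(1) cpos in \<open>auto intro!: continuous_intros\<close>)
  then have "continuous_on {0<..} (\<lambda>x. V (lift_path h \<omega> (cis \<theta> * of_real (x / R))))"
    by (rule continuous_on_compose2[OF continuous_on_V]) (rule image_subsetI, rule dom, use assms(1) in simp)
  moreover have "continuous_on {0<..} (\<lambda>x. mat_pow (- (of_real (1 - 2 * h) * cis \<theta> * of_real (x / R))) D)"
    by (rule continuous_on_compose2[OF continuous_on_mat_pow]) (use assms(1) in \<open>auto intro!: continuous_intros\<close>)
  ultimately show ?thesis
    unfolding path_integrand_def
    by (intro bounded_bilinear.continuous_on[OF bounded_bilinear_mat_scale]
        bounded_bilinear.continuous_on[OF bounded_bilinear_matrix_mult] continuous_intros)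
qed

text \<open>The kernel decays like exp(-cos(\<theta>r + \<phi>) x). Against it stand the growth of
  \<open>V\<close> along the trajectory and that of the matrix power; each is made to cost a quarter
  of \<open>cc\<close>, which leaves an integrable majorant of rate cc/2.\<close>

lemma path_integrand_limit:
  fixes \<theta>r :: "real \<Rightarrow> real" and \<omega> :: "real \<Rightarrow> complex"
  assumes h: "h = 0 \<or> h = 1" and \<theta>: "\<bar>\<theta>\<bar> < pi / 2" and \<theta>r: "(\<theta>r \<longlongrightarrow> \<theta>) at_top"
    and \<omega>: "((\<lambda>R. \<omega> R - of_real (ln R)) \<longlongrightarrow> \<omega>') at_top"
    and \<theta>\<phi>: "\<bar>\<theta> + \<phi>\<bar> < pi / 2" and dir: "Im \<omega>' + \<theta> \<in> dir_class lam \<alpha>"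
  shows "\<forall>\<^sub>F R in at_top. \<forall>t>0. lift_path h (\<omega> R) (cis (\<theta>r R) * of_real t) \<in> log_domain lam \<alpha> M"
    and "\<forall>\<^sub>F R in at_top. integrable lborel (half_line (path_integrand h (\<theta>r R) \<phi> (\<omega> R) R))"
    and "integrable lborel (half_line (limit_integrand \<theta> \<phi> \<omega>'))"
    and "((\<lambda>R. integral\<^sup>L lborel (half_line (path_integrand h (\<theta>r R) \<phi> (\<omega> R) R))) \<longlongrightarrow>
      integral\<^sup>L lborel (half_line (limit_integrand \<theta> \<phi> \<omega>'))) at_top"
proof -
  define \<alpha>' where "\<alpha>' = Im \<omega>' + \<theta>"
  \<comment> \<open>Inside the strip the growth bounds hold only on closed substrips, so a margin
    around \<alpha>' is fixed before the trajectories are confined to it.\<close>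
  obtain \<kappa> where \<kappa>: "0 < \<kappa>" "cball \<alpha>' \<kappa> \<subseteq> dir_class lam \<alpha>"
    using open_dir_class[OF inj \<alpha>] dir unfolding \<alpha>'_def open_contains_cball by blast
  have ab: "\<alpha>' - \<kappa> \<in> dir_class lam \<alpha>" "\<alpha>' + \<kappa> \<in> dir_class lam \<alpha>"
    using \<kappa> by (auto simp: dist_real_def)
  obtain C K where C: "0 \<le> C" and K: "0 \<le> K" and V_le: "\<And>\<zeta>. M + 1 \<le> Re \<zeta> \<or> Im \<zeta> \<in> {\<alpha>' - \<kappa>..\<alpha>' + \<kappa>} \<Longrightarrow>
      norm (V \<zeta>) \<le> C * exp (K * (max 0 (Re \<zeta>) + \<bar>Im \<zeta>\<bar>))"
    using V_growth[OF ab] by metis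
  \<comment> \<open>Half of the limiting cosine, so that cos(\<theta>r R + \<phi>) exceeds it for
    large R.\<close>
  define cc where "cc = cos (\<theta> + \<phi>) / 2"
  have cos_pos: "0 < cos (\<theta> + \<phi>)" using \<theta>\<phi> by (intro cos_gt_zero_pi) linarith+
  then have cc: "0 < cc" by (simp add: cc_def)
  \<comment> \<open>Chosen to make K \<delta> at most cc/4; K + 1 in the denominator allows K =
    0.\<close>
  define \<delta> where "\<delta> = cc / (4 * (K + 1))"
  have \<delta>: "0 < \<delta>" using cc K by (simp add: \<delta>_def)
  have K\<delta>: "K * \<delta> \<le> cc / 4"
  proof -
    have "K * \<delta> \<le> (K + 1) * \<delta>" using \<delta> by simp
    also have "\<dots> = cc / 4" using K by (simp add: \<delta>_def field_simps)
    finally show ?thesis .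
  qed
  obtain C1 where C1: "\<forall>\<^sub>F R in at_top. \<forall>x>0. max 0 (Re (lift_path h (\<omega> R) (cis (\<theta>r R) * of_real (x / R))))
    + \<bar>Im (lift_path h (\<omega> R) (cis (\<theta>r R) * of_real (x / R)))\<bar> \<le> \<delta> * x + C1"
    using lift_path_growth[OF h \<theta> \<theta>r \<omega> \<delta>] by auto
  define Kd where "Kd = real CARD('n) ^ 3 * norm D"
  define N1 where "N1 = norm (mat 1 :: complex^'n^'n)"
  define C2 where "C2 = C * exp (K * C1) * N1 * real CARD('n) ^ 3"
  have dich: "\<forall>\<^sub>F R in at_top. \<forall>t>0. M + 1 \<le> Re (lift_path h (\<omega> R) (cis (\<theta>r R) * of_real t)) \<or>
    \<bar>Im (lift_path h (\<omega> R) (cis (\<theta>r R) * of_real t)) - (Im \<omega>' + \<theta>)\<bar> \<le> \<kappa>"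
    by (rule lift_path_dichotomy[OF h \<theta> \<theta>r \<omega> \<kappa>(1)])
  have strip: "y \<in> {\<alpha>' - \<kappa>..\<alpha>' + \<kappa>} \<longleftrightarrow> \<bar>y - (Im \<omega>' + \<theta>)\<bar> \<le> \<kappa>" for y
    by (auto simp: \<alpha>'_def abs_le_iff)
  show dom: "\<forall>\<^sub>F R in at_top. \<forall>t>0. lift_path h (\<omega> R) (cis (\<theta>r R) * of_real t) \<in> log_domain lam \<alpha> M"
    using dich
  proof eventually_elim
    case (elim R)
    show ?case
    proof (intro allI impI)
      fix t :: real assume "0 < t"
      let ?\<zeta> = "lift_path h (\<omega> R) (cis (\<theta>r R) * of_real t)"
      have "M + 1 \<le> Re ?\<zeta> \<or> Im ?\<zeta> \<in> cball \<alpha>' \<kappa>"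
        using elim[rule_format, OF \<open>0 < t\<close>] by (auto simp: dist_real_def \<alpha>'_def abs_minus_commute)
      then show "?\<zeta> \<in> log_domain lam \<alpha> M" using \<kappa>(2) by (auto simp: log_domain_def)
    qed
  qed
  have cos_ev: "\<forall>\<^sub>F R in at_top. cc < cos (\<theta>r R + \<phi>)"
  proof -
    have "((\<lambda>R. cos (\<theta>r R + \<phi>)) \<longlongrightarrow> cos (\<theta> + \<phi>)) at_top" by (intro tendsto_intros \<theta>r)
    then show ?thesis using cos_pos by (intro order_tendstoD(1)) (auto simp: cc_def)
  qed
  have bound: "\<forall>\<^sub>F R in at_top. continuous_on {0<..} (path_integrand h (\<theta>r R) \<phi> (\<omega> R) R) \<and>
      (\<forall>x>0. norm (path_integrand h (\<theta>r R) \<phi> (\<omega> R) R x) \<le> C2 * exp (- (cc / 2) * x))"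
    using dich dom C1 cos_ev eventually_theta[OF h \<theta> \<theta>r \<omega>] eventually_gt_at_top[of 0]
      eventually_ge_at_top[of "4 * Kd / cc"]
  proof eventually_elim
    case (elim R)
    show ?case
    proof (intro conjI allI impI)
      show "continuous_on {0<..} (path_integrand h (\<theta>r R) \<phi> (\<omega> R) R)"
        by (rule continuous_on_path_integrand) (use elim in auto)
      fix x :: real assume x: "0 < x"
      let ?\<zeta> = "lift_path h (\<omega> R) (cis (\<theta>r R) * of_real (x / R))"
      let ?l = "- (of_real (1 - 2 * h) * cis (\<theta>r R) * of_real (x / R)) :: complex"
      have xR: "0 < x / R" using x elim by simp
      have "norm (V ?\<zeta>) \<le> C * exp (K * (max 0 (Re ?\<zeta>) + \<bar>Im ?\<zeta>\<bar>))"
        by (rule V_le) (use elim(1)[rule_format, OF xR] strip in auto)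
      also have "\<dots> \<le> C * exp (K * (\<delta> * x + C1))"
        using elim(3)[rule_format, OF x] C K by (intro mult_left_mono) (auto intro: mult_left_mono)
      also have "K * (\<delta> * x + C1) \<le> cc / 4 * x + K * C1"
        using mult_right_mono[OF K\<delta>, of x] x by (simp add: algebra_simps)
      then have "C * exp (K * (\<delta> * x + C1)) \<le> C * exp (cc / 4 * x + K * C1)"
        using C by (intro mult_left_mono) auto
      finally have V1: "norm (V ?\<zeta>) \<le> C * exp (K * C1) * exp (cc / 4 * x)"
        by (simp add: exp_add mult_ac)
      have "norm ?l = x / R" using norm_sign[OF h] xR by (simp only: norm_minus_cancel norm_mult norm_cis norm_of_real)
      then have "norm (mat_pow ?l D) \<le> N1 * exp (Kd * (x / R))"
        using norm_mat_pow_le[of ?l D] by (simp add: N1_def Kd_def)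
      also have "\<dots> \<le> N1 * exp (cc / 4 * x)"
      proof -
        have "Kd / R \<le> cc / 4" using elim cc by (simp add: field_simps)
        then have "Kd / R * x \<le> cc / 4 * x" using x by (intro mult_right_mono) auto
        then show ?thesis by (intro mult_left_mono) (auto simp: N1_def)
      qed
      finally have P1: "norm (mat_pow ?l D) \<le> N1 * exp (cc / 4 * x)" .
      have "norm (path_integrand h (\<theta>r R) \<phi> (\<omega> R) R x)
        = exp (- (cos (\<theta>r R + \<phi>) * x)) * norm (V ?\<zeta> ** mat_pow ?l D)"
        by (simp add: path_integrand_def norm_mat_scale norm_mult cis_mult)
      also have "\<dots> \<le> exp (- (cc * x)) * (C * exp (K * C1) * exp (cc / 4 * x) * (N1 * exp (cc / 4 * x)) * real CARD('n) ^ 3)"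
      proof (intro mult_mono)
        show "exp (- (cos (\<theta>r R + \<phi>) * x)) \<le> exp (- (cc * x))" using elim x by simp
        have "norm (V ?\<zeta> ** mat_pow ?l D) \<le> norm (V ?\<zeta>) * norm (mat_pow ?l D) * real CARD('n) ^ 3"
          by (rule norm_matrix_mult_le)
        also have "\<dots> \<le> C * exp (K * C1) * exp (cc / 4 * x) * (N1 * exp (cc / 4 * x)) * real CARD('n) ^ 3"
          using V1 P1 C by (intro mult_right_mono mult_mono) auto
        finally show "norm (V ?\<zeta> ** mat_pow ?l D) \<le> C * exp (K * C1) * exp (cc / 4 * x) * (N1 * exp (cc / 4 * x)) * real CARD('n) ^ 3" .
      qed auto
      also have "\<dots> = C2 * (exp (- (cc * x)) * exp (cc / 4 * x) * exp (cc / 4 * x))"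
        by (simp add: C2_def mult_ac)
      also have "exp (- (cc * x)) * exp (cc / 4 * x) * exp (cc / 4 * x) = exp (- (cc / 2) * x)"
        unfolding exp_add[symmetric] by (simp add: field_simps)
      finally show "norm (path_integrand h (\<theta>r R) \<phi> (\<omega> R) R x) \<le> C2 * exp (- (cc / 2) * x)" .
    qed
  qed
  have lim_dom: "\<omega>' + of_real (ln x) + \<i> * of_real \<theta> \<in> log_domain lam \<alpha> M" for x
    using dir by (simp add: log_domain_def)
  have cont_lim: "continuous_on {0<..} (limit_integrand \<theta> \<phi> \<omega>')"
  proof -
    have "continuous_on {0<..} (\<lambda>x. V (\<omega>' + of_real (ln x) + \<i> * of_real \<theta>))"
      by (rule continuous_on_compose2[OF continuous_on_V]) (use lim_dom in \<open>auto intro!: continuous_intros\<close>)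
    then show ?thesis
      unfolding limit_integrand_def
      by (intro bounded_bilinear.continuous_on[OF bounded_bilinear_mat_scale] continuous_intros)
  qed
  have lim: "((\<lambda>R. path_integrand h (\<theta>r R) \<phi> (\<omega> R) R x) \<longlongrightarrow> limit_integrand \<theta> \<phi> \<omega>' x) at_top" if x: "0 < x" for x
  proof -
    have "isCont V (\<omega>' + of_real (ln x) + \<i> * of_real \<theta>)"
      using continuous_on_V open_log_domain[OF inj \<alpha>] lim_dom by (simp add: continuous_on_eq_continuous_at)
    then have 1: "((\<lambda>R. V (lift_path h (\<omega> R) (cis (\<theta>r R) * of_real (x / R)))) \<longlongrightarrow> V (\<omega>' + of_real (ln x) + \<i> * of_real \<theta>)) at_top"
      by (rule isCont_tendsto_compose) (rule lift_path_tendsto[OF h \<theta> \<theta>r \<omega> x])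
    have cis_lim: "((\<lambda>R. cis (\<theta>r R)) \<longlongrightarrow> cis \<theta>) at_top"
      unfolding cis_conv_exp by (intro tendsto_intros \<theta>r)
    have xR: "((\<lambda>R. of_real (x / R) :: complex) \<longlongrightarrow> of_real 0) at_top"
      by (intro tendsto_of_real real_tendsto_divide_at_top[OF tendsto_const] filterlim_ident)
    have "((\<lambda>R. - (of_real (1 - 2 * h) * cis (\<theta>r R) * of_real (x / R))) \<longlongrightarrow>
        - (of_real (1 - 2 * h) * cis \<theta> * of_real 0 :: complex)) at_top"
      by (intro tendsto_minus tendsto_mult tendsto_const cis_lim xR)
    then have l0: "((\<lambda>R. - (of_real (1 - 2 * h) * cis (\<theta>r R) * of_real (x / R)) :: complex) \<longlongrightarrow> 0) at_top" by simp
    have "isCont (\<lambda>l. mat_pow l D) 0"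
      using continuous_on_mat_pow[of D] by (simp add: continuous_on_eq_continuous_at)
    from isCont_tendsto_compose[OF this l0]
    have 2: "((\<lambda>R. mat_pow (- (of_real (1 - 2 * h) * cis (\<theta>r R) * of_real (x / R))) D) \<longlongrightarrow> mat 1) at_top" by simp
    have "((\<lambda>R. path_integrand h (\<theta>r R) \<phi> (\<omega> R) R x) \<longlongrightarrow>
      mat_scale (cis \<theta> * exp (- (cis \<theta> * cis \<phi> * of_real x))) (V (\<omega>' + of_real (ln x) + \<i> * of_real \<theta>) ** mat 1)) at_top"
      unfolding path_integrand_def
      by (intro bounded_bilinear.tendsto[OF bounded_bilinear_mat_scale]
          bounded_bilinear.tendsto[OF bounded_bilinear_matrix_mult] 1 2 tendsto_mult tendsto_exp tendsto_minus tendsto_const cis_lim)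
    then show ?thesis by (simp add: limit_integrand_def)
  qed
  have cc2: "0 < cc / 2" using cc by simp
  show "\<forall>\<^sub>F R in at_top. integrable lborel (half_line (path_integrand h (\<theta>r R) \<phi> (\<omega> R) R))"
    "integrable lborel (half_line (limit_integrand \<theta> \<phi> \<omega>'))"
    "((\<lambda>R. integral\<^sup>L lborel (half_line (path_integrand h (\<theta>r R) \<phi> (\<omega> R) R))) \<longlongrightarrow>
      integral\<^sup>L lborel (half_line (limit_integrand \<theta> \<phi> \<omega>'))) at_top"
    by (rule half_line_dominated_convergence[OF cc2 bound cont_lim lim]; assumption)+
qed

text \<open>The value of \<open>T\<^sup>\<plusminus>\<close> along the trajectory whose logarithm is \<open>lift_path h \<omega>\<close>.\<close>

definition path_value :: "real \<Rightarrow> real \<Rightarrow> real \<Rightarrow> complex \<Rightarrow> real \<Rightarrow> complex^'n^'n" where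
  "path_value h \<theta> \<phi> \<omega> R = (let I = integral\<^sup>L lborel (half_line (path_integrand h \<theta> \<phi> \<omega> R))
     in mat_scale (of_real ((1 - 2 * h) / R)) (I ** D) + mat_scale (cis \<phi>) (block_col blk j I))"

text \<open>For h = 1 the sign sits in exp \<omega> = -w, and (1 - exp(-\<tau>)) exp \<tau> = exp
  \<tau> - 1 turns the formula of the path into w into that of the path to infinity.\<close>

lemma trajectory_exp_lift:
  assumes h: "h = 0 \<or> h = 1" and w: "exp \<omega> = of_real (1 - 2 * h) * w" and "0 < Re \<tau>"
  shows "exp (lift_path h \<omega> \<tau>) = w * (1 - exp (- (of_real (1 - 2 * h) * \<tau>)))"
  using h
proof
  assume "h = 0"
  then show ?thesis using exp_lift_path[OF assms(3), of h \<omega>] w by simp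
next
  assume h1: "h = 1"
  have "(1 - exp (- \<tau>)) * exp \<tau> = exp \<tau> - 1" by (simp add: left_diff_distrib exp_minus)
  then have "exp (lift_path h \<omega> \<tau>) = - w * (exp \<tau> - 1)"
    using exp_lift_path[OF assms(3), of h \<omega>] w h1 by (simp add: mult.assoc)
  also have "\<dots> = w * (1 - exp \<tau>)" by (simp add: algebra_simps)
  finally show ?thesis using h1 by simp
qed

text \<open>On block column j the power with exponent A_jj + \<rho> splits off the scalar exp(l
  \<rho>). Since (1 - 2h) \<rho> = R cis \<phi>, this scalar depends on t only through x = R t, and
  the change of time supplies the 1/R that tames the final factor A_jj + \<rho>.\<close>

lemma has_path_value_iff_path_value:
  fixes w \<rho> :: complex
  assumes h: "h = 0 \<or> h = 1" and \<theta>: "\<bar>\<theta>\<bar> < pi / 2" and R: "0 < R"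
    and w: "w \<noteq> 0" "exp \<omega> = of_real (1 - 2 * h) * w" and \<rho>: "of_real (1 - 2 * h) * \<rho> = of_real R * cis \<phi>"
    and dom: "\<And>t. 0 < t \<Longrightarrow> lift_path h \<omega> (cis \<theta> * of_real t) \<in> log_domain lam \<alpha> M"
    and int: "integrable lborel (half_line (path_integrand h \<theta> \<phi> \<omega> R))"
    and traj: "trajectory_from_0 (\<lambda>\<sigma>. of_real (1 - 2 * h) * cis \<theta> * (w - \<sigma>)) \<gamma>"
  shows "has_path_value blk A T j w \<rho> \<gamma> X \<longleftrightarrow> X = path_value h \<theta> \<phi> \<omega> R"
proof -
  define sg where "sg = (of_real (1 - 2 * h) :: complex)"
  define \<zeta> where "\<zeta> t = lift_path h \<omega> (cis \<theta> * of_real t)" for t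
  define \<gamma>0 where "\<gamma>0 t = w * (1 - exp (- (sg * cis \<theta> * of_real t)))" for t
  define u where "u t = (if t = 0 then U_germ blk T j 0 else V (\<zeta> t))" for t
  have cpos: "0 < cos \<theta>" using \<theta> by (intro cos_gt_zero_pi) linarith+
  have "continuation_along (U_germ blk T j) \<gamma>0 u"
    unfolding u_def
  proof (rule continuation_along_lift)
    show "continuous_on {0<..} \<zeta>"
      unfolding \<zeta>_def by (rule continuous_on_compose2[OF continuous_on_lift_path])
        (use cpos in \<open>auto intro!: continuous_intros\<close>)
    show "\<zeta> t \<in> log_domain lam \<alpha> M" if "0 < t" for t unfolding \<zeta>_def by (rule dom[OF that])
    show "exp (\<zeta> t) = \<gamma>0 t" if "0 < t" for t
      unfolding \<zeta>_def \<gamma>0_def sg_def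
      by (subst trajectory_exp_lift[OF h w(2)]) (use cpos that in \<open>simp_all add: mult.assoc\<close>)
    show "\<gamma>0 0 = 0" by (simp add: \<gamma>0_def)
    show "continuous_on {0..} \<gamma>0" unfolding \<gamma>0_def by (intro continuous_intros)
  qed
  note iff = has_path_value_iff[OF w(1) traj this[unfolded \<gamma>0_def sg_def], of A \<rho> X, folded sg_def]
  let ?f = "path_integrand h \<theta> \<phi> \<omega> R"
  let ?g = "\<lambda>t. mat_scale (sg * cis \<theta>) (u t ** mat_pow (- (sg * cis \<theta> * of_real t)) (diag_block blk j (A + mat \<rho>)))"
  have g: "?g t = mat_scale sg (?f (R * t))" if "0 < t" for t
  proof -
    have "?g t = mat_scale (sg * cis \<theta> * exp (- (sg * cis \<theta> * of_real t) * \<rho>)) (V (\<zeta> t) ** mat_pow (- (sg * cis \<theta> * of_real t)) D)"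
      using that by (simp add: u_def block_col_mult_mat_pow[OF V_col])
    also have "- (sg * cis \<theta> * of_real t) * \<rho> = - (cis \<theta> * cis \<phi> * of_real (R * t))"
    proof -
      have "- (sg * cis \<theta> * of_real t) * \<rho> = - (cis \<theta> * of_real t) * (sg * \<rho>)" by (simp add: mult_ac)
      also have "sg * \<rho> = of_real R * cis \<phi>" unfolding sg_def by (rule \<rho>)
      finally show ?thesis by (simp add: mult_ac)
    qed
    finally show ?thesis using R by (simp add: path_integrand_def \<zeta>_def sg_def mult.assoc)
  qed
  define I where "I = integral\<^sup>L lborel (half_line ?f)"
  have hg: "half_line ?g = (\<lambda>t. mat_scale sg (half_line (\<lambda>t. ?f (R * t)) t))"
    unfolding half_line_bounded_linear[OF bounded_linear_mat_scale, symmetric] by (rule half_line_cong) (rule g)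
  have "integrable lborel (half_line ?g)"
    unfolding hg by (intro integrable_bounded_linear[OF bounded_linear_mat_scale] half_line_scale int R)
  from has_integral_half_line[OF this]
  have "(?g has_integral mat_scale sg ((1 / R) *\<^sub>R I)) {0..}"
    unfolding hg using integral_bounded_linear[OF bounded_linear_mat_scale half_line_scale(1)[OF R int]]
      half_line_scale(2)[OF R int] by (simp add: I_def)
  also have "mat_scale sg ((1 / R) *\<^sub>R I) = mat_scale (sg / of_real R) I"
    by (simp add: vec_eq_iff scaleR_conv_of_real[where 'a=complex])
  finally have gI: "(?g has_integral mat_scale (sg / of_real R) I) {0..}" .
  have "has_path_value blk A T j w \<rho> \<gamma> X \<longleftrightarrow> X = mat_scale (sg / of_real R) I ** diag_block blk j (A + mat \<rho>)"
  proof
    assume "has_path_value blk A T j w \<rho> \<gamma> X"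
    then obtain I' where I': "(?g has_integral I') {0..}" "X = I' ** diag_block blk j (A + mat \<rho>)"
      unfolding iff by (elim exE conjE)
    show "X = mat_scale (sg / of_real R) I ** diag_block blk j (A + mat \<rho>)"
      unfolding I'(2) has_integral_unique[OF I'(1) gI] ..
  next
    assume "X = mat_scale (sg / of_real R) I ** diag_block blk j (A + mat \<rho>)"
    with gI show "has_path_value blk A T j w \<rho> \<gamma> X" unfolding iff by (intro exI conjI)
  qed
  also have "mat_scale (sg / of_real R) I ** diag_block blk j (A + mat \<rho>) = path_value h \<theta> \<phi> \<omega> R"
  proof -
    have "sg * \<rho> = of_real R * cis \<phi>" unfolding sg_def by (rule \<rho>)
    then have "\<rho> * (sg / of_real R) = cis \<phi>" using R by (simp add: field_simps)
    moreover have "block_col blk j (mat_scale c I) = mat_scale c (block_col blk j I)" for c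
      by (simp add: vec_eq_iff)
    ultimately show ?thesis
      by (simp add: mult_diag_block_add_mat mat_scale_mult_left path_value_def I_def[symmetric] sg_def)
  qed
  finally show ?thesis .
qed

text \<open>The A_jj part of the final factor carries 1/R and disappears. The \<rho> part leaves the
  phase of (1 - 2h) \<rho> in front of the limit integral.\<close>

lemma path_value_tendsto:
  fixes \<theta>r :: "real \<Rightarrow> real" and \<omega> :: "real \<Rightarrow> complex"
  assumes "h = 0 \<or> h = 1" "\<bar>\<theta>\<bar> < pi / 2" "(\<theta>r \<longlongrightarrow> \<theta>) at_top"
    "((\<lambda>R. \<omega> R - of_real (ln R)) \<longlongrightarrow> \<omega>') at_top" "\<bar>\<theta> + \<phi>\<bar> < pi / 2" "Im \<omega>' + \<theta> \<in> dir_class lam \<alpha>"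
  shows "((\<lambda>R. path_value h (\<theta>r R) \<phi> (\<omega> R) R) \<longlongrightarrow>
    mat_scale (cis \<phi>) (integral\<^sup>L lborel (half_line (limit_integrand \<theta> \<phi> \<omega>')))) at_top"
proof -
  note lim = path_integrand_limit(4)[OF assms] and int = path_integrand_limit(3)[OF assms]
  let ?J = "integral\<^sup>L lborel (half_line (limit_integrand \<theta> \<phi> \<omega>'))"
  have "block_col blk j ?J = ?J"
  proof -
    have "block_col blk j (limit_integrand \<theta> \<phi> \<omega>' x) = limit_integrand \<theta> \<phi> \<omega>' x" for x
    proof -
      have "block_col blk j (mat_scale c X) = mat_scale c (block_col blk j X)" for c and X :: "complex^'n^'n"
        by (simp add: vec_eq_iff)
      then show ?thesis unfolding limit_integrand_def by (simp only: V_col)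
    qed
    then have "block_col blk j (half_line (limit_integrand \<theta> \<phi> \<omega>') x) = half_line (limit_integrand \<theta> \<phi> \<omega>') x" for x
      by (cases "0 < x") (simp_all add: vec_eq_iff)
    then have eq: "(\<lambda>x. block_col blk j (half_line (limit_integrand \<theta> \<phi> \<omega>') x)) = half_line (limit_integrand \<theta> \<phi> \<omega>')"
      by (rule ext)
    show ?thesis
      using integral_bounded_linear[OF bounded_linear_block_col int, of blk j] unfolding eq by (rule sym)
  qed
  moreover have z: "((\<lambda>R. of_real ((1 - 2 * h) / R) :: complex) \<longlongrightarrow> of_real 0) at_top"
    by (intro tendsto_of_real real_tendsto_divide_at_top[OF tendsto_const] filterlim_ident)
  note 1 = bounded_bilinear.tendsto[OF bounded_bilinear_mat_scale z
      bounded_bilinear.tendsto[OF bounded_bilinear_matrix_mult lim tendsto_const[of D]]]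
  note 2 = bounded_linear.tendsto[OF bounded_linear_mat_scale
      bounded_linear.tendsto[OF bounded_linear_block_col lim], of "cis \<phi>" blk j]
  have "((\<lambda>R. path_value h (\<theta>r R) \<phi> (\<omega> R) R) \<longlongrightarrow>
    mat_scale (of_real 0) (?J ** D) + mat_scale (cis \<phi>) (block_col blk j ?J)) at_top"
    unfolding path_value_def Let_def by (rule tendsto_add[OF 1 2])
  moreover have "mat_scale (of_real 0) X = 0" for X :: "complex^'n^'n" by (simp add: vec_eq_iff)
  ultimately show ?thesis by simp
qed

end

subsection \<open>The Laplace integral\<close>

lemma Re_cis_minus_mult: "Re (cis (- a) * z) = Re z * cos a + Im z * sin a"
  by simp

lemma Re_cis_div_pos:
  assumes "0 < Re (cis (- a) * z)"
  shows "0 < Re (cis a / z)"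
proof -
  define w where "w = cis (- a) * z"
  have "cis a / z = inverse w"
    by (simp add: w_def field_simps flip: cis_inverse)
  moreover have w: "0 < Re w" using assms unfolding w_def .
  then have "w \<noteq> 0" by auto
  then have "0 < (Re w)\<^sup>2 + (Im w)\<^sup>2" by (simp add: complex_neq_0)
  then have "0 < Re (inverse w)" using w by simp
  ultimately show ?thesis by simp
qed

lemma Re_of_real_times: "Re (of_real x * w) = x * Re w"
  by simp

text \<open>As a function of x this is a sinusoid f with sin(b - a) f(x) = sin(b - x) f(a) + sin(x -
  a) f(b), and for b - a < \<pi> all coefficients are non-negative.\<close>

lemma Re_cis_mult_pos_between:
  assumes a: "0 < Re (cis (- a) * z)" and b: "0 < Re (cis (- b) * z)"
    and x: "a \<le> x" "x \<le> b" and ab: "b - a < pi"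
  shows "0 < Re (cis (- x) * z)"
proof (cases "a = b")
  case False
  let ?f = "\<lambda>x. Re z * cos x + Im z * sin x"
  note fa = a[unfolded Re_cis_minus_mult] and fb = b[unfolded Re_cis_minus_mult]
  have eq: "sin (b - a) * ?f x = sin (b - x) * ?f a + sin (x - a) * ?f b"
    unfolding sin_diff by (simp add: algebra_simps)
  have s1: "0 < sin (b - a)" using False x ab by (intro sin_gt_zero) linarith+
  have "0 < sin (b - x) * ?f a + sin (x - a) * ?f b"
  proof -
    have nn: "0 \<le> sin (b - x)" "0 \<le> sin (x - a)" using x ab by (auto intro!: sin_ge_zero)
    have "0 < sin (b - x) \<or> 0 < sin (x - a)"
    proof (cases "x = a")
      case True
      then show ?thesis using False x ab by (intro disjI1 sin_gt_zero) linarith+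
    next
      case ne: False
      then show ?thesis using x ab by (intro disjI2 sin_gt_zero) linarith+
    qed
    then show ?thesis
    proof
      assume "0 < sin (b - x)"
      then show ?thesis
        by (intro add_pos_nonneg mult_pos_pos[OF _ fa] mult_nonneg_nonneg[OF nn(2) less_imp_le[OF fb]])
    next
      assume "0 < sin (x - a)"
      then show ?thesis
        by (intro add_nonneg_pos mult_pos_pos[OF _ fb] mult_nonneg_nonneg[OF nn(1) less_imp_le[OF fa]])
    qed
  qed
  then have "0 < sin (b - a) * ?f x" unfolding eq .
  from zero_less_mult_pos[OF this s1] show ?thesis unfolding Re_cis_minus_mult .
qed (use assms in auto)

text \<open>Both \<open>\<lambda>\<^sub>i - \<lambda>\<^sub>k\<close> and its negative are singular, so every interval of length \<open>\<pi>\<close> contains a singular direction.\<close>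

lemma dir_class_gap:
  fixes lam :: "'p::finite \<Rightarrow> complex" and i k :: 'p
  assumes inj: "inj lam" and \<alpha>: "\<alpha> \<in> nonsingular_dirs lam" and "i \<noteq> k"
    and a: "a \<in> dir_class lam \<alpha>" and b: "b \<in> dir_class lam \<alpha>"
  shows "b - a < pi"
proof (rule ccontr)
  assume "\<not> b - a < pi"
  then have ab: "a + pi \<le> b" by simp
  define \<mu> where "\<mu> = lam i - lam k"
  have \<mu>: "\<mu> \<noteq> 0" using inj \<open>i \<noteq> k\<close> by (simp add: \<mu>_def inj_eq)
  \<comment> \<open>A zero of f means that direction x or its opposite points at \<mu>; since f(a +
    \<pi>) = -f(a), one occurs within a half-turn.\<close>
  define f where "f x = Im (cis (- x) * \<mu>)" for x
  have f: "f x = Im \<mu> * cos x - Re \<mu> * sin x" for x by (simp add: f_def)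
  have cont: "continuous_on {a..a + pi} f" unfolding f by (intro continuous_intros)
  have "f (a + pi) = - f a" by (simp add: f)
  have "\<exists>x. a \<le> x \<and> x \<le> a + pi \<and> f x = 0"
  proof (cases "f a \<le> 0")
    case True
    then show ?thesis using IVT'[of f a 0 "a + pi"] cont \<open>f (a + pi) = - f a\<close> by simp
  next
    case False
    then show ?thesis using IVT2'[of f "a + pi" 0 a] cont \<open>f (a + pi) = - f a\<close> by simp
  qed
  then obtain x where x: "a \<le> x" "x \<le> a + pi" "f x = 0" by blast
  have "x \<in> {a..b}" using x ab by simp
  then have "x \<in> nonsingular_dirs lam"
    using Icc_subset_dir_class[OF inj \<alpha> a b] dir_class_nonsingular[OF inj \<alpha>] by blast
  note nonsing = this[unfolded nonsingular_dirs_def mem_Collect_eq]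
  define s where "s = Re (cis (- x) * \<mu>)"
  have cs: "cis (- x) * \<mu> = of_real s" using x(3) by (simp add: complex_eq_iff s_def f_def)
  have "\<mu> = cis x * (cis (- x) * \<mu>)" by (simp add: mult.assoc[symmetric] cis_mult)
  then have \<mu>s: "\<mu> = rcis s x" unfolding cs by (simp add: rcis_def mult.commute)
  have "s \<noteq> 0" using \<mu> \<mu>s by auto
  then consider "0 < s" | "0 < - s" by linarith
  then show False
  proof cases
    case 1
    have "lam i - lam k = rcis s x" using \<mu>s by (simp add: \<mu>_def)
    then have "\<exists>r>0. lam i - lam k = rcis r x" using 1 by (intro exI[of _ s] conjI)
    then show ?thesis
      using nonsing[THEN spec, THEN spec, THEN mp, OF \<open>i \<noteq> k\<close>] by (rule notE[rotated])
  next
    case 2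
    have "lam k - lam i = rcis (- s) x" using \<mu>s by (simp add: \<mu>_def rcis_def algebra_simps)
    then have "\<exists>r>0. lam k - lam i = rcis r x" using 2 by (intro exI[of _ "- s"] conjI)
    then show ?thesis
      using nonsing[THEN spec, THEN spec, THEN mp, OF \<open>i \<noteq> k\<close>[symmetric]] by (rule notE[rotated])
  qed
qed

context borel_lift_data
begin

definition laplace_integrand :: "real \<Rightarrow> complex \<Rightarrow> real \<Rightarrow> complex^'n^'n" where
  "laplace_integrand a z t = mat_scale (exp (- rcis t a / z) * cis a) (V (of_real (ln t) + \<i> * of_real a))"

lemma ray_in_log_domain: "a \<in> dir_class lam \<alpha> \<Longrightarrow> of_real x + \<i> * of_real a \<in> log_domain lam \<alpha> M"
  by (simp add: log_domain_def)

lemma continuous_on_laplace_integrand: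
  assumes "a \<in> dir_class lam \<alpha>"
  shows "continuous_on {0<..} (laplace_integrand a z)"
proof -
  have "continuous_on {0<..} (\<lambda>t. V (of_real (ln t) + \<i> * of_real a))"
    by (rule continuous_on_compose2[OF continuous_on_V])
      (use ray_in_log_domain[OF assms] in \<open>auto intro!: continuous_intros\<close>)
  moreover have "continuous_on {0<..} (\<lambda>t. exp (- rcis t a / z) * cis a)"
    unfolding rcis_def by (cases "z = 0") (auto intro!: continuous_intros)
  ultimately show ?thesis
    unfolding laplace_integrand_def by (intro bounded_bilinear.continuous_on[OF bounded_bilinear_mat_scale])
qed

text \<open>The decay rate is c = Re(cis a / z), positive because inversion preserves the right
  half-plane; the polynomial growth of \<open>V\<close> along the ray costs at most half of
  it.\<close>

lemma integrable_laplace: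
  assumes a: "a \<in> dir_class lam \<alpha>" and z: "0 < Re (cis (- a) * z)"
  shows "integrable lborel (half_line (laplace_integrand a z))"
proof -
  define c where "c = Re (cis a / z)"
  have c: "0 < c" unfolding c_def by (rule Re_cis_div_pos[OF z])
  obtain C K where C: "0 \<le> C" and K: "0 \<le> K" and V_le: "\<And>\<zeta>. M + 1 \<le> Re \<zeta> \<or> Im \<zeta> \<in> {a..a} \<Longrightarrow>
      norm (V \<zeta>) \<le> C * exp (K * (max 0 (Re \<zeta>) + \<bar>Im \<zeta>\<bar>))"
    using V_growth[OF a a] by metis
  define \<delta> where "\<delta> = c / (2 * (K + 1))"
  have \<delta>: "0 < \<delta>" using c K by (simp add: \<delta>_def)
  have K\<delta>: "K * \<delta> \<le> c / 2"
  proof -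
    have "K * \<delta> \<le> (K + 1) * \<delta>" using \<delta> by simp
    also have "\<dots> = c / 2" using K by (simp add: \<delta>_def field_simps)
    finally show ?thesis .
  qed
  obtain C1 where C1: "\<forall>x>0. ln (1 + 1 * x) \<le> \<delta> * x + C1"
    using ln_one_plus_le_linear[of 1 \<delta>] \<delta> by auto
  show ?thesis
  proof (rule integrable_half_line)
    show "continuous_on {0<..} (laplace_integrand a z)" by (rule continuous_on_laplace_integrand[OF a])
    show "0 < c / 2" using c by simp
    fix t :: real assume t: "0 < t"
    let ?\<zeta> = "of_real (ln t) + \<i> * of_real a :: complex"
    have "max 0 (ln t) \<le> ln (1 + 1 * t)" using t by (auto intro: ln_mono)
    then have m: "max 0 (ln t) \<le> \<delta> * t + C1" using C1[rule_format, OF t] by linarith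
    have "norm (V ?\<zeta>) \<le> C * exp (K * (max 0 (ln t) + \<bar>a\<bar>))" using V_le[of ?\<zeta>] by simp
    also have "\<dots> \<le> C * exp (K * (\<delta> * t + C1 + \<bar>a\<bar>))"
      using m K C by (intro mult_left_mono) (auto intro: mult_left_mono)
    also have "K * (\<delta> * t + C1 + \<bar>a\<bar>) \<le> c / 2 * t + K * (C1 + \<bar>a\<bar>)"
      using mult_right_mono[OF K\<delta>, of t] t by (simp add: algebra_simps)
    then have "C * exp (K * (\<delta> * t + C1 + \<bar>a\<bar>)) \<le> C * exp (c / 2 * t + K * (C1 + \<bar>a\<bar>))"
      using C by (intro mult_left_mono) auto
    finally have V1: "norm (V ?\<zeta>) \<le> C * exp (c / 2 * t + K * (C1 + \<bar>a\<bar>))" .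
    have "rcis t a / z = of_real t * (cis a / z)" by (simp add: rcis_def)
    then have "Re (rcis t a / z) = t * c" by (simp only: Re_of_real_times c_def)
    then have "norm (laplace_integrand a z t) = exp (- (c * t)) * norm (V ?\<zeta>)"
      by (simp add: laplace_integrand_def norm_mat_scale norm_mult mult.commute)
    also have "\<dots> \<le> exp (- (c * t)) * (C * exp (c / 2 * t + K * (C1 + \<bar>a\<bar>)))"
      by (intro mult_left_mono V1) auto
    also have "\<dots> = C * exp (- (c * t) + (c / 2 * t + K * (C1 + \<bar>a\<bar>)))" by (simp only: exp_add mult_ac)
    also have "- (c * t) + (c / 2 * t + K * (C1 + \<bar>a\<bar>)) = K * (C1 + \<bar>a\<bar>) + - (c / 2) * t" by (simp add: field_simps)
    also have "C * exp (K * (C1 + \<bar>a\<bar>) + - (c / 2) * t) = C * exp (K * (C1 + \<bar>a\<bar>)) * exp (- (c / 2) * t)"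
      by (simp only: exp_add mult_ac)
    finally show "norm (laplace_integrand a z t) \<le> C * exp (K * (C1 + \<bar>a\<bar>)) * exp (- (c / 2) * t)" .
  qed
qed

definition laplace_value :: "real \<Rightarrow> complex \<Rightarrow> complex^'n^'n" where
  "laplace_value a z = mat_scale (1 / z) (integral\<^sup>L lborel (half_line (laplace_integrand a z)))"

lemma has_laplace_value_iff:
  assumes a: "a \<in> dir_class lam \<alpha>" and z: "0 < Re (cis (- a) * z)"
  shows "has_laplace_value blk T a j z X \<longleftrightarrow> X = laplace_value a z"
proof -
  define \<zeta> where "\<zeta> t = (of_real (ln t) + \<i> * of_real a :: complex)" for t
  define u where "u t = (if t = 0 then U_germ blk T j 0 else V (\<zeta> t))" for t
  have cont: "continuous_on {0..} (\<lambda>t. rcis t a)" unfolding rcis_def by (intro continuous_intros)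
  have u: "continuation_along (U_germ blk T j) (\<lambda>t. rcis t a) u"
    unfolding u_def
  proof (rule continuation_along_lift[OF _ _ _ _ cont])
    show "continuous_on {0<..} \<zeta>" unfolding \<zeta>_def by (intro continuous_intros) auto
    show "\<zeta> t \<in> log_domain lam \<alpha> M" for t unfolding \<zeta>_def by (rule ray_in_log_domain[OF a])
    show "exp (\<zeta> t) = rcis t a" if "0 < t" for t
      using that by (simp add: \<zeta>_def exp_add exp_of_real rcis_def cis_conv_exp)
  qed simp
  have "half_line (\<lambda>t. mat_scale (exp (- rcis t a / z) * cis a) (u t)) = half_line (laplace_integrand a z)"
    by (rule half_line_cong) (simp add: laplace_integrand_def u_def \<zeta>_def)
  then have int: "((\<lambda>t. mat_scale (exp (- rcis t a / z) * cis a) (u t)) has_integral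
      integral\<^sup>L lborel (half_line (laplace_integrand a z))) {0..}"
    using has_integral_half_line[of "\<lambda>t. mat_scale (exp (- rcis t a / z) * cis a) (u t)"]
      integrable_laplace[OF a z] by simp
  show ?thesis
  proof
    assume "has_laplace_value blk T a j z X"
    then obtain u' I where u': "continuation_along (U_germ blk T j) (\<lambda>t. rcis t a) u'"
      and I: "((\<lambda>t. mat_scale (exp (- rcis t a / z) * cis a) (u' t)) has_integral I) {0..}"
      and X: "X = mat_scale (1 / z) I"
      unfolding has_laplace_value_def by (elim exE conjE) (rule that; assumption)
    have "u' t = u t" if "t \<in> {0..}" for t
      using continuation_along_unique[OF u' u cont] that by simp
    then have "((\<lambda>t. mat_scale (exp (- rcis t a / z) * cis a) (u t)) has_integral I) {0..}"
      by (intro has_integral_eq[OF _ I]) simp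
    from has_integral_unique[OF this int] show "X = laplace_value a z"
      unfolding X laplace_value_def by simp
  next
    assume "X = laplace_value a z"
    then show "has_laplace_value blk T a j z X"
      unfolding has_laplace_value_def laplace_value_def
      by (intro exI[of _ u] exI[of _ "integral\<^sup>L lborel (half_line (laplace_integrand a z))"] conjI u int)
  qed
qed

text \<open>Substitution t = |z| x. Since z has argument a - \<theta> - \<phi>, the exponent s/z
  becomes cis \<theta> cis \<phi> x, the logarithms of s agree, and the constant |z| cis(a -
  \<theta>)/z left over is the phase cis \<phi>.\<close>

lemma limit_integral_eq_laplace_value:
  assumes a: "a \<in> dir_class lam \<alpha>" and z: "z \<noteq> 0" "z = rcis (norm z) (a - \<theta> - \<phi>)" and \<theta>\<phi>: "\<bar>\<theta> + \<phi>\<bar> < pi / 2"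
  shows "0 < Re (cis (- a) * z)"
    and "mat_scale (cis \<phi>) (integral\<^sup>L lborel (half_line (limit_integrand \<theta> \<phi>
      (of_real (ln (norm z)) + \<i> * of_real (a - \<theta>))))) = laplace_value a z"
proof -
  have "cis (- a) * z = of_real (norm z) * cis (- (\<theta> + \<phi>))"
    by (subst z(2)) (simp add: rcis_def cis_mult algebra_simps)
  then have "Re (cis (- a) * z) = norm z * cos (\<theta> + \<phi>)" by (simp only: Re_of_real_times cis.sel cos_minus)
  moreover have "0 < cos (\<theta> + \<phi>)" using \<theta>\<phi> by (intro cos_gt_zero_pi) linarith+
  ultimately show pos: "0 < Re (cis (- a) * z)" using z(1) by simp
  let ?\<omega> = "of_real (ln (norm z)) + \<i> * of_real (a - \<theta>) :: complex"
  let ?L = "laplace_integrand a z" and ?F = "limit_integrand \<theta> \<phi> ?\<omega>"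
  have nz: "0 < norm z" using z(1) by simp
  have zdiv: "rcis (norm z * x) a / z = cis \<theta> * cis \<phi> * of_real x" for x
  proof -
    have "rcis (norm z * x) a = of_real x * (cis (\<theta> + \<phi>) * z)"
      by (subst (2) z(2)) (simp add: rcis_def cis_mult algebra_simps)
    then show ?thesis using z(1) by (simp add: cis_mult mult.commute add.commute)
  qed
  have L: "?L (norm z * x) = mat_scale (cis (a - \<theta>)) (?F x)" if "0 < x" for x
  proof -
    have "of_real (ln (norm z * x)) + \<i> * of_real a = ?\<omega> + of_real (ln x) + \<i> * of_real \<theta>"
      using that nz by (simp add: ln_mult algebra_simps)
    moreover have "- rcis (norm z * x) a / z = - (cis \<theta> * cis \<phi> * of_real x)" using zdiv[of x] by simp
    moreover have "cis a = cis (a - \<theta>) * cis \<theta>" by (simp add: cis_mult)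
    ultimately show ?thesis unfolding laplace_integrand_def limit_integrand_def by (simp only: mat_scale_scale mult_ac)
  qed
  have intL: "integrable lborel (half_line ?L)" by (rule integrable_laplace[OF a pos])
  have hl: "half_line (\<lambda>x. ?L (norm z * x)) = (\<lambda>x. mat_scale (cis (a - \<theta>)) (half_line ?F x))"
    unfolding half_line_bounded_linear[OF bounded_linear_mat_scale, symmetric] by (rule half_line_cong) (rule L)
  have F_eq: "half_line ?F x = mat_scale (cis (\<theta> - a)) (half_line (\<lambda>x. ?L (norm z * x)) x)" for x
    unfolding hl by (simp add: cis_mult)
  have intF: "integrable lborel (half_line ?F)"
    using integrable_bounded_linear[OF bounded_linear_mat_scale half_line_scale(1)[OF nz intL], of "cis (\<theta> - a)"]
    by (simp add: F_eq[symmetric])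
  have "(1 / norm z) *\<^sub>R integral\<^sup>L lborel (half_line ?L) = mat_scale (cis (a - \<theta>)) (integral\<^sup>L lborel (half_line ?F))"
    using half_line_scale(2)[OF nz intL] integral_bounded_linear[OF bounded_linear_mat_scale intF, of "cis (a - \<theta>)"]
    unfolding hl by simp
  then have "mat_scale (of_real (norm z)) ((1 / norm z) *\<^sub>R integral\<^sup>L lborel (half_line ?L))
    = mat_scale (of_real (norm z) * cis (a - \<theta>)) (integral\<^sup>L lborel (half_line ?F))" by simp
  moreover have "mat_scale (of_real (norm z)) ((1 / norm z) *\<^sub>R integral\<^sup>L lborel (half_line ?L)) = integral\<^sup>L lborel (half_line ?L)"
    using nz by (simp add: vec_eq_iff scaleR_conv_of_real[where 'a=complex])
  ultimately have "laplace_value a z = mat_scale (1 / z * (of_real (norm z) * cis (a - \<theta>))) (integral\<^sup>L lborel (half_line ?F))"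
    by (simp add: laplace_value_def)
  also have "1 / z * (of_real (norm z) * cis (a - \<theta>)) = cis \<phi>"
  proof -
    have "of_real (norm z) * cis (a - \<theta>) = cis \<phi> * z"
      by (subst (2) z(2)) (simp add: rcis_def cis_mult mult.left_commute)
    then show ?thesis using z(1) by simp
  qed
  finally show "mat_scale (cis \<phi>) (integral\<^sup>L lborel (half_line ?F)) = laplace_value a z" ..
qed

text \<open>In the logarithmic variable exp(-s/z) U ds becomes exp(-exp \<zeta> / z) exp \<zeta> V
  d\<zeta>. A primitive on the strip replaces contour integration: truncated integrals along
  different rays are differences of its values.\<close>

lemma laplace_primitive:
  obtains H where "\<And>\<zeta>. Im \<zeta> \<in> dir_class lam \<alpha> \<Longrightarrow>
    (H has_field_derivative exp (- exp \<zeta> / z) * exp \<zeta> * V \<zeta> $ r $ s) (at \<zeta>)"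
proof -
  let ?S = "{\<zeta>. Im \<zeta> \<in> dir_class lam \<alpha>}"
  have "(\<lambda>\<zeta>. V \<zeta> $ r $ s) holomorphic_on ?S"
    by (rule holomorphic_on_subset[OF V_hol]) (auto simp: log_domain_def)
  moreover have "(\<lambda>\<zeta>. exp (- exp \<zeta> / z) * exp \<zeta>) holomorphic_on ?S"
    by (cases "z = 0") (auto intro!: holomorphic_intros)
  ultimately have hol: "(\<lambda>\<zeta>. exp (- exp \<zeta> / z) * exp \<zeta> * V \<zeta> $ r $ s) holomorphic_on ?S"
    by (rule holomorphic_on_mult[rotated])
  have "\<i> * of_real \<alpha> \<in> ?S" using base_in_dir_class[OF inj \<alpha>] by simp
  then obtain H where "\<forall>\<zeta>\<in>?S. (H has_field_derivative exp (- exp \<zeta> / z) * exp \<zeta> * V \<zeta> $ r $ s) (at \<zeta>)"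
    using starlike_primitive[OF open_Im_vimage[OF open_dir_class[OF inj \<alpha>]] _ _ hol, of "\<i> * of_real \<alpha>"]
      closed_segment_subset[OF _ _ convex_Im_vimage[OF convex_dir_class[OF inj \<alpha>]]] by auto
  then show ?thesis by (intro that[of H]) simp
qed

text \<open>In the logarithmic plane the two rays are horizontal lines. The vertical segments
  joining them at Re \<zeta> = n and Re \<zeta> = -n contribute nothing in the limit.\<close>

lemma laplace_rotate:
  assumes a: "a \<in> dir_class lam \<alpha>" and b: "b \<in> dir_class lam \<alpha>" and ab: "a \<le> b"
    and z: "\<And>x. x \<in> {a..b} \<Longrightarrow> 0 < Re (cis (- x) * z)"
  shows "integral\<^sup>L lborel (half_line (laplace_integrand a z)) = integral\<^sup>L lborel (half_line (laplace_integrand b z))"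
proof -
  have abI: "{a..b} \<subseteq> dir_class lam \<alpha>" by (rule Icc_subset_dir_class[OF inj \<alpha> a b])
  have z0: "z \<noteq> 0" using z[of a] ab by auto
  obtain c where c: "0 < c" "\<And>x. x \<in> {a..b} \<Longrightarrow> c \<le> Re (cis x / z)"
  proof -
    have "continuous_on {a..b} (\<lambda>x. Re (cis x / z))" by (intro continuous_intros) (use z0 in auto)
    then obtain x0 where x0: "x0 \<in> {a..b}" "\<forall>x\<in>{a..b}. Re (cis x0 / z) \<le> Re (cis x / z)"
      using continuous_attains_inf[of "{a..b}" "\<lambda>x. Re (cis x / z)"] ab by auto
    then show ?thesis using Re_cis_div_pos[OF z[OF x0(1)]] by (intro that[of "Re (cis x0 / z)"]) auto
  qed
  obtain C K where C: "0 \<le> C" and K: "0 \<le> K" and V_le: "\<And>\<zeta>. M + 1 \<le> Re \<zeta> \<or> Im \<zeta> \<in> {a..b} \<Longrightarrow>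
      norm (V \<zeta>) \<le> C * exp (K * (max 0 (Re \<zeta>) + \<bar>Im \<zeta>\<bar>))"
    using V_growth[OF a b] by metis
  define m where "m = max \<bar>a\<bar> \<bar>b\<bar>"
  \<comment> \<open>Bounds the derivative of the primitive on the vertical segment Re \<zeta> = X.
    To the right exp(-c exp X) beats every other factor, to the left exp X does.\<close>
  define E where "E X = exp (- (c * exp X)) * exp X * (C * exp (K * (max 0 X + m)))" for X
  have E1: "(\<lambda>n. E (real n)) \<longlonglongrightarrow> 0"
  proof -
    have "(\<lambda>n. exp (- (c * exp (real n))) * exp (real n) * (C * exp (K * (real n + m)))) \<longlonglongrightarrow> 0"
      using c(1) by real_asymp
    then show ?thesis by (simp add: E_def)
  qed
  have E2: "(\<lambda>n. E (- real n)) \<longlonglongrightarrow> 0"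
  proof -
    have "(\<lambda>n. exp (- (c * exp (- real n))) * exp (- real n) * (C * exp (K * m))) \<longlonglongrightarrow> 0"
      using c(1) by real_asymp
    then show ?thesis by (simp add: E_def)
  qed
  have "integral\<^sup>L lborel (half_line (laplace_integrand a z)) $ r $ s
      = integral\<^sup>L lborel (half_line (laplace_integrand b z)) $ r $ s" for r s
  proof -
    obtain H where H: "\<And>\<zeta>. Im \<zeta> \<in> dir_class lam \<alpha> \<Longrightarrow>
      (H has_field_derivative exp (- exp \<zeta> / z) * exp \<zeta> * V \<zeta> $ r $ s) (at \<zeta>)"
      using laplace_primitive[of z r s] by metis
    define p where "p x X = (of_real X + \<i> * of_real x :: complex)" for x X :: real
    have lim: "(\<lambda>n. H (p x (real n)) - H (p x (- real n))) \<longlonglongrightarrow>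
        integral\<^sup>L lborel (half_line (laplace_integrand x z)) $ r $ s" if x: "x \<in> {a..b}" for x
    proof -
      have xI: "x \<in> dir_class lam \<alpha>" using x abI by blast
      define f where "f = (\<lambda>t. laplace_integrand x z t $ r $ s)"
      have bl: "bounded_linear (\<lambda>X :: complex^'n^'n. X $ r $ s)"
        by (rule bounded_linear_compose[OF bounded_linear_vec_nth bounded_linear_vec_nth])
      have hl: "half_line f = (\<lambda>t. half_line (laplace_integrand x z) t $ r $ s)"
        unfolding f_def by (rule half_line_bounded_linear[OF bl])
      have int: "integrable lborel (half_line f)"
        unfolding hl by (rule integrable_bounded_linear[OF bl integrable_laplace[OF xI z[OF x]]])
      have int_eq: "integral\<^sup>L lborel (half_line f) = integral\<^sup>L lborel (half_line (laplace_integrand x z)) $ r $ s"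
        unfolding hl by (rule integral_bounded_linear[OF bl integrable_laplace[OF xI z[OF x]]])
      have cont: "continuous_on {0<..} f" unfolding f_def
        by (intro bounded_linear.continuous_on[OF bl] continuous_on_laplace_integrand xI)
      \<comment> \<open>Truncation to [exp(-n), exp n] corresponds to Re \<zeta> between -n and
        n.\<close>
      have FTC: "integral\<^sup>L lborel (\<lambda>t. indicator {exp (- real n)..exp (real n)} t *\<^sub>R f t)
          = H (p x (real n)) - H (p x (- real n))" for n
      proof -
        have "integral\<^sup>L lborel (\<lambda>t. indicator {exp (- real n)..exp (real n)} t *\<^sub>R f t)
          = H (p x (ln (exp (real n)))) - H (p x (ln (exp (- real n))))"
        proof (rule integral_FTC_Icc)
          show "exp (- real n) \<le> exp (real n)" by simp
          show "continuous_on {exp (- real n)..exp (real n)} f"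
            by (rule continuous_on_subset[OF cont]) (auto intro: less_le_trans[OF exp_gt_zero])
          fix t assume "exp (- real n) \<le> t"
          then have t: "0 < t" by (rule less_le_trans[OF exp_gt_zero])
          have p': "((\<lambda>t. p x (ln t)) has_vector_derivative of_real (1 / t)) (at t)"
            unfolding p_def using t
            by (auto intro!: derivative_eq_intros has_vector_derivative_of_real
                simp: has_real_derivative_iff_has_vector_derivative[symmetric])
          have "((H \<circ> (\<lambda>t. p x (ln t))) has_vector_derivative of_real (1 / t) *
              (exp (- exp (p x (ln t)) / z) * exp (p x (ln t)) * V (p x (ln t)) $ r $ s)) (at t)"
            by (rule field_vector_diff_chain_at[OF p' H]) (simp add: p_def xI)
          moreover have "exp (p x (ln t)) = rcis t x"
            using t by (simp add: p_def exp_add exp_of_real rcis_def cis_conv_exp)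
          then have "of_real (1 / t) * (exp (- exp (p x (ln t)) / z) * exp (p x (ln t)) * V (p x (ln t)) $ r $ s) = f t"
            using t by (simp add: f_def laplace_integrand_def p_def rcis_def)
          ultimately show "((\<lambda>t. H (p x (ln t))) has_vector_derivative f t) (at t within {exp (- real n)..exp (real n)})"
            by (simp add: o_def has_vector_derivative_at_within)
        qed
        then show ?thesis by simp
      qed
      have "(\<lambda>n. integral\<^sup>L lborel (\<lambda>t. indicator {exp (- real n)..exp (real n)} t *\<^sub>R f t)) \<longlonglongrightarrow> integral\<^sup>L lborel (half_line f)"
      proof (rule integral_dominated_convergence[where w = "\<lambda>t. norm (half_line f t)"])
        show "half_line f \<in> borel_measurable lborel" using int by auto
        show "integrable lborel (\<lambda>t. norm (half_line f t))" by (intro integrable_norm int)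
        have eq: "(\<lambda>t. indicator {exp (- real n)..exp (real n)} t *\<^sub>R f t)
            = (\<lambda>t. indicator {exp (- real n)..exp (real n)} t *\<^sub>R half_line f t)" for n
        proof
          fix t show "indicator {exp (- real n)..exp (real n)} t *\<^sub>R f t = indicator {exp (- real n)..exp (real n)} t *\<^sub>R half_line f t"
            using less_le_trans[OF exp_gt_zero, of "- real n" t] by (auto simp: indicator_def)
        qed
        show "(\<lambda>t. indicator {exp (- real n)..exp (real n)} t *\<^sub>R f t) \<in> borel_measurable lborel" for n
          unfolding eq using int by measurable
        show "AE t in lborel. norm (indicator {exp (- real n)..exp (real n)} t *\<^sub>R f t) \<le> norm (half_line f t)" for n
          unfolding fun_cong[OF eq] by (rule AE_I2) (simp add: indicator_def)
        show "AE t in lborel. (\<lambda>n. indicator {exp (- real n)..exp (real n)} t *\<^sub>R f t) \<longlonglongrightarrow> half_line f t"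
        proof (rule AE_I2)
          fix t :: real
          show "(\<lambda>n. indicator {exp (- real n)..exp (real n)} t *\<^sub>R f t) \<longlonglongrightarrow> half_line f t"
          proof (cases "0 < t")
            case True
            have "\<forall>\<^sub>F n in sequentially. half_line f t = indicator {exp (- real n)..exp (real n)} t *\<^sub>R f t"
              using eventually_ge_at_top[of "nat \<lceil>\<bar>ln t\<bar>\<rceil>"]
            proof eventually_elim
              case (elim n)
              then have "\<bar>ln t\<bar> \<le> real n" by linarith
              then have "exp (- real n) \<le> exp (ln t)" "exp (ln t) \<le> exp (real n)" by auto
              then show ?case using True by simp
            qed
            then show ?thesis by (rule Lim_transform_eventually[OF tendsto_const])
          next
            case False
            then have "indicator {exp (- real n)..exp (real n)} t *\<^sub>R f t = half_line f t" for n
              using less_le_trans[OF exp_gt_zero, of "- real n" t] by (auto simp: indicator_def)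
            then show ?thesis by simp
          qed
        qed
      qed
      then show ?thesis unfolding FTC int_eq .
    qed
    have diff: "norm (H (p a X) - H (p b X)) \<le> E X * (b - a)" for X
    proof -
      let ?S = "{\<zeta>. Re \<zeta> = X} \<inter> {\<zeta>. Im \<zeta> \<in> {a..b}}"
      have eq: "{\<zeta>. Re \<zeta> = X} = {\<zeta>. X \<le> Re \<zeta>} \<inter> {\<zeta>. Re \<zeta> \<le> X}" by auto
      have "convex {\<zeta>. Re \<zeta> = X}"
        unfolding eq by (intro convex_Int convex_halfspace_Re_ge convex_halfspace_Re_le)
      then have conv: "convex ?S" by (intro convex_Int convex_Im_vimage convex_real_interval)
      have "norm (H (p a X) - H (p b X)) \<le> E X * norm (p a X - p b X)"
      proof (rule field_differentiable_bound[OF conv])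
        fix \<zeta> assume \<zeta>: "\<zeta> \<in> ?S"
        then show "(H has_field_derivative exp (- exp \<zeta> / z) * exp \<zeta> * V \<zeta> $ r $ s) (at \<zeta> within ?S)"
          by (intro has_field_derivative_at_within[OF H]) (use abI in auto)
        have ReX: "Re \<zeta> = X" using \<zeta> by simp
        have "exp \<zeta> / z = of_real (exp X) * (cis (Im \<zeta>) / z)"
          by (subst exp_eq_polar) (simp only: ReX times_divide_eq_right)
        then have eqR: "Re (exp \<zeta> / z) = exp X * Re (cis (Im \<zeta>) / z)"
          by (simp only: Re_of_real_times)
        have "exp X * c \<le> exp X * Re (cis (Im \<zeta>) / z)"
          by (rule mult_left_mono[OF c(2)]) (use \<zeta> in simp_all)
        then have "- Re (exp \<zeta> / z) \<le> - (c * exp X)" unfolding eqR by (simp only: neg_le_iff_le mult.commute[of c])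
        moreover have "norm (exp (- exp \<zeta> / z)) = exp (- Re (exp \<zeta> / z))"
          by (simp only: norm_exp_eq_Re minus_divide_left[symmetric] uminus_complex.sel)
        ultimately have n1: "norm (exp (- exp \<zeta> / z)) \<le> exp (- (c * exp X))" by (simp only: exp_le_cancel_iff)
        have n2: "norm (exp \<zeta>) \<le> exp X" using \<zeta> by simp
        have "a \<le> Im \<zeta>" "Im \<zeta> \<le> b" "Re \<zeta> = X" using \<zeta> by auto
        then have "max 0 (Re \<zeta>) + \<bar>Im \<zeta>\<bar> \<le> max 0 X + m" unfolding m_def by linarith
        then have "K * (max 0 (Re \<zeta>) + \<bar>Im \<zeta>\<bar>) \<le> K * (max 0 X + m)" using K by (rule mult_left_mono)
        then have "C * exp (K * (max 0 (Re \<zeta>) + \<bar>Im \<zeta>\<bar>)) \<le> C * exp (K * (max 0 X + m))"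
          using C by (intro mult_left_mono) simp_all
        moreover have "norm (V \<zeta>) \<le> C * exp (K * (max 0 (Re \<zeta>) + \<bar>Im \<zeta>\<bar>))"
          by (rule V_le) (use \<open>a \<le> Im \<zeta>\<close> \<open>Im \<zeta> \<le> b\<close> in simp)
        ultimately have n3: "norm (V \<zeta> $ r $ s) \<le> C * exp (K * (max 0 X + m))"
          using matrix_entry_norm_le[of "V \<zeta>" r s] by linarith
        show "norm (exp (- exp \<zeta> / z) * exp \<zeta> * V \<zeta> $ r $ s) \<le> E X"
          unfolding E_def norm_mult by (rule mult_mono[OF mult_mono[OF n1 n2] n3]) simp_all
      qed (use ab in \<open>simp_all add: p_def\<close>)
      also have "p a X - p b X = \<i> * of_real (a - b)" by (simp add: p_def algebra_simps)
      also have "norm (\<i> * of_real (a - b) :: complex) = b - a" using ab by (simp only: norm_mult norm_ii norm_of_real) simp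
      finally show ?thesis .
    qed
    have 0: "(\<lambda>n. (H (p a (real n)) - H (p a (- real n))) - (H (p b (real n)) - H (p b (- real n)))) \<longlonglongrightarrow> 0"
    proof (rule Lim_null_comparison)
      show "(\<lambda>n. E (real n) * (b - a) + E (- real n) * (b - a)) \<longlonglongrightarrow> 0"
        using tendsto_add[OF tendsto_mult_right[OF E1, of "b - a"] tendsto_mult_right[OF E2, of "b - a"]] by simp
      show "\<forall>\<^sub>F n in sequentially. norm ((H (p a (real n)) - H (p a (- real n))) - (H (p b (real n)) - H (p b (- real n))))
        \<le> E (real n) * (b - a) + E (- real n) * (b - a)"
      proof (rule always_eventually, rule allI)
        fix n
        have eq: "(H (p a (real n)) - H (p a (- real n))) - (H (p b (real n)) - H (p b (- real n)))
          = (H (p a (real n)) - H (p b (real n))) - (H (p a (- real n)) - H (p b (- real n)))" by simp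
        show "norm ((H (p a (real n)) - H (p a (- real n))) - (H (p b (real n)) - H (p b (- real n))))
          \<le> E (real n) * (b - a) + E (- real n) * (b - a)"
          unfolding eq using norm_triangle_ineq4[of "H (p a (real n)) - H (p b (real n))" "H (p a (- real n)) - H (p b (- real n))"]
            diff[of "real n"] diff[of "- real n"] by linarith
      qed
    qed
    have "(\<lambda>n. (H (p a (real n)) - H (p a (- real n))) - (H (p b (real n)) - H (p b (- real n)))) \<longlonglongrightarrow>
      integral\<^sup>L lborel (half_line (laplace_integrand a z)) $ r $ s - integral\<^sup>L lborel (half_line (laplace_integrand b z)) $ r $ s"
      by (intro tendsto_diff lim) (use ab in auto)
    from LIMSEQ_unique[OF this 0] show ?thesis by simp
  qed
  then show ?thesis by (simp add: vec_eq_iff)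
qed

lemma laplace_value_near:
  assumes a: "a \<in> dir_class lam \<alpha>" "0 < Re (cis (- a) * z)" and b: "b \<in> dir_class lam \<alpha>" "0 < Re (cis (- b) * z)"
    and "\<bar>a - b\<bar> < pi"
  shows "laplace_value a z = laplace_value b z"
proof (cases "a \<le> b")
  case True
  have "0 < Re (cis (- x) * z)" if "x \<in> {a..b}" for x
    by (rule Re_cis_mult_pos_between[OF a(2) b(2)]) (use that assms(5) in auto)
  from laplace_rotate[OF a(1) b(1) True this] show ?thesis by (simp add: laplace_value_def)
next
  case False
  have "0 < Re (cis (- x) * z)" if "x \<in> {b..a}" for x
    by (rule Re_cis_mult_pos_between[OF b(2) a(2)]) (use that assms(5) in auto)
  from laplace_rotate[OF b(1) a(1) _ this] False show ?thesis by (simp add: laplace_value_def)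
qed

text \<open>With at least two blocks, directions in [\<alpha>] differ by less than \<pi>. With a
  single block every direction is non-singular, so b is first moved by a multiple of 2\<pi>, which
  does not affect the integral, to within \<pi> of a.\<close>

lemma laplace_value_unique:
  assumes a: "a \<in> dir_class lam \<alpha>" "0 < Re (cis (- a) * z)" and b: "b \<in> dir_class lam \<alpha>" "0 < Re (cis (- b) * z)"
  shows "laplace_value a z = laplace_value b z"
proof (cases "\<exists>i k :: 'p. i \<noteq> k")
  case True
  then obtain i k :: 'p where ik: "i \<noteq> k" by blast
  have "\<bar>a - b\<bar> < pi"
    using dir_class_gap[OF inj \<alpha> ik a(1) b(1)] dir_class_gap[OF inj \<alpha> ik b(1) a(1)] by linarith
  then show ?thesis by (rule laplace_value_near[OF a b])
next
  case False
  then have "nonsingular_dirs lam = UNIV" by (auto simp: nonsingular_dirs_def)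
  then have cls: "dir_class lam \<alpha> = UNIV" by (simp add: dir_class_def connected_component_eq_UNIV[symmetric])
  define k where "k = round ((a - b) / (2 * pi))"
  define b' where "b' = b + 2 * pi * of_int k"
  have cis_b': "cis b' = cis b"
    unfolding b'_def cis_mult[symmetric] cis_multiple_2pi[OF Ints_of_int] by simp
  have cis_mb': "cis (- b') = cis (- b)"
    using cis_b' by (metis cis_cnj)
  have "\<bar>of_int k - (a - b) / (2 * pi)\<bar> \<le> 1 / 2" unfolding k_def by (rule of_int_round_abs_le)
  then have "\<bar>of_int k - (a - b) / (2 * pi)\<bar> * (2 * pi) \<le> 1 / 2 * (2 * pi)" by (intro mult_right_mono) auto
  then have "\<bar>(of_int k - (a - b) / (2 * pi)) * (2 * pi)\<bar> \<le> pi" by (simp add: abs_mult)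
  moreover have "(of_int k - (a - b) / (2 * pi)) * (2 * pi) = b' - a" by (simp add: b'_def field_simps)
  ultimately have le: "\<bar>b' - a\<bar> \<le> pi" by simp
  have pos': "0 < Re (cis (- b') * z)" using b(2) unfolding cis_mb' .
  \<comment> \<open>Opposite directions cannot both satisfy the positivity condition, since the real
    part changes sign.\<close>
  have "\<bar>a - b'\<bar> \<noteq> pi"
  proof
    assume "\<bar>a - b'\<bar> = pi"
    then have "a = b' + pi \<or> a = b' - pi" by linarith
    then have "cos a = - cos b' \<and> sin a = - sin b'"
      by (elim disjE) (simp_all add: cos_diff sin_diff)
    then have "Re (cis (- a) * z) = - Re (cis (- b') * z)"
      unfolding Re_cis_minus_mult by simp
    then show False using a(2) pos' by linarith
  qed
  then have "laplace_value a z = laplace_value b' z"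
    using le pos' by (intro laplace_value_near a) (auto simp: cls abs_minus_commute)
  also have "laplace_value b' z = laplace_value b z"
  proof -
    have "has_laplace_value blk T b' j z = has_laplace_value blk T b j z"
      unfolding has_laplace_value_def rcis_def cis_b' ..
    moreover have "has_laplace_value blk T b' j z (laplace_value b' z)"
      using has_laplace_value_iff[of b' z] pos' by (simp add: cls)
    ultimately show ?thesis using has_laplace_value_iff[OF b] by simp
  qed
  finally show ?thesis .
qed

lemma T_lim_eq:
  assumes a: "a \<in> dir_class lam \<alpha>" "0 < Re (cis (- a) * z)"
  shows "T_lim blk lam T \<alpha> j z = laplace_value a z"
  unfolding T_lim_def
proof (rule the_equality)
  show "\<exists>\<alpha>'\<in>dir_class lam \<alpha>. 0 < Re (cis (- \<alpha>') * z) \<and> has_laplace_value blk T \<alpha>' j z (laplace_value a z)"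
    using a has_laplace_value_iff[OF a, of "laplace_value a z"] by (intro bexI[of _ a] conjI) simp_all
  fix X assume "\<exists>\<alpha>'\<in>dir_class lam \<alpha>. 0 < Re (cis (- \<alpha>') * z) \<and> has_laplace_value blk T \<alpha>' j z X"
  then obtain b where b: "b \<in> dir_class lam \<alpha>" "0 < Re (cis (- b) * z)" "has_laplace_value blk T b j z X" by blast
  then have "X = laplace_value b z" using has_laplace_value_iff[OF b(1,2)] by blast
  then show "X = laplace_value a z" using laplace_value_unique[OF a b(1,2)] by simp
qed

end

subsection \<open>Homotopies on the Riemann sphere\<close>

text \<open>Polar coordinates let modulus and angle be deformed separately. The angle is
  undetermined at t = 0, but there the modulus is 0; at the other end, growth of the modulus uniform
  in x gives continuity at the point at infinity.\<close>

lemma homotopic_sphere_paths: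
  fixes r a :: "real \<Rightarrow> real \<Rightarrow> real"
  assumes r: "continuous_on ({0..1} \<times> {0..}) (\<lambda>p. r (fst p) (snd p))" and r0: "\<And>x. r x 0 = 0"
    and r_lim: "\<And>B. \<exists>t0\<ge>0. \<forall>x\<in>{0..1}. \<forall>t\<ge>t0. B \<le> r x t"
    and a: "continuous_on ({0..1} \<times> {0<..}) (\<lambda>p. a (fst p) (snd p))"
    and avoid: "\<And>x t. x \<in> {0..1} \<Longrightarrow> 0 < t \<Longrightarrow> rcis (r x t) (a x t) \<notin> S" "0 \<notin> S"
  shows "homotopic_with (\<lambda>h. h 0 = Some 0 \<and> h 1 = None) (top_of_set {0..1})
       (subtopology (Alexandroff_compactification euclidean) (- Some ` S))
       (sphere_path (\<lambda>t. rcis (r 0 t) (a 0 t))) (sphere_path (\<lambda>t. rcis (r 1 t) (a 1 t)))"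
proof -
  define f where "f p = rcis (r (fst p) (snd p)) (a (fst p) (snd p))" for p :: "real \<times> real"
  let ?D = "{0..1} \<times> {0..} :: (real \<times> real) set"
  have f0: "f (x, 0) = 0" for x by (simp add: f_def r0)
  have f_pos: "continuous_on ({0..1} \<times> {0<..}) f"
    unfolding f_def rcis_def by (intro continuous_intros continuous_on_subset[OF r] a) auto
  have f_cont: "continuous_on ?D f"
    unfolding continuous_on_def
  proof
    fix p :: "real \<times> real" assume p: "p \<in> ?D"
    show "(f \<longlongrightarrow> f p) (at p within ?D)"
    proof (cases "snd p = 0")
      case True
      have "((\<lambda>p. r (fst p) (snd p)) \<longlongrightarrow> r (fst p) (snd p)) (at p within ?D)"
        using r p unfolding continuous_on_def by blast
      then have "((\<lambda>p. \<bar>r (fst p) (snd p)\<bar>) \<longlongrightarrow> 0) (at p within ?D)"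
        using True r0 by (simp add: tendsto_rabs_zero)
      then have "(f \<longlongrightarrow> 0) (at p within ?D)"
        by (rule tendsto_0_le[where K = 1]) (simp add: f_def)
      moreover have "f p = 0" using f0[of "fst p"] True by (metis prod.collapse)
      ultimately show ?thesis by simp
    next
      case False
      then have pp: "p \<in> {0..1} \<times> {0<..}" using p by (auto simp: mem_Times_iff)
      then have "(f \<longlongrightarrow> f p) (at p within {0..1} \<times> {0<..})"
        using f_pos unfolding continuous_on_def by blast
      moreover have "at p within ?D = at p within {0..1} \<times> {0<..}"
        by (rule at_within_nhd[where S = "UNIV \<times> {0<..}"]) (use pp in \<open>auto simp: mem_Times_iff open_Times\<close>)
      ultimately show ?thesis by simp
    qed
  qed
  let ?Q = "{0..1} \<times> {0..<1} :: (real \<times> real) set" and ?P = "{0..1} \<times> {0..1} :: (real \<times> real) set"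
  define G where "G p = f (fst p, snd p / (1 - snd p))" for p :: "real \<times> real"
  have G_cont: "continuous_on ?Q G"
    unfolding G_def
    by (rule continuous_on_compose2[OF f_cont]) (auto intro!: continuous_intros simp: mem_Times_iff)
  define h where "h p = sphere_path (\<lambda>t. f (fst p, t)) (snd p)" for p :: "real \<times> real"
  have h: "h p = (if snd p < 1 then Some (G p) else None)" for p
    by (simp add: h_def sphere_path_def G_def)
  have "continuous_map (top_of_set ?P) (Alexandroff_compactification euclidean) h"
    unfolding continuous_map_def
  proof (intro conjI allI impI)
    show "h \<in> topspace (top_of_set ?P) \<rightarrow> topspace (Alexandroff_compactification euclidean)"
      by (auto simp: topspace_Alexandroff_compactification) (metis option.exhaust rangeI)
    fix U :: "complex option set" assume "openin (Alexandroff_compactification euclidean) U"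
    then consider V where "open V" "U = Some ` V" | C where "compact C" "U = insert None (Some ` (UNIV - C))"
      by (auto simp: openin_Alexandroff_compactification compactin_euclidean_iff)
    then show "openin (top_of_set ?P) {p \<in> topspace (top_of_set ?P). h p \<in> U}"
    proof cases
      case 1
      have "{p \<in> topspace (top_of_set ?P). h p \<in> U} = ?Q \<inter> G -` V"
        by (auto simp: h 1 mem_Times_iff split: if_splits)
      moreover have "openin (top_of_set ?Q) (?Q \<inter> G -` V)"
        by (rule continuous_openin_preimage_gen[OF G_cont 1(1)])
      moreover have "openin (top_of_set ?P) ?Q"
      proof -
        have "?Q = ?P \<inter> (UNIV \<times> {..<1})" by auto
        then show ?thesis by (simp only:) (intro openin_open_Int open_Times open_UNIV open_lessThan)
      qed
      ultimately show ?thesis using openin_trans by (simp only:) blast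
    next
      case 2
      \<comment> \<open>A neighbourhood of infinity omits a compact set C. Beyond time t0, which is
        the parameter s0 under t = s/(1 - s), the homotopy has left C, so the preimage of C is
        closed inside the part up to s0.\<close>
      obtain B where B: "\<And>z. z \<in> C \<Longrightarrow> norm z \<le> B"
        using compact_imp_bounded[OF 2(1)] unfolding bounded_iff by blast
      obtain t0 where t0: "0 \<le> t0" "\<forall>x\<in>{0..1}. \<forall>t\<ge>t0. B + 1 \<le> r x t" using r_lim by blast
      define s0 where "s0 = t0 / (1 + t0)"
      have s0: "0 \<le> s0" "s0 < 1" using t0(1) by (auto simp: s0_def)
      let ?R = "{0..1} \<times> {0..s0} :: (real \<times> real) set"
      have small: "snd p \<le> s0" if "p \<in> ?Q" "G p \<in> C" for p
      proof (rule ccontr)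
        assume gt: "\<not> snd p \<le> s0"
        have s: "fst p \<in> {0..1}" "0 \<le> snd p" "snd p < 1" using that(1) by (auto simp: mem_Times_iff)
        have "t0 < snd p * (1 + t0)" using gt t0(1) by (simp add: s0_def not_le pos_divide_less_eq)
        then have "t0 \<le> snd p / (1 - snd p)" using s by (simp add: le_divide_eq algebra_simps)
        then have "B + 1 \<le> r (fst p) (snd p / (1 - snd p))" using t0(2) s(1) by blast
        also have "\<dots> \<le> norm (G p)" by (simp add: G_def f_def)
        finally show False using B[OF that(2)] by simp
      qed
      have "closed (?R \<inter> G -` C)"
        by (rule continuous_closed_preimage[OF continuous_on_subset[OF G_cont]])
          (use s0 2(1) in \<open>auto intro: closed_Times compact_imp_closed\<close>)
      moreover have "{p \<in> topspace (top_of_set ?P). h p \<in> U} = ?P \<inter> - (?R \<inter> G -` C)"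
      proof (rule set_eqI)
        fix p
        show "p \<in> {p \<in> topspace (top_of_set ?P). h p \<in> U} \<longleftrightarrow> p \<in> ?P \<inter> - (?R \<inter> G -` C)"
        proof (cases "p \<in> ?Q")
          case True
          then have "p \<in> ?P" "snd p < 1" by (auto simp: mem_Times_iff)
          moreover have "G p \<in> C \<longleftrightarrow> p \<in> ?R \<inter> G -` C" using small[OF True] True by (auto simp: mem_Times_iff)
          ultimately show ?thesis by (auto simp: h 2(2))
        next
          case False
          then show ?thesis using s0 by (auto simp: h 2(2) mem_Times_iff)
        qed
      qed
      ultimately show ?thesis by (simp only:) (intro openin_open_Int open_Compl)
    qed
  qed
  moreover have "h p \<notin> Some ` S" if "p \<in> ?P" for p
  proof (cases "0 < snd p \<and> snd p < 1")
    case True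
    then have "0 < snd p / (1 - snd p)" by simp
    then have "G p \<notin> S" using that avoid(1)[of "fst p" "snd p / (1 - snd p)"] by (auto simp: G_def f_def mem_Times_iff)
    then show ?thesis by (auto simp: h)
  next
    case False
    then have "snd p = 0 \<or> snd p = 1" using that by (auto simp: mem_Times_iff)
    then show ?thesis using avoid(2) by (auto simp: h G_def f0)
  qed
  ultimately have "continuous_map (top_of_set ?P) (subtopology (Alexandroff_compactification euclidean) (- Some ` S)) h"
    by (auto simp: continuous_map_in_subtopology)
  then have cm: "continuous_map (prod_topology (top_of_set {0..1}) (top_of_set {0..1}))
      (subtopology (Alexandroff_compactification euclidean) (- Some ` S)) h"
    by (simp add: prod_topology_subtopology_eu)
  show ?thesis
    unfolding homotopic_with_def
    by (intro exI[of _ h] conjI cm) (auto simp: h_def f_def sphere_path_def r0)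
qed

lemma sphere_path_cong: "(\<And>t. 0 \<le> t \<Longrightarrow> f t = g t) \<Longrightarrow> s \<in> {0..1} \<Longrightarrow> sphere_path f s = sphere_path g s"
  by (simp add: sphere_path_def)

context borel_lift_data
begin

lemma sing_not_exp_log_domain: "\<zeta> \<in> log_domain lam \<alpha> M \<Longrightarrow> exp \<zeta> \<notin> sing lam j"
  using exp_log_domain_nonsingular[OF inj \<alpha> _ M_bound] by (auto simp: sing_def)

lemma zero_not_sing: "0 \<notin> sing lam j"
  using inj by (auto simp: sing_def inj_eq)

text \<open>
  First the angle is moved to \<open>\<alpha>\<close> at constant modulus, which is possible since \<open>log_domain\<close> is a
  union of a half-plane \<open>Re > M\<close> and a horizontal strip; then the modulus is adjusted on the ray.
\<close>

lemma lifted_path_homotopic_to_ray: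
  assumes \<zeta>: "continuous_on {0<..} \<zeta>" "\<And>t. 0 < t \<Longrightarrow> \<zeta> t \<in> log_domain lam \<alpha> M"
    and exp_\<zeta>: "\<And>t. 0 < t \<Longrightarrow> exp (\<zeta> t) = \<gamma> t" and \<gamma>: "\<gamma> 0 = 0" "continuous_on {0..} \<gamma>"
    and lim: "filterlim \<gamma> at_infinity at_top"
  shows "homotopic_to_ray (sing lam j) \<alpha> \<gamma>"
proof -
  let ?H = "homotopic_with (\<lambda>h. h 0 = Some 0 \<and> h 1 = None) (top_of_set {0..1})
       (subtopology (Alexandroff_compactification euclidean) (- Some ` sing lam j))"
  have polar: "rcis (norm (\<gamma> t)) y = exp (Complex (Re (\<zeta> t)) y)" if "0 < t" for t y
    using exp_\<zeta>[OF that] exp_eq_rcis[of "Complex (Re (\<zeta> t)) y"] norm_exp_eq_Re[of "\<zeta> t"] by simp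
  have big: "\<exists>t0\<ge>0. \<forall>t\<ge>t0. B \<le> norm (\<gamma> t)" for B
  proof -
    have "\<forall>\<^sub>F t in at_top. B \<le> norm (\<gamma> t)"
      using filterlim_at_infinity_imp_norm_at_top[OF lim] by (simp add: filterlim_at_top)
    then obtain N where N: "\<forall>t\<ge>N. B \<le> norm (\<gamma> t)" by (auto simp: eventually_at_top_linorder)
    then show ?thesis by (intro exI[of _ "max 0 N"]) simp
  qed
  have norm_cont: "continuous_on ({0..1::real} \<times> {0..}) (\<lambda>p. norm (\<gamma> (snd p)))"
  proof (rule continuous_on_norm)
    show "continuous_on ({0..1::real} \<times> {0..}) (\<lambda>p. \<gamma> (snd p))"
      by (rule continuous_on_compose2[OF \<gamma>(2)]) (auto intro: continuous_on_snd continuous_on_id)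
  qed
  have "?H (sphere_path (\<lambda>t. rcis (norm (\<gamma> t)) ((1 - 0) * Im (\<zeta> t) + 0 * \<alpha>)))
      (sphere_path (\<lambda>t. rcis (norm (\<gamma> t)) ((1 - 1) * Im (\<zeta> t) + 1 * \<alpha>)))"
  proof (rule homotopic_sphere_paths[where r = "\<lambda>x t. norm (\<gamma> t)" and a = "\<lambda>x t. (1 - x) * Im (\<zeta> t) + x * \<alpha>"])
    show "continuous_on ({0..1::real} \<times> {0..}) (\<lambda>p. norm (\<gamma> (snd p)))" by (rule norm_cont)
    show "norm (\<gamma> 0) = 0" by (simp add: \<gamma>)
    show "\<exists>t0\<ge>0. \<forall>x\<in>{0..1::real}. \<forall>t\<ge>t0. B \<le> norm (\<gamma> t)" for B using big[of B] by blast
    have "continuous_on ({0..1::real} \<times> {0<..}) (\<lambda>p. \<zeta> (snd p))"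
      by (rule continuous_on_compose2[OF \<zeta>(1)]) (auto intro: continuous_on_snd continuous_on_id)
    then show "continuous_on ({0..1} \<times> {0<..}) (\<lambda>p. (1 - fst p) * Im (\<zeta> (snd p)) + fst p * \<alpha>)"
      by (intro continuous_intros)
    fix x t :: real assume x: "x \<in> {0..1}" and t: "0 < t"
    let ?y = "(1 - x) * Im (\<zeta> t) + x * \<alpha>"
    have "Complex (Re (\<zeta> t)) ?y \<in> log_domain lam \<alpha> M"
    proof (cases "M < Re (\<zeta> t)")
      case False
      then have "Im (\<zeta> t) \<in> dir_class lam \<alpha>" using \<zeta>(2)[OF t] by (simp add: log_domain_def)
      then have "(1 - x) *\<^sub>R Im (\<zeta> t) + x *\<^sub>R \<alpha> \<in> dir_class lam \<alpha>"
        by (intro convexD[OF convex_dir_class[OF inj \<alpha>]] base_in_dir_class[OF inj \<alpha>]) (use x in auto)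
      then show ?thesis by (simp add: log_domain_def)
    qed (simp add: log_domain_def)
    from sing_not_exp_log_domain[OF this] show "rcis (norm (\<gamma> t)) ?y \<notin> sing lam j" unfolding polar[OF t] .
  qed (rule zero_not_sing)
  then have 1: "?H (sphere_path (\<lambda>t. rcis (norm (\<gamma> t)) (Im (\<zeta> t)))) (sphere_path (\<lambda>t. rcis (norm (\<gamma> t)) \<alpha>))"
    by simp
  have "?H (sphere_path (\<lambda>t. rcis ((1 - 0) * norm (\<gamma> t) + 0 * t) \<alpha>))
      (sphere_path (\<lambda>t. rcis ((1 - 1) * norm (\<gamma> t) + 1 * t) \<alpha>))"
  proof (rule homotopic_sphere_paths[where r = "\<lambda>x t. (1 - x) * norm (\<gamma> t) + x * t" and a = "\<lambda>x t. \<alpha>"])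
    show "continuous_on ({0..1} \<times> {0..}) (\<lambda>p. (1 - fst p) * norm (\<gamma> (snd p)) + fst p * snd p)"
      by (intro continuous_intros norm_cont)
    show "(1 - x) * norm (\<gamma> 0) + x * 0 = 0" for x by (simp add: \<gamma>)
    show "\<exists>t0\<ge>0. \<forall>x\<in>{0..1}. \<forall>t\<ge>t0. B \<le> (1 - x) * norm (\<gamma> t) + x * t" for B
    proof -
      obtain t0 where t0: "t0 \<ge> 0" "\<forall>t\<ge>t0. B \<le> norm (\<gamma> t)" using big by blast
      show ?thesis
      proof (intro exI[of _ "max t0 B"] conjI ballI allI impI)
        show "0 \<le> max t0 B" using t0 by simp
        fix x t :: real assume x: "x \<in> {0..1}" and t: "max t0 B \<le> t"
        have "(1 - x) * B + x * B \<le> (1 - x) * norm (\<gamma> t) + x * t"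
          using x t t0(2) by (intro add_mono mult_left_mono) auto
        then show "B \<le> (1 - x) * norm (\<gamma> t) + x * t" by (simp add: algebra_simps)
      qed
    qed
    show "continuous_on ({0..1::real} \<times> {0<..}) (\<lambda>p. \<alpha>)" by (rule continuous_on_const)
    fix x t :: real assume x: "x \<in> {0..1}" and t: "0 < t"
    have "0 < norm (\<gamma> t)" using exp_\<zeta>[OF t] by (metis exp_not_eq_zero zero_less_norm_iff)
    then have pos: "0 < (1 - x) * norm (\<gamma> t) + x * t"
      using x t by (cases "x = 0") (auto intro!: add_nonneg_pos mult_nonneg_nonneg)
    show "rcis ((1 - x) * norm (\<gamma> t) + x * t) \<alpha> \<notin> sing lam j"
    proof
      assume "rcis ((1 - x) * norm (\<gamma> t) + x * t) \<alpha> \<in> sing lam j"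
      then obtain i where "i \<noteq> j" "lam i - lam j = rcis ((1 - x) * norm (\<gamma> t) + x * t) \<alpha>"
        unfolding sing_def by auto
      then show False using \<alpha> pos unfolding nonsingular_dirs_def by auto
    qed
  qed (rule zero_not_sing)
  then have 2: "?H (sphere_path (\<lambda>t. rcis (norm (\<gamma> t)) \<alpha>)) (sphere_path (\<lambda>t. rcis t \<alpha>))" by simp
  show ?thesis
    unfolding homotopic_to_ray_def
  proof (rule homotopic_with_eq[OF homotopic_with_trans[OF 1 2]])
    fix s :: real assume "s \<in> topspace (top_of_set {0..1})"
    then have s: "s \<in> {0..1}" by simp
    show "sphere_path \<gamma> s = sphere_path (\<lambda>t. rcis (norm (\<gamma> t)) (Im (\<zeta> t))) s"
    proof (rule sphere_path_cong[OF _ s])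
      fix t :: real assume "0 \<le> t"
      show "\<gamma> t = rcis (norm (\<gamma> t)) (Im (\<zeta> t))"
      proof (cases "t = 0")
        case False
        then have t: "0 < t" using \<open>0 \<le> t\<close> by simp
        show ?thesis unfolding polar[OF t] by (simp add: exp_\<zeta>[OF t])
      qed (simp add: \<gamma>)
    qed
  qed auto
qed

end

subsection \<open>The parameter sectors\<close>

lemma spec_bounded:
  fixes N :: "complex^'n::finite^'n"
  shows "\<exists>B. \<forall>\<mu>\<in>spec N. norm \<mu> \<le> B"
proof -
  have "bounded_linear (\<lambda>v. N *v v)"
    by (intro linear_conv_bounded_linear[THEN iffD1] linearI)
      (simp_all add: vec_eq_iff matrix_vector_mult_def algebra_simps sum.distrib scaleR_sum_right)
  then obtain B where B: "\<And>v. norm (N *v v) \<le> norm v * B"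
    using bounded_linear.bounded by blast
  have "norm \<mu> \<le> B" if \<mu>: "\<mu> \<in> spec N" for \<mu>
  proof -
    obtain v where v: "v \<noteq> 0" "N *v v = \<mu> *s v" using \<mu> unfolding spec_def mem_Collect_eq by (elim exE conjE)
    have "norm (\<mu> *s v) = norm \<mu> * norm v"
      by (simp add: norm_vec_def norm_mult L2_set_right_distrib)
    then have "norm \<mu> * norm v \<le> B * norm v" using B[of v] v(2) by (simp add: mult.commute)
    then show ?thesis using v(1) by simp
  qed
  then show ?thesis by blast
qed

text \<open>Off the real axis the imaginary part of \<rho> outgrows every element of X, and integers
  do not change it. On the real axis \<open>sg\<close> is the side on which \<rho> runs to infinity,
  while the integer shifts go the other way, so the distance only grows with m.\<close>

lemma eventually_avoids_integer_translates:
  fixes X :: "complex set" and sg :: real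
  assumes X: "\<forall>\<mu>\<in>X. norm \<mu> \<le> B" and sg: "sin \<phi> = 0 \<Longrightarrow> cos \<phi> = sg" "sg = 1 \<or> sg = -1"
  shows "\<forall>\<^sub>F R in at_top. \<forall>m::nat. m > 0 \<longrightarrow> (\<forall>\<mu>\<in>X. rcis R \<phi> \<noteq> - of_real sg * of_nat m - \<mu>)"
proof (cases "sin \<phi> = 0")
  case True
  show ?thesis
    using eventually_gt_at_top[of B]
  proof eventually_elim
    case (elim R)
    show ?case
    proof (intro allI impI ballI notI)
      fix m :: nat and \<mu> assume "0 < m" "\<mu> \<in> X" and eq: "rcis R \<phi> = - of_real sg * of_nat m - \<mu>"
      have "Re (rcis R \<phi>) = - sg * real m - Re \<mu>" unfolding eq by simp
      then have "- Re \<mu> = sg * (R + real m)" using sg(1)[OF True] by (simp add: algebra_simps)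
      then have "\<bar>Re \<mu>\<bar> = \<bar>R + real m\<bar>" using sg(2) by auto
      then show False using abs_Re_le_cmod[of \<mu>] X \<open>\<mu> \<in> X\<close> elim by force
    qed
  qed
next
  case False
  show ?thesis
    using eventually_gt_at_top[of "B / \<bar>sin \<phi>\<bar>"] eventually_gt_at_top[of 0]
  proof eventually_elim
    case (elim R)
    show ?case
    proof (intro allI impI ballI notI)
      fix m :: nat and \<mu> assume "0 < m" "\<mu> \<in> X" and eq: "rcis R \<phi> = - of_real sg * of_nat m - \<mu>"
      have "Im (rcis R \<phi>) = - Im \<mu>" unfolding eq by simp
      then have "Im \<mu> = - (R * sin \<phi>)" by simp
      then have "\<bar>Im \<mu>\<bar> = R * \<bar>sin \<phi>\<bar>" using elim by (simp add: abs_mult)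
      moreover have "B < R * \<bar>sin \<phi>\<bar>" using elim(1) False by (simp add: divide_less_eq)
      moreover have "norm \<mu> \<le> B" using X \<open>\<mu> \<in> X\<close> by blast
      ultimately show False using abs_Im_le_cmod[of \<mu>] by linarith
    qed
  qed
qed

lemma Arg2pi_rcis:
  assumes "0 < R" "0 \<le> \<phi>" "\<phi> < 2 * pi"
  shows "Arg2pi (rcis R \<phi>) = \<phi>"
  using assms by (intro Arg2pi_unique[of R]) (auto simp: rcis_def cis_conv_exp)

lemma eventually_P_plus:
  assumes "0 < \<eta>" "\<phi> \<in> {- pi + \<eta> <..< pi - \<eta>}"
  shows "\<forall>\<^sub>F R in at_top. rcis R \<phi> \<in> P_plus blk A \<eta>"
proof -
  obtain B1 B2 where "\<forall>\<mu>\<in>spec A. norm \<mu> \<le> B1" "\<forall>\<mu>\<in>spec (block_diag blk A). norm \<mu> \<le> B2"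
    using spec_bounded by blast
  then have B: "\<forall>\<mu>\<in>spec A \<union> spec (block_diag blk A). norm \<mu> \<le> max B1 B2" by (auto simp: le_max_iff_disj)
  have "cos \<phi> = 1" if "sin \<phi> = 0"
  proof -
    have "\<not> 0 < \<phi>" using sin_gt_zero[of \<phi>] assms that by auto
    moreover have "\<not> \<phi> < 0" using sin_gt_zero[of "- \<phi>"] assms that by auto
    ultimately show ?thesis by simp
  qed
  then have "\<forall>\<^sub>F R in at_top. \<forall>m::nat. m > 0 \<longrightarrow>
      (\<forall>\<mu>\<in>spec A \<union> spec (block_diag blk A). rcis R \<phi> \<noteq> - of_real 1 * of_nat m - \<mu>)"
    by (intro eventually_avoids_integer_translates[OF B]) auto
  then show ?thesis
    using eventually_gt_at_top[of 0]
  proof eventually_elim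
    case (elim R)
    have "Arg (rcis R \<phi>) = \<phi>" using elim(2) assms by (intro Arg_rcis) auto
    then show ?case using elim assms by (simp add: P_plus_def)
  qed
qed

lemma eventually_P_minus:
  assumes "0 < \<eta>" "\<phi> \<in> {\<eta> <..< 2 * pi - \<eta>}"
  shows "\<forall>\<^sub>F R in at_top. rcis R \<phi> \<in> P_minus blk A \<eta>"
proof -
  obtain B1 B2 where "\<forall>\<mu>\<in>spec A. norm \<mu> \<le> B1" "\<forall>\<mu>\<in>spec (block_diag blk A). norm \<mu> \<le> B2"
    using spec_bounded by blast
  then have B: "\<forall>\<mu>\<in>spec A \<union> spec (block_diag blk A). norm \<mu> \<le> max B1 B2" by (auto simp: le_max_iff_disj)
  have "cos \<phi> = -1" if "sin \<phi> = 0"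
  proof -
    have "\<not> \<phi> < pi" using sin_gt_zero[of \<phi>] assms that by auto
    moreover have "\<not> pi < \<phi>" using sin_lt_zero[of \<phi>] assms that by auto
    ultimately show ?thesis by simp
  qed
  then have "\<forall>\<^sub>F R in at_top. \<forall>m::nat. m > 0 \<longrightarrow>
      (\<forall>\<mu>\<in>spec A \<union> spec (block_diag blk A). rcis R \<phi> \<noteq> - of_real (-1) * of_nat m - \<mu>)"
    by (intro eventually_avoids_integer_translates[OF B]) auto
  then show ?thesis
    using eventually_gt_at_top[of 0]
  proof eventually_elim
    case (elim R)
    have "Arg2pi (rcis R \<phi>) = \<phi>" using elim(2) assms by (intro Arg2pi_rcis) auto
    then show ?case using elim assms by (simp add: P_minus_def)
  qed
qed

subsection \<open>Convergence of the fundamental solutions\<close>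

lemma block_col_mult_mat_pow_diag_block:
  fixes u :: "complex^'n::finite^'n"
  assumes "block_col blk j u = u"
  shows "block_col blk j (u ** mat_pow l (diag_block blk j A)) = u ** mat_pow l (diag_block blk j A)"
proof -
  let ?M = "mat_scale l (diag_block blk j A)"
  have M: "block_col blk j (v ** ?M) = v ** ?M" for v
  proof -
    have "(v ** ?M) $ r $ s = 0" if "blk s \<noteq> j" for r s
      unfolding matrix_mult_nth by (intro sum.neutral) (use that in auto)
    then show ?thesis by (simp add: vec_eq_iff)
  qed
  have pow: "block_col blk j (v ** mat_power ?M k) = v ** mat_power ?M k" if "block_col blk j v = v" for v k
    using that
  proof (induction k arbitrary: v)
    case (Suc k)
    have "v ** mat_power ?M (Suc k) = (v ** ?M) ** mat_power ?M k" by (simp add: matrix_mul_assoc)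
    then show ?case using Suc.IH[OF M[of v]] by simp
  qed simp
  have s: "(\<lambda>k. u ** ((1 / fact k) *\<^sub>R mat_power ?M k)) sums (u ** mat_exp ?M)"
    by (intro bounded_linear.sums[OF bounded_bilinear.bounded_linear_right[OF bounded_bilinear_matrix_mult]] mat_exp_sums)
  have "block_col blk j (u ** ((1 / fact k) *\<^sub>R mat_power ?M k)) = u ** ((1 / fact k) *\<^sub>R mat_power ?M k)" for k
    using pow[OF assms, of k]
    by (simp only: bounded_bilinear.scaleR_right[OF bounded_bilinear_matrix_mult]
        linear_scale[OF bounded_linear.linear[OF bounded_linear_block_col]])
  then have "(\<lambda>k. u ** ((1 / fact k) *\<^sub>R mat_power ?M k)) sums block_col blk j (u ** mat_exp ?M)"
    using bounded_linear.sums[OF bounded_linear_block_col s, of blk j] by (simp only:)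
  from sums_unique2[OF this s] show ?thesis by (simp add: mat_pow_def)
qed

lemma block_col_mult_diag_block:
  assumes "block_col blk j u = u"
  shows "u ** diag_block blk k X = (if k = j then block_col blk j (u ** X) else 0)"
proof -
  have u: "u $ r $ q = 0" if "blk q \<noteq> j" for r q
    by (subst assms[symmetric]) (simp add: that)
  have "(u ** diag_block blk k X) $ r $ s = (if k = j then block_col blk j (u ** X) else 0) $ r $ s" for r s
    by (auto simp: matrix_mult_nth u intro!: sum.cong sum.neutral)
  then show ?thesis by (simp add: vec_eq_iff)
qed

text \<open>Mixed terms vanish since \<open>u j\<close> is supported in block column j. The scalar
  exp(\<rho> Ln(1 - \<lambda>_j/(\<rho>z))) is split off because its exponent has a limit while
  \<rho> itself does not.\<close>

lemma mult_Phi: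
  fixes u :: "'p::finite \<Rightarrow> complex^'n::finite^'n"
  assumes u: "\<And>j. block_col blk j (u j) = u j"
  shows "(\<Sum>j\<in>UNIV. u j) ** Phi blk lam A lg z \<rho> =
    (\<Sum>j\<in>UNIV. block_col blk j (mat_scale (exp (Ln (1 - lam j / (\<rho> * z)) * \<rho>))
      ((u j ** mat_pow (lg z) (diag_block blk j A)) ** mat_pow (Ln (1 - lam j / (\<rho> * z))) (diag_block blk j A))))"
proof -
  define X where "X k = mat_pow (lg z) (diag_block blk k A) **
         mat_pow (Ln (1 - lam k / (\<rho> * z))) (diag_block blk k (A + mat \<rho>))" for k
  have "(\<Sum>j\<in>UNIV. u j) ** Phi blk lam A lg z \<rho> = (\<Sum>k\<in>UNIV. \<Sum>j\<in>UNIV. u j ** diag_block blk k (X k))"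
    unfolding Phi_def X_def[symmetric]
    by (simp add: bounded_bilinear.sum_left[OF bounded_bilinear_matrix_mult]
        bounded_bilinear.sum_right[OF bounded_bilinear_matrix_mult])
  also have "\<dots> = (\<Sum>j\<in>UNIV. \<Sum>k\<in>UNIV. u j ** diag_block blk k (X k))" by (rule sum.swap)
  also have "\<dots> = (\<Sum>j\<in>UNIV. \<Sum>k\<in>UNIV. if k = j then block_col blk j (u j ** X k) else 0)"
    by (simp only: block_col_mult_diag_block[OF u])
  also have "\<dots> = (\<Sum>j\<in>UNIV. block_col blk j (u j ** X j))" by simp
  also have "\<dots> = (\<Sum>j\<in>UNIV. block_col blk j (mat_scale (exp (Ln (1 - lam j / (\<rho> * z)) * \<rho>))
      ((u j ** mat_pow (lg z) (diag_block blk j A)) ** mat_pow (Ln (1 - lam j / (\<rho> * z))) (diag_block blk j A))))"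
    unfolding X_def matrix_mul_assoc
    by (simp only: block_col_mult_mat_pow[OF block_col_mult_mat_pow_diag_block[OF u]])
  finally show ?thesis .
qed

text \<open>In the variable x = 1/\<rho> the second limit is the derivative of Ln(1 - cx/z) at
  0.\<close>

lemma Ln_one_minus_times_tendsto:
  assumes "z \<noteq> 0"
  shows "((\<lambda>R. Ln (1 - c / (rcis R \<phi> * z))) \<longlongrightarrow> 0) at_top"
    and "((\<lambda>R. Ln (1 - c / (rcis R \<phi> * z)) * rcis R \<phi>) \<longlongrightarrow> - c / z) at_top"
proof -
  define e where "e R = 1 / rcis R \<phi>" for R
  have "((\<lambda>R. of_real (1 / R) * cis (- \<phi>)) \<longlongrightarrow> of_real 0 * cis (- \<phi>)) at_top"
    by (intro tendsto_mult tendsto_of_real tendsto_const real_tendsto_divide_at_top[OF tendsto_const] filterlim_ident)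
  moreover have "e R = of_real (1 / R) * cis (- \<phi>)" for R
    by (simp add: e_def rcis_def divide_inverse flip: cis_inverse)
  ultimately have "(e \<longlongrightarrow> 0) at_top" by (simp add: e_def[abs_def])
  moreover have "\<forall>\<^sub>F R in at_top. e R \<noteq> 0"
    using eventually_gt_at_top[of 0] by eventually_elim (simp add: e_def)
  ultimately have e: "filterlim e (at 0) at_top" by (simp add: filterlim_at)
  have ce: "c / (rcis R \<phi> * z) = c / z * e R" for R by (simp add: e_def)
  have "((\<lambda>x. Ln (1 - c / z * x)) has_field_derivative - c / z) (at 0)"
    using assms by (auto intro!: derivative_eq_intros)
  then have d: "((\<lambda>x. Ln (1 - c / z * x) / x) \<longlongrightarrow> - c / z) (at 0)"
    by (simp add: has_field_derivative_iff)
  have "isCont (\<lambda>x. Ln (1 - c / z * x)) 0"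
    using \<open>(_ has_field_derivative _) _\<close> by (rule DERIV_isCont)
  then have "((\<lambda>x. Ln (1 - c / z * x)) \<longlongrightarrow> 0) (at 0)" by (simp add: isCont_def)
  from filterlim_compose[OF this e] show "((\<lambda>R. Ln (1 - c / (rcis R \<phi> * z))) \<longlongrightarrow> 0) at_top"
    unfolding ce .
  from filterlim_compose[OF d e] show "((\<lambda>R. Ln (1 - c / (rcis R \<phi> * z)) * rcis R \<phi>) \<longlongrightarrow> - c / z) at_top"
    unfolding ce by (simp add: e_def)
qed

text \<open>The classical limit of (1 - \<lambda>/(\<rho>z))^\<rho> to exp(-\<lambda>/z), carried
  through the block structure; it turns \<open>Phi\<close> into the exponential and power factors of
  \<open>Psi\<close>.\<close>

lemma mult_Phi_tendsto:
  fixes u :: "'p::finite \<Rightarrow> real \<Rightarrow> complex^'n::finite^'n"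
  assumes z: "z \<noteq> 0" and lim: "\<And>j. (u j \<longlongrightarrow> L j) at_top"
    and col: "\<And>j. \<forall>\<^sub>F R in at_top. block_col blk j (u j R) = u j R"
  shows "((\<lambda>R. (\<Sum>j\<in>UNIV. u j R) ** Phi blk lam A lg z (rcis R \<phi>)) \<longlongrightarrow>
    (\<Sum>j\<in>UNIV. mat_scale (exp (- lam j / z)) (L j ** mat_pow (lg z) (diag_block blk j A)))) at_top"
proof -
  have L: "block_col blk j (L j) = L j" for j
  proof (rule tendsto_unique[OF trivial_limit_at_top_linorder _ lim])
    show "(u j \<longlongrightarrow> block_col blk j (L j)) at_top"
      by (rule Lim_transform_eventually[OF bounded_linear.tendsto[OF bounded_linear_block_col lim] col])
  qed
  have all: "\<forall>\<^sub>F R in at_top. \<forall>j. block_col blk j (u j R) = u j R"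
    by (rule eventually_all_finite[OF col])
  define W where "W j R = block_col blk j (mat_scale (exp (Ln (1 - lam j / (rcis R \<phi> * z)) * rcis R \<phi>))
      ((u j R ** mat_pow (lg z) (diag_block blk j A)) ** mat_pow (Ln (1 - lam j / (rcis R \<phi> * z))) (diag_block blk j A)))" for j R
  have W: "(W j \<longlongrightarrow> mat_scale (exp (- lam j / z)) (L j ** mat_pow (lg z) (diag_block blk j A))) at_top" for j
  proof -
    note ln = Ln_one_minus_times_tendsto[OF z, of "lam j" \<phi>]
    have "isCont (\<lambda>l. mat_pow l (diag_block blk j A)) 0"
      using continuous_on_mat_pow[of "diag_block blk j A"] by (simp add: continuous_on_eq_continuous_at)
    note mp = isCont_tendsto_compose[OF this ln(1)]
    note m1 = bounded_bilinear.tendsto[OF bounded_bilinear_matrix_mult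
        bounded_bilinear.tendsto[OF bounded_bilinear_matrix_mult lim[of j] tendsto_const[of "mat_pow (lg z) (diag_block blk j A)"]] mp]
    note m2 = bounded_linear.tendsto[OF bounded_linear_block_col
        bounded_bilinear.tendsto[OF bounded_bilinear_mat_scale tendsto_exp[OF ln(2)] m1], of blk j]
    have "(W j \<longlongrightarrow> block_col blk j (mat_scale (exp (- lam j / z)) (L j ** mat_pow (lg z) (diag_block blk j A) ** mat_pow 0 (diag_block blk j A)))) at_top"
      unfolding W_def[abs_def] by (rule m2)
    moreover have "block_col blk j (mat_scale c X) = mat_scale c (block_col blk j X)" for c and X :: "complex^'n^'n"
      by (simp add: vec_eq_iff)
    ultimately show ?thesis by (simp add: block_col_mult_mat_pow_diag_block[OF L])
  qed
  have "((\<lambda>R. \<Sum>j\<in>UNIV. W j R) \<longlongrightarrow> (\<Sum>j\<in>UNIV. mat_scale (exp (- lam j / z)) (L j ** mat_pow (lg z) (diag_block blk j A)))) at_top"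
    by (intro tendsto_sum W)
  moreover have "\<forall>\<^sub>F R in at_top. (\<Sum>j\<in>UNIV. W j R) = (\<Sum>j\<in>UNIV. u j R) ** Phi blk lam A lg z (rcis R \<phi>)"
    using all by eventually_elim (simp add: W_def mult_Phi)
  ultimately show ?thesis by (rule Lim_transform_eventually)
qed

section \<open>The values of T^+ and T^- for large |\<rho>|\<close>

context borel_lift_data
begin

lemma norm_gt_not_sing: "exp M < norm w \<Longrightarrow> w \<notin> sing lam j"
  using M_bound by (auto simp: sing_def not_le[symmetric])

lemma block_col_path_value: "block_col blk j (path_value h \<theta> \<phi> \<omega> R) = path_value h \<theta> \<phi> \<omega> R"
proof -
  have "(I ** D) $ r $ s = 0" if "blk s \<noteq> j" for I :: "complex^'n^'n" and r s
    unfolding matrix_mult_nth by (intro sum.neutral) (use that in auto)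
  then show ?thesis by (simp add: path_value_def Let_def vec_eq_iff)
qed

text \<open>
  The sign \<open>1 - 2h\<close> is absorbed into \<open>\<rho>\<close>: \<open>(1 - 2h) \<rho> = R cis \<phi>'\<close>, and \<open>\<omega> R\<close> is the branch of
  \<open>log ((1 - 2h) (\<rho> z - \<lambda>\<^sub>j))\<close> with imaginary part close to \<open>\<alpha>' - \<theta>\<close>.
\<close>

definition log_endpoint :: "real \<Rightarrow> real \<Rightarrow> complex \<Rightarrow> real \<Rightarrow> real \<Rightarrow> complex" where
  "log_endpoint h \<phi>' z \<beta> R = Ln ((of_real R * cis \<phi>' * z - of_real (1 - 2 * h) * lam j) * cis (- \<beta>)) + \<i> * of_real \<beta>"

text \<open>Rotation by -\<beta> brings the end-point close to the positive real axis, away from the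
  cut of the principal logarithm; after division by R it tends to |z|.\<close>

lemma log_endpoint_asymp:
  assumes z: "z \<noteq> 0" "z = rcis (norm z) (\<beta> - \<phi>')"
  shows "((\<lambda>R. log_endpoint h \<phi>' z \<beta> R - of_real (ln R)) \<longlongrightarrow> of_real (ln (norm z)) + \<i> * of_real \<beta>) at_top"
    and "\<forall>\<^sub>F R in at_top. exp (log_endpoint h \<phi>' z \<beta> R) = of_real R * cis \<phi>' * z - of_real (1 - 2 * h) * lam j"
proof -
  define k where "k = of_real (1 - 2 * h) * lam j * cis (- \<beta>)"
  define q where "q R = of_real (norm z) - k * of_real (1 / R)" for R
  have "((\<lambda>R. of_real (norm z) - k * of_real (1 / R)) \<longlongrightarrow> of_real (norm z) - k * of_real 0) at_top"
    by (intro tendsto_intros tendsto_of_real real_tendsto_divide_at_top[OF tendsto_const] filterlim_ident)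
  then have q: "(q \<longlongrightarrow> of_real (norm z)) at_top" by (simp add: q_def[abs_def])
  have nz: "0 < norm z" using z(1) by simp
  have q0: "\<forall>\<^sub>F R in at_top. q R \<noteq> 0"
    using tendsto_imp_eventually_ne[OF q, of 0] z(1) by simp
  have eq: "(of_real R * cis \<phi>' * z - of_real (1 - 2 * h) * lam j) * cis (- \<beta>) = of_real R * q R" if "0 < R" for R
  proof -
    have "cis \<phi>' * z * cis (- \<beta>) = of_real (norm z)"
      by (subst z(2)) (simp add: rcis_def cis_mult mult.commute mult.left_commute)
    then have "of_real R * cis \<phi>' * z * cis (- \<beta>) = of_real R * of_real (norm z)"
      by (simp only: mult.assoc)
    moreover have "of_real R * (k * of_real (1 / R)) = k" using that by simp
    ultimately show ?thesis unfolding q_def by (simp only: left_diff_distrib right_diff_distrib k_def)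
  qed
  have "((\<lambda>R. Ln (q R)) \<longlongrightarrow> Ln (of_real (norm z))) at_top"
    by (rule tendsto_Ln[OF q]) (use nz in \<open>simp add: complex_nonpos_Reals_iff\<close>)
  then have "((\<lambda>R. Ln (q R) + \<i> * of_real \<beta>) \<longlongrightarrow> of_real (ln (norm z)) + \<i> * of_real \<beta>) at_top"
    using nz by (intro tendsto_add tendsto_const) (simp add: Ln_of_real)
  moreover have "\<forall>\<^sub>F R in at_top. Ln (q R) + \<i> * of_real \<beta> = log_endpoint h \<phi>' z \<beta> R - of_real (ln R)"
    using q0 eventually_gt_at_top[of 0]
  proof eventually_elim
    case (elim R)
    have "Ln (of_real R * q R) = of_real (ln R) + Ln (q R)" using Ln_times_of_real[of R "q R"] elim by (simp add: Ln_of_real)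
    then show ?case unfolding log_endpoint_def eq[OF elim(2)] by simp
  qed
  ultimately show "((\<lambda>R. log_endpoint h \<phi>' z \<beta> R - of_real (ln R)) \<longlongrightarrow> of_real (ln (norm z)) + \<i> * of_real \<beta>) at_top"
    by (rule Lim_transform_eventually)
  show "\<forall>\<^sub>F R in at_top. exp (log_endpoint h \<phi>' z \<beta> R) = of_real R * cis \<phi>' * z - of_real (1 - 2 * h) * lam j"
    using q0 eventually_gt_at_top[of 0]
  proof eventually_elim
    case (elim R)
    have "exp (log_endpoint h \<phi>' z \<beta> R) = (of_real R * q R) * cis \<beta>"
      unfolding log_endpoint_def eq[OF elim(2)] using elim by (simp add: exp_add cis_conv_exp)
    also have "\<dots> = (of_real R * cis \<phi>' * z - of_real (1 - 2 * h) * lam j) * (cis (- \<beta>) * cis \<beta>)"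
      unfolding eq[OF elim(2), symmetric] by (simp only: mult.assoc)
    finally show ?case by (simp add: cis_mult)
  qed
qed

lemma trajectory_not_sing:
  assumes h: "h = 0 \<or> h = 1" and \<theta>: "\<bar>\<theta>\<bar> < pi / 2" and w: "exp \<omega> = of_real (1 - 2 * h) * w"
    and dom: "\<And>t. 0 < t \<Longrightarrow> lift_path h \<omega> (cis \<theta> * of_real t) \<in> log_domain lam \<alpha> M" and "0 \<le> t"
  shows "w * (1 - exp (- (of_real (1 - 2 * h) * cis \<theta> * of_real t))) \<notin> sing lam j"
proof (cases "t = 0")
  case False
  then have t: "0 < t" using \<open>0 \<le> t\<close> by simp
  have "0 < cos \<theta>" using \<theta> by (intro cos_gt_zero_pi) linarith+
  then have "exp (lift_path h \<omega> (cis \<theta> * of_real t)) = w * (1 - exp (- (of_real (1 - 2 * h) * (cis \<theta> * of_real t))))"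
    using t by (intro trajectory_exp_lift[OF h w]) simp
  then have eq: "w * (1 - exp (- (of_real (1 - 2 * h) * cis \<theta> * of_real t))) = exp (lift_path h \<omega> (cis \<theta> * of_real t))"
    by (simp only: mult.assoc)
  show ?thesis unfolding eq by (rule sing_not_exp_log_domain[OF dom[OF t]])
qed (simp add: zero_not_sing)

text \<open>The path in the definition is forced to be the trajectory, whose value is determined,
  and all side conditions hold. The lower bound on the modulus keeps the end-point itself off the
  singularities.\<close>

lemma is_T_plus_iff:
  assumes R: "0 < R" and \<phi>: "- pi < \<phi>" "\<phi> < pi" and \<theta>: "\<bar>\<theta>\<bar> < pi / 2" and \<theta>\<phi>: "\<bar>\<theta> + \<phi>\<bar> < pi / 2"
    and w: "exp \<omega> = rcis R \<phi> * z - lam j" "exp M < norm (rcis R \<phi> * z - lam j)"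
    and dir: "Im \<omega> + \<theta> \<in> dir_class lam \<alpha>"
    and dom: "\<And>t. 0 < t \<Longrightarrow> lift_path 0 \<omega> (cis \<theta> * of_real t) \<in> log_domain lam \<alpha> M"
    and int: "integrable lborel (half_line (path_integrand 0 \<theta> \<phi> \<omega> R))"
  shows "is_T_plus blk lam A T \<alpha> \<theta> j z (rcis R \<phi>) X \<longleftrightarrow> X = path_value 0 \<theta> \<phi> \<omega> R"
proof -
  define w where "w = rcis R \<phi> * z - lam j"
  have expw: "exp \<omega> = w" using w(1) by (simp add: w_def)
  then have w0: "w \<noteq> 0" by (metis exp_not_eq_zero)
  have val: "has_path_value blk A T j w (rcis R \<phi>) \<gamma> X \<longleftrightarrow> X = path_value 0 \<theta> \<phi> \<omega> R"
    if "trajectory_from_0 (\<lambda>\<sigma>. cis \<theta> * (w - \<sigma>)) \<gamma>" for \<gamma>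
    by (rule has_path_value_iff_path_value[OF _ \<theta> R w0 _ _ dom int]) (use that expw in \<open>simp_all add: rcis_def\<close>)
  show ?thesis
  proof
    assume "is_T_plus blk lam A T \<alpha> \<theta> j z (rcis R \<phi>) X"
    then obtain \<gamma> where "trajectory_from_0 (\<lambda>\<sigma>. cis \<theta> * (w - \<sigma>)) \<gamma>" "has_path_value blk A T j w (rcis R \<phi>) \<gamma> X"
      unfolding is_T_plus_def Let_def w_def[symmetric] by (elim exE conjE)
    then show "X = path_value 0 \<theta> \<phi> \<omega> R" using val by simp
  next
    assume X: "X = path_value 0 \<theta> \<phi> \<omega> R"
    define \<gamma> where "\<gamma> t = w * (1 - exp (- (cis \<theta> * of_real t)))" for t
    have traj: "trajectory_from_0 (\<lambda>\<sigma>. cis \<theta> * (w - \<sigma>)) \<gamma>"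
      unfolding trajectory_from_0_iff by (simp add: \<gamma>_def)
    have cpos: "0 < cos \<theta>" using \<theta> by (intro cos_gt_zero_pi) linarith+
    have "((\<lambda>t. exp (- (cos \<theta> * t))) \<longlongrightarrow> 0) at_top" using cpos by real_asymp
    then have "((\<lambda>t. exp (- (cis \<theta> * of_real t))) \<longlongrightarrow> 0) at_top"
      by (rule tendsto_0_le[where K = 1]) simp
    then have "((\<lambda>t. w * (1 - exp (- (cis \<theta> * of_real t)))) \<longlongrightarrow> w * (1 - 0)) at_top"
      by (intro tendsto_mult tendsto_diff tendsto_const)
    then have lim: "(\<gamma> \<longlongrightarrow> w) at_top" by (simp add: \<gamma>_def[abs_def])
    have ns: "\<gamma> t \<notin> sing lam j" if "0 \<le> t" for t
      using trajectory_not_sing[of 0 \<theta> \<omega> w t] \<theta> expw dom that by (simp add: \<gamma>_def)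
    have "w = rcis (norm w) (Im \<omega>)" using exp_eq_rcis[of \<omega>] norm_exp_eq_Re[of \<omega>] unfolding expw by simp
    then have "\<exists>\<alpha>'\<in>dir_class lam \<alpha>. w = rcis (cmod w) (\<alpha>' - \<theta>)"
      using dir by (intro bexI[of _ "Im \<omega> + \<theta>"]) simp_all
    moreover have "Arg (rcis R \<phi>) = \<phi>" using R \<phi> by (intro Arg_rcis) auto
    moreover have "w \<notin> sing lam j" using w(2) by (intro norm_gt_not_sing) (simp add: w_def)
    ultimately show "is_T_plus blk lam A T \<alpha> \<theta> j z (rcis R \<phi>) X"
      unfolding is_T_plus_def Let_def w_def[symmetric]
      using w0 \<theta> \<theta>\<phi> traj lim ns val[OF traj] X by (intro conjI exI[of _ \<gamma>]) simp_all
  qed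
qed

text \<open>As for T^+, with the reversed field cis(\<theta> - \<pi>) = -cis \<theta>. The
  trajectory now runs to infinity, and its homotopy to the ray comes from its lift to the
  logarithmic domain.\<close>

lemma is_T_minus_iff:
  assumes R: "0 < R" and \<phi>: "0 < \<phi>" "\<phi> < 2 * pi" and \<theta>: "\<bar>\<theta>\<bar> < pi / 2" and \<theta>\<phi>: "\<bar>\<theta> - pi + \<phi>\<bar> < pi / 2"
    and w: "exp \<omega> = - (rcis R \<phi> * z - lam j)"
    and dir: "Im \<omega> + \<theta> \<in> dir_class lam \<alpha>"
    and dom: "\<And>t. 0 < t \<Longrightarrow> lift_path 1 \<omega> (cis \<theta> * of_real t) \<in> log_domain lam \<alpha> M"
    and int: "integrable lborel (half_line (path_integrand 1 \<theta> (\<phi> - pi) \<omega> R))"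
  shows "is_T_minus blk lam A T \<alpha> \<theta> j z (rcis R \<phi>) X \<longleftrightarrow> X = path_value 1 \<theta> (\<phi> - pi) \<omega> R"
proof -
  define w where "w = rcis R \<phi> * z - lam j"
  have expw: "exp \<omega> = - w" using w(1) by (simp add: w_def)
  then have w0: "w \<noteq> 0" by (metis exp_not_eq_zero neg_equal_0_iff_equal)
  have cis_pi: "cis (\<theta> - pi) = - cis \<theta>" "cis (\<phi> - pi) = - cis \<phi>" by (simp_all add: complex_eq_iff)
  have val: "has_path_value blk A T j w (rcis R \<phi>) \<gamma> X \<longleftrightarrow> X = path_value 1 \<theta> (\<phi> - pi) \<omega> R"
    if "trajectory_from_0 (\<lambda>\<sigma>. cis (\<theta> - pi) * (w - \<sigma>)) \<gamma>" for \<gamma>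
    by (rule has_path_value_iff_path_value[OF _ \<theta> R w0 _ _ dom int])
      (use that expw in \<open>simp_all add: rcis_def cis_pi\<close>)
  show ?thesis
  proof
    assume "is_T_minus blk lam A T \<alpha> \<theta> j z (rcis R \<phi>) X"
    then obtain \<gamma> where "trajectory_from_0 (\<lambda>\<sigma>. cis (\<theta> - pi) * (w - \<sigma>)) \<gamma>" "has_path_value blk A T j w (rcis R \<phi>) \<gamma> X"
      unfolding is_T_minus_def Let_def w_def[symmetric] by (elim exE conjE)
    then show "X = path_value 1 \<theta> (\<phi> - pi) \<omega> R" using val by simp
  next
    assume X: "X = path_value 1 \<theta> (\<phi> - pi) \<omega> R"
    define \<gamma> where "\<gamma> t = w * (1 - exp (cis \<theta> * of_real t))" for t
    have traj: "trajectory_from_0 (\<lambda>\<sigma>. cis (\<theta> - pi) * (w - \<sigma>)) \<gamma>"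
      unfolding trajectory_from_0_iff by (simp add: \<gamma>_def cis_pi)
    have cpos: "0 < cos \<theta>" using \<theta> by (intro cos_gt_zero_pi) linarith+
    have lim: "filterlim \<gamma> at_infinity at_top"
    proof (rule filterlim_norm_at_top_imp_at_infinity, rule filterlim_at_top_mono)
      have "filterlim (\<lambda>t. exp (cos \<theta> * t) - 1) at_top at_top" using cpos by real_asymp
      then show "filterlim (\<lambda>t. norm w * (exp (cos \<theta> * t) - 1)) at_top at_top"
        using w0 by (intro filterlim_tendsto_pos_mult_at_top[OF tendsto_const]) auto
      show "\<forall>\<^sub>F t in at_top. norm w * (exp (cos \<theta> * t) - 1) \<le> norm (\<gamma> t)"
      proof (rule always_eventually, rule allI)
        fix t
        have "exp (cos \<theta> * t) - 1 \<le> norm (1 - exp (cis \<theta> * of_real t))"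
          using norm_triangle_ineq2[of "exp (cis \<theta> * of_real t)" 1] by (simp add: norm_minus_commute)
        then show "norm w * (exp (cos \<theta> * t) - 1) \<le> norm (\<gamma> t)"
          unfolding \<gamma>_def norm_mult by (intro mult_left_mono) auto
      qed
    qed
    have ns: "\<gamma> t \<notin> sing lam j" if "0 \<le> t" for t
      using trajectory_not_sing[of 1 \<theta> \<omega> w t] \<theta> expw dom that by (simp add: \<gamma>_def)
    have hom: "homotopic_to_ray (sing lam j) \<alpha> \<gamma>"
    proof (rule lifted_path_homotopic_to_ray[where \<zeta> = "\<lambda>t. lift_path 1 \<omega> (cis \<theta> * of_real t)"])
      show "continuous_on {0<..} (\<lambda>t. lift_path 1 \<omega> (cis \<theta> * of_real t))"
        by (rule continuous_on_compose2[OF continuous_on_lift_path])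
          (use cpos in \<open>auto intro!: continuous_intros\<close>)
      show "exp (lift_path 1 \<omega> (cis \<theta> * of_real t)) = \<gamma> t" if "0 < t" for t
        using trajectory_exp_lift[of 1 \<omega> w "cis \<theta> * of_real t"] cpos that expw by (simp add: \<gamma>_def)
      show "continuous_on {0..} \<gamma>" unfolding \<gamma>_def by (intro continuous_intros)
    qed (use dom lim in \<open>simp_all add: \<gamma>_def\<close>)
    have nw: "norm w = exp (Re \<omega>)" using norm_exp_eq_Re[of \<omega>] unfolding expw by simp
    have "- w = rcis (norm w) (Im \<omega>)" unfolding nw using exp_eq_rcis[of \<omega>] unfolding expw .
    then have "w = - rcis (norm w) (Im \<omega>)" by (metis add.inverse_inverse)
    then have "w = rcis (norm w) (Im \<omega> + pi)" by (simp add: rcis_def complex_eq_iff)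
    then have "\<exists>\<alpha>'\<in>dir_class lam \<alpha>. w = rcis (cmod w) (\<alpha>' - \<theta> + pi)"
      using dir by (intro bexI[of _ "Im \<omega> + \<theta>"]) simp_all
    moreover have "Arg2pi (rcis R \<phi>) = \<phi>" using R \<phi> by (intro Arg2pi_rcis) auto
    ultimately show "is_T_minus blk lam A T \<alpha> \<theta> j z (rcis R \<phi>) X"
      unfolding is_T_minus_def Let_def w_def[symmetric]
      using w0 \<theta> \<theta>\<phi> traj lim ns hom val[OF traj] X by (intro conjI exI[of _ \<gamma>]) simp_all
  qed
qed

text \<open>Collects for both signs what a single value of R has to satisfy. The angular conditions
  are open, hence stable under the convergence of the end-point logarithm after removal of ln
  R.\<close>

lemma eventually_endpoint:
  fixes \<theta>r :: "real \<Rightarrow> real"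
  assumes h: "h = 0 \<or> h = 1" and \<theta>: "\<bar>\<theta>\<bar> < pi / 2" and \<theta>r: "(\<theta>r \<longlongrightarrow> \<theta>) at_top"
    and \<theta>\<phi>: "\<bar>\<theta> + \<phi>\<bar> < pi / 2" and dir: "\<alpha>' \<in> dir_class lam \<alpha>"
    and z: "z \<noteq> 0" "z = rcis (norm z) (\<alpha>' - \<theta> - \<phi>)"
  shows "has_laplace_value blk T \<alpha>' j z (T_lim blk lam T \<alpha> j z)"
    and "((\<lambda>R. path_value h (\<theta>r R) \<phi> (log_endpoint h \<phi> z (\<alpha>' - \<theta>) R) R) \<longlongrightarrow> T_lim blk lam T \<alpha> j z) at_top"
    and "\<forall>\<^sub>F R in at_top. 0 < R \<and> \<bar>\<theta>r R\<bar> < pi / 2 \<and> \<bar>\<theta>r R + \<phi>\<bar> < pi / 2 \<and>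
      exp (log_endpoint h \<phi> z (\<alpha>' - \<theta>) R) = of_real R * cis \<phi> * z - of_real (1 - 2 * h) * lam j \<and>
      exp M < norm (of_real R * cis \<phi> * z - of_real (1 - 2 * h) * lam j) \<and>
      Im (log_endpoint h \<phi> z (\<alpha>' - \<theta>) R) + \<theta>r R \<in> dir_class lam \<alpha> \<and>
      (\<forall>t>0. lift_path h (log_endpoint h \<phi> z (\<alpha>' - \<theta>) R) (cis (\<theta>r R) * of_real t) \<in> log_domain lam \<alpha> M) \<and>
      integrable lborel (half_line (path_integrand h (\<theta>r R) \<phi> (log_endpoint h \<phi> z (\<alpha>' - \<theta>) R) R))"
proof -
  let ?\<omega> = "log_endpoint h \<phi> z (\<alpha>' - \<theta>)" and ?\<omega>' = "of_real (ln (norm z)) + \<i> * of_real (\<alpha>' - \<theta>) :: complex"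
  note asymp = log_endpoint_asymp[OF z, of h]
  have dir': "Im ?\<omega>' + \<theta> \<in> dir_class lam \<alpha>" using dir by simp
  note lap = limit_integral_eq_laplace_value[OF dir z \<theta>\<phi>]
  have T_lim: "T_lim blk lam T \<alpha> j z = laplace_value \<alpha>' z" by (rule T_lim_eq[OF dir lap(1)])
  show "has_laplace_value blk T \<alpha>' j z (T_lim blk lam T \<alpha> j z)"
    unfolding has_laplace_value_iff[OF dir lap(1)] by (rule T_lim)
  show "((\<lambda>R. path_value h (\<theta>r R) \<phi> (?\<omega> R) R) \<longlongrightarrow> T_lim blk lam T \<alpha> j z) at_top"
    using path_value_tendsto[OF h \<theta> \<theta>r asymp(1) \<theta>\<phi> dir'] unfolding lap(2) T_lim .
  have "((\<lambda>R. \<bar>\<theta>r R + \<phi>\<bar>) \<longlongrightarrow> \<bar>\<theta> + \<phi>\<bar>) at_top" by (intro tendsto_intros \<theta>r)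
  then have e1: "\<forall>\<^sub>F R in at_top. \<bar>\<theta>r R + \<phi>\<bar> < pi / 2" using \<theta>\<phi> by (rule order_tendstoD(2))
  have "\<forall>\<^sub>F R in at_top. M < Re (?\<omega> R)"
    using filterlim_Re_omega[OF h \<theta> \<theta>r asymp(1)] by (simp add: filterlim_at_top_dense)
  then have e2: "\<forall>\<^sub>F R in at_top. exp M < norm (of_real R * cis \<phi> * z - of_real (1 - 2 * h) * lam j)"
    using asymp(2)
  proof eventually_elim
    case (elim R)
    show ?case unfolding elim(2)[symmetric] using elim(1) by simp
  qed
  have "((\<lambda>R. Im (?\<omega> R) + \<theta>r R) \<longlongrightarrow> Im ?\<omega>' + \<theta>) at_top"
    by (intro tendsto_add \<theta>r tendsto_Im_omega[OF h \<theta> \<theta>r asymp(1)])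
  then have e3: "\<forall>\<^sub>F R in at_top. Im (?\<omega> R) + \<theta>r R \<in> dir_class lam \<alpha>"
    using open_dir_class[OF inj \<alpha>] dir' by (rule topological_tendstoD)
  show "\<forall>\<^sub>F R in at_top. 0 < R \<and> \<bar>\<theta>r R\<bar> < pi / 2 \<and> \<bar>\<theta>r R + \<phi>\<bar> < pi / 2 \<and>
      exp (?\<omega> R) = of_real R * cis \<phi> * z - of_real (1 - 2 * h) * lam j \<and>
      exp M < norm (of_real R * cis \<phi> * z - of_real (1 - 2 * h) * lam j) \<and>
      Im (?\<omega> R) + \<theta>r R \<in> dir_class lam \<alpha> \<and>
      (\<forall>t>0. lift_path h (?\<omega> R) (cis (\<theta>r R) * of_real t) \<in> log_domain lam \<alpha> M) \<and>
      integrable lborel (half_line (path_integrand h (\<theta>r R) \<phi> (?\<omega> R) R))"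
    using eventually_gt_at_top[of 0] eventually_theta[OF h \<theta> \<theta>r asymp(1)] e1 asymp(2) e2 e3
      path_integrand_limit(1)[OF h \<theta> \<theta>r asymp(1) \<theta>\<phi> dir'] path_integrand_limit(2)[OF h \<theta> \<theta>r asymp(1) \<theta>\<phi> dir']
    by eventually_elim (intro conjI; (elim conjE)?; assumption)
qed

lemma T_plus_convergence:
  fixes \<theta>r :: "real \<Rightarrow> real"
  assumes \<theta>: "\<bar>\<theta>\<bar> < pi / 2" and \<theta>r: "(\<theta>r \<longlongrightarrow> \<theta>) at_top" and \<phi>: "- pi < \<phi>" "\<phi> < pi"
    and \<theta>\<phi>: "\<bar>\<theta> + \<phi>\<bar> < pi / 2" and dir: "\<alpha>' \<in> dir_class lam \<alpha>"
    and z: "z \<noteq> 0" "z = rcis (norm z) (\<alpha>' - \<theta> - \<phi>)"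
  shows "\<forall>\<^sub>F R in at_top. \<exists>!X. is_T_plus blk lam A T \<alpha> (\<theta>r R) j z (rcis R \<phi>) X"
    and "((\<lambda>R. T_plus blk lam A T \<alpha> (\<theta>r R) j z (rcis R \<phi>)) \<longlongrightarrow> T_lim blk lam T \<alpha> j z) at_top"
    and "\<forall>\<^sub>F R in at_top. block_col blk j (T_plus blk lam A T \<alpha> (\<theta>r R) j z (rcis R \<phi>))
      = T_plus blk lam A T \<alpha> (\<theta>r R) j z (rcis R \<phi>)"
proof -
  let ?p = "\<lambda>R. path_value 0 (\<theta>r R) \<phi> (log_endpoint 0 \<phi> z (\<alpha>' - \<theta>) R) R"
  have h: "(0::real) = 0 \<or> (0::real) = 1" by simp
  note end_point = eventually_endpoint[OF h \<theta> \<theta>r \<theta>\<phi> dir z]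
  have iff: "\<forall>\<^sub>F R in at_top. \<forall>X. is_T_plus blk lam A T \<alpha> (\<theta>r R) j z (rcis R \<phi>) X \<longleftrightarrow> X = ?p R"
    using end_point(3)
    by eventually_elim (intro allI is_T_plus_iff \<phi>, simp_all add: rcis_def)
  show "\<forall>\<^sub>F R in at_top. \<exists>!X. is_T_plus blk lam A T \<alpha> (\<theta>r R) j z (rcis R \<phi>) X"
    using iff by eventually_elim simp
  have eq: "\<forall>\<^sub>F R in at_top. ?p R = T_plus blk lam A T \<alpha> (\<theta>r R) j z (rcis R \<phi>)"
    using iff by eventually_elim (simp add: T_plus_def)
  show "((\<lambda>R. T_plus blk lam A T \<alpha> (\<theta>r R) j z (rcis R \<phi>)) \<longlongrightarrow> T_lim blk lam T \<alpha> j z) at_top"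
    by (rule Lim_transform_eventually[OF end_point(2) eq])
  show "\<forall>\<^sub>F R in at_top. block_col blk j (T_plus blk lam A T \<alpha> (\<theta>r R) j z (rcis R \<phi>))
      = T_plus blk lam A T \<alpha> (\<theta>r R) j z (rcis R \<phi>)"
    using eq by eventually_elim (metis block_col_path_value)
qed

text \<open>Passing from \<rho> to -\<rho> is a half-turn, so the general estimates apply with h = 1
  and \<phi> - \<pi> as the angle.\<close>

lemma T_minus_convergence:
  fixes \<theta>r :: "real \<Rightarrow> real"
  assumes \<theta>: "\<bar>\<theta>\<bar> < pi / 2" and \<theta>r: "(\<theta>r \<longlongrightarrow> \<theta>) at_top" and \<phi>: "0 < \<phi>" "\<phi> < 2 * pi"
    and \<theta>\<phi>: "\<bar>\<theta> - pi + \<phi>\<bar> < pi / 2" and dir: "\<alpha>' \<in> dir_class lam \<alpha>"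
    and z: "z \<noteq> 0" "z = rcis (norm z) (\<alpha>' - \<theta> + pi - \<phi>)"
  shows "\<forall>\<^sub>F R in at_top. \<exists>!X. is_T_minus blk lam A T \<alpha> (\<theta>r R) j z (rcis R \<phi>) X"
    and "((\<lambda>R. T_minus blk lam A T \<alpha> (\<theta>r R) j z (rcis R \<phi>)) \<longlongrightarrow> T_lim blk lam T \<alpha> j z) at_top"
    and "\<forall>\<^sub>F R in at_top. block_col blk j (T_minus blk lam A T \<alpha> (\<theta>r R) j z (rcis R \<phi>))
      = T_minus blk lam A T \<alpha> (\<theta>r R) j z (rcis R \<phi>)"
    and "has_laplace_value blk T \<alpha>' j z (T_lim blk lam T \<alpha> j z)"
proof -
  let ?p = "\<lambda>R. path_value 1 (\<theta>r R) (\<phi> - pi) (log_endpoint 1 (\<phi> - pi) z (\<alpha>' - \<theta>) R) R"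
  have h: "(1::real) = 0 \<or> (1::real) = 1" by simp
  have \<theta>\<phi>': "\<bar>\<theta> + (\<phi> - pi)\<bar> < pi / 2" using \<theta>\<phi> by (simp add: algebra_simps)
  have z': "z = rcis (norm z) (\<alpha>' - \<theta> - (\<phi> - pi))" using z(2) by (simp add: algebra_simps)
  note end_point = eventually_endpoint[OF h \<theta> \<theta>r \<theta>\<phi>' dir z(1) z']
  have cis_pi: "cis (\<phi> - pi) = - cis \<phi>" by (simp add: complex_eq_iff)
  show "has_laplace_value blk T \<alpha>' j z (T_lim blk lam T \<alpha> j z)" by (rule end_point(1))
  have iff: "\<forall>\<^sub>F R in at_top. \<forall>X. is_T_minus blk lam A T \<alpha> (\<theta>r R) j z (rcis R \<phi>) X \<longleftrightarrow> X = ?p R"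
    using end_point(3)
    by eventually_elim (intro allI is_T_minus_iff \<phi>, simp_all add: rcis_def cis_pi algebra_simps)
  show "\<forall>\<^sub>F R in at_top. \<exists>!X. is_T_minus blk lam A T \<alpha> (\<theta>r R) j z (rcis R \<phi>) X"
    using iff by eventually_elim simp
  have eq: "\<forall>\<^sub>F R in at_top. ?p R = T_minus blk lam A T \<alpha> (\<theta>r R) j z (rcis R \<phi>)"
    using iff by eventually_elim (simp add: T_minus_def)
  show "((\<lambda>R. T_minus blk lam A T \<alpha> (\<theta>r R) j z (rcis R \<phi>)) \<longlongrightarrow> T_lim blk lam T \<alpha> j z) at_top"
    by (rule Lim_transform_eventually[OF end_point(2) eq])
  show "\<forall>\<^sub>F R in at_top. block_col blk j (T_minus blk lam A T \<alpha> (\<theta>r R) j z (rcis R \<phi>))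
      = T_minus blk lam A T \<alpha> (\<theta>r R) j z (rcis R \<phi>)"
    using eq by eventually_elim (metis block_col_path_value)
qed

end

lemma borel_lift_data_exists:
  assumes "formal_transformation blk lam A T" "inj lam" "\<alpha> \<in> nonsingular_dirs lam"
  shows "\<exists>V M \<epsilon>. borel_lift_data blk lam T j \<alpha> V M \<epsilon>"
  using assms by (rule borel_lift[where j = j]) (rule exI, rule exI, rule exI, rule borel_lift_data.intro; (rule assms | assumption))

text \<open>\<open>T_plus\<close> and \<open>T_minus\<close> depend on the trajectory parameter, so
  it may vary with the block and with |\<rho>| as long as it tends to \<theta>. The eventual unique
  existence shows that the definite descriptions denote genuine values.\<close>

theorem mainTheorem2:
  fixes blk :: "'n::finite \<Rightarrow> 'p::finite"
    and lam :: "'p \<Rightarrow> complex"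
    and A :: "complex^'n^'n"
    and T :: "complex fps^'n^'n"
    and lg :: "complex \<Rightarrow> complex"
    and S :: "complex set"
    and z :: complex
    and \<eta> \<alpha> \<alpha>' \<theta> \<phi> :: real
    and th :: "'p \<Rightarrow> real \<Rightarrow> real"
  assumes "surj blk" and "inj lam"
    and "nonresonant blk A"
    and "formal_transformation blk lam A T"
    and "0 < \<eta>" and "\<eta> < pi / 2"
    and "\<alpha> \<in> nonsingular_dirs lam"
    and "\<alpha>' \<in> dir_class lam \<alpha>"
    and "\<bar>\<theta>\<bar> < pi / 2"
    and "\<And>j. (th j \<longlongrightarrow> \<theta>) at_top"
    and "log_branch S lg" and "z \<in> S" and "z \<noteq> 0"
  shows "(\<phi> \<in> {- pi + \<eta> <..< pi - \<eta>} \<and> \<bar>\<theta> + \<phi>\<bar> < pi / 2 \<and> z = rcis (cmod z) (\<alpha>' - \<theta> - \<phi>) \<longrightarrow>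
      (\<forall>\<^sub>F R in at_top. rcis R \<phi> \<in> P_plus blk A \<eta> \<and>
         (\<forall>j. \<exists>!V. is_T_plus blk lam A T \<alpha> (th j R) j z (rcis R \<phi>) V)) \<and>
      (\<forall>j. has_laplace_value blk T \<alpha>' j z (T_lim blk lam T \<alpha> j z) \<and>
         ((\<lambda>R. T_plus blk lam A T \<alpha> (th j R) j z (rcis R \<phi>)) \<longlongrightarrow> T_lim blk lam T \<alpha> j z) at_top) \<and>
      ((\<lambda>R. Y_plus blk lam A T lg \<alpha> (\<lambda>j. th j R) z (rcis R \<phi>)) \<longlongrightarrow> Psi blk lam A T lg \<alpha> z) at_top)
    \<and> (\<phi> \<in> {\<eta> <..< 2 * pi - \<eta>} \<and> \<bar>\<theta> - pi + \<phi>\<bar> < pi / 2 \<and>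
        z = rcis (cmod z) (\<alpha>' - \<theta> + pi - \<phi>) \<longrightarrow>
      (\<forall>\<^sub>F R in at_top. rcis R \<phi> \<in> P_minus blk A \<eta> \<and>
         (\<forall>j. \<exists>!V. is_T_minus blk lam A T \<alpha> (th j R) j z (rcis R \<phi>) V)) \<and>
      (\<forall>j. has_laplace_value blk T \<alpha>' j z (T_lim blk lam T \<alpha> j z) \<and>
         ((\<lambda>R. T_minus blk lam A T \<alpha> (th j R) j z (rcis R \<phi>)) \<longlongrightarrow> T_lim blk lam T \<alpha> j z) at_top) \<and>
      ((\<lambda>R. Y_minus blk lam A T lg \<alpha> (\<lambda>j. th j R) z (rcis R \<phi>)) \<longlongrightarrow> Psi blk lam A T lg \<alpha> z) at_top)"
proof (intro conjI impI)
  have data: "\<exists>V M \<epsilon>. borel_lift_data blk lam T j \<alpha> V M \<epsilon>" for j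
    by (rule borel_lift_data_exists[OF assms(4,2,7)])
  {
    assume "\<phi> \<in> {- pi + \<eta> <..< pi - \<eta>} \<and> \<bar>\<theta> + \<phi>\<bar> < pi / 2 \<and> z = rcis (cmod z) (\<alpha>' - \<theta> - \<phi>)"
    then have sector: "\<phi> \<in> {- pi + \<eta> <..< pi - \<eta>}" and \<theta>\<phi>: "\<bar>\<theta> + \<phi>\<bar> < pi / 2"
      and z: "z = rcis (cmod z) (\<alpha>' - \<theta> - \<phi>)" by auto
    have \<phi>: "- pi < \<phi>" "\<phi> < pi" using sector \<open>0 < \<eta>\<close> by auto
    have conv: "(\<forall>\<^sub>F R in at_top. \<exists>!V. is_T_plus blk lam A T \<alpha> (th j R) j z (rcis R \<phi>) V) \<and>
        has_laplace_value blk T \<alpha>' j z (T_lim blk lam T \<alpha> j z) \<and>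
        ((\<lambda>R. T_plus blk lam A T \<alpha> (th j R) j z (rcis R \<phi>)) \<longlongrightarrow> T_lim blk lam T \<alpha> j z) at_top \<and>
        (\<forall>\<^sub>F R in at_top. block_col blk j (T_plus blk lam A T \<alpha> (th j R) j z (rcis R \<phi>))
          = T_plus blk lam A T \<alpha> (th j R) j z (rcis R \<phi>))" for j
    proof -
      obtain V M \<epsilon> where "borel_lift_data blk lam T j \<alpha> V M \<epsilon>" using data by blast
      then interpret borel_lift_data blk lam A T j \<alpha> V M \<epsilon> .
      have h: "(0::real) = 0 \<or> (0::real) = 1" by simp
      show ?thesis
        by (intro conjI T_plus_convergence[OF assms(9,10) \<phi> \<theta>\<phi> assms(8) \<open>z \<noteq> 0\<close> z]
            eventually_endpoint(1)[OF h assms(9,10) \<theta>\<phi> assms(8) \<open>z \<noteq> 0\<close> z])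
    qed
    have "\<forall>\<^sub>F R in at_top. \<forall>j. \<exists>!V. is_T_plus blk lam A T \<alpha> (th j R) j z (rcis R \<phi>) V"
      by (rule eventually_all_finite) (use conv in blast)
    with eventually_P_plus[OF \<open>0 < \<eta>\<close> sector]
    show "\<forall>\<^sub>F R in at_top. rcis R \<phi> \<in> P_plus blk A \<eta> \<and>
        (\<forall>j. \<exists>!V. is_T_plus blk lam A T \<alpha> (th j R) j z (rcis R \<phi>) V)"
      by (rule eventually_conj)
    show "\<forall>j. has_laplace_value blk T \<alpha>' j z (T_lim blk lam T \<alpha> j z) \<and>
        ((\<lambda>R. T_plus blk lam A T \<alpha> (th j R) j z (rcis R \<phi>)) \<longlongrightarrow> T_lim blk lam T \<alpha> j z) at_top"
      using conv by blast
    show "((\<lambda>R. Y_plus blk lam A T lg \<alpha> (\<lambda>j. th j R) z (rcis R \<phi>)) \<longlongrightarrow> Psi blk lam A T lg \<alpha> z) at_top"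
      unfolding Y_plus_def Psi_def
      by (rule mult_Phi_tendsto[OF \<open>z \<noteq> 0\<close>]) (use conv in blast)+
  }
  {
    assume "\<phi> \<in> {\<eta> <..< 2 * pi - \<eta>} \<and> \<bar>\<theta> - pi + \<phi>\<bar> < pi / 2 \<and> z = rcis (cmod z) (\<alpha>' - \<theta> + pi - \<phi>)"
    then have sector: "\<phi> \<in> {\<eta> <..< 2 * pi - \<eta>}" and \<theta>\<phi>: "\<bar>\<theta> - pi + \<phi>\<bar> < pi / 2"
      and z: "z = rcis (cmod z) (\<alpha>' - \<theta> + pi - \<phi>)" by auto
    have \<phi>: "0 < \<phi>" "\<phi> < 2 * pi" using sector \<open>0 < \<eta>\<close> by auto
    have conv: "(\<forall>\<^sub>F R in at_top. \<exists>!V. is_T_minus blk lam A T \<alpha> (th j R) j z (rcis R \<phi>) V) \<and>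
        has_laplace_value blk T \<alpha>' j z (T_lim blk lam T \<alpha> j z) \<and>
        ((\<lambda>R. T_minus blk lam A T \<alpha> (th j R) j z (rcis R \<phi>)) \<longlongrightarrow> T_lim blk lam T \<alpha> j z) at_top \<and>
        (\<forall>\<^sub>F R in at_top. block_col blk j (T_minus blk lam A T \<alpha> (th j R) j z (rcis R \<phi>))
          = T_minus blk lam A T \<alpha> (th j R) j z (rcis R \<phi>))" for j
    proof -
      obtain V M \<epsilon> where "borel_lift_data blk lam T j \<alpha> V M \<epsilon>" using data by blast
      then interpret borel_lift_data blk lam A T j \<alpha> V M \<epsilon> .
      show ?thesis
        by (intro conjI T_minus_convergence[OF assms(9,10) \<phi> \<theta>\<phi> assms(8) \<open>z \<noteq> 0\<close> z])
    qed
    have "\<forall>\<^sub>F R in at_top. \<forall>j. \<exists>!V. is_T_minus blk lam A T \<alpha> (th j R) j z (rcis R \<phi>) V"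
      by (rule eventually_all_finite) (use conv in blast)
    with eventually_P_minus[OF \<open>0 < \<eta>\<close> sector]
    show "\<forall>\<^sub>F R in at_top. rcis R \<phi> \<in> P_minus blk A \<eta> \<and>
        (\<forall>j. \<exists>!V. is_T_minus blk lam A T \<alpha> (th j R) j z (rcis R \<phi>) V)"
      by (rule eventually_conj)
    show "\<forall>j. has_laplace_value blk T \<alpha>' j z (T_lim blk lam T \<alpha> j z) \<and>
        ((\<lambda>R. T_minus blk lam A T \<alpha> (th j R) j z (rcis R \<phi>)) \<longlongrightarrow> T_lim blk lam T \<alpha> j z) at_top"
      using conv by blast
    show "((\<lambda>R. Y_minus blk lam A T lg \<alpha> (\<lambda>j. th j R) z (rcis R \<phi>)) \<longlongrightarrow> Psi blk lam A T lg \<alpha> z) at_top"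
      unfolding Y_minus_def Psi_def
      by (rule mult_Phi_tendsto[OF \<open>z \<noteq> 0\<close>]) (use conv in blast)+
  }
qed

end
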